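(* Let $\lambda,\rho$ be $\sigma$-finite measures on a measurable space $(\mathbb X,\mathcal X)$ such that $\lambda\ll\rho$ with density $h_\lambda$, and let $h:\mathbb X\to\mathbb R$ be measurable. Assume that $$\int(1-h_\lambda)^2\,\mathrm d\rho+\int h^2\,\mathrm d\rho<\infty.$$ Let $\theta_0\in\mathbb R$ and let $I\subset\mathbb R$ be an interval with non-empty interior such that $\theta_0\in I$ and $h_\theta:=h_\lambda+(\theta-\theta_0)h\ge0$ $\rho$-a.e. for every $\theta\in I$. For $\theta\in I$ let $\lambda_\theta$ denote the measure with density $h_\theta$ with respect to $\rho$. Let $f:\mathbf N\to\mathbb R$ be a measurable function such that $\mathbb E_\rho f(\Phi)^2<\infty$. Then $$\mathbb E_{\lambda_\theta}f(\Phi)=\mathbb E_\lambda f(\Phi)+\sum_{n=1}^\infty\frac{(\theta-\theta_0)^n}{n!}\int\big(\mathbb E_\lambda D^nf(\Phi)\big)h^{\otimes n}\,\mathrm d\rho^n,\qquad\theta\in I,$$ where the series converges absolutely. Moreover, $$\frac{\mathrm d}{\mathrm d\theta}\mathbb E_{\lambda_\theta}f(\Phi)=\int\big(\mathbb E_{\lambda_\theta}D_xf(\Phi)\big)h(x)\,\rho(\mathrm dx),\qquad\theta\in I.$$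
   Context: $\mathbf N$ is the space of $\sigma$-finite measures $\varphi$ on $\mathbb X$ with values in $\{0,1,2,\ldots\}\cup\{\infty\}$, equipped with the smallest $\sigma$-field making all maps $\varphi\mapsto\varphi(B)$, $B\in\mathcal X$, measurable. For a $\sigma$-finite measure $\lambda$ on $\mathbb X$, $\Pi_\lambda$ denotes the distribution (on $\mathbf N$) of a Poisson process with intensity measure $\lambda$. $\Phi:\Omega\to\mathbf N$ is a fixed measurable map on a measurable space $\Omega$, and $\mathbb P_\lambda$ is a probability measure on $\Omega$ with $\mathbb P_\lambda(\Phi\in\cdot)=\Pi_\lambda$; $\mathbb E_\lambda$ is the corresponding expectation. For $f:\mathbf N\to\mathbb R$ measurable, $n\in\mathbb N$ and $x_1,\ldots,x_n\in\mathbb X$, $$D^n_{x_1,\ldots,x_n}f(\varphi)=\sum_{J\subset\{1,\ldots,n\}}(-1)^{n-|J|}f\Big(\varphi+\sum_{j\in J}\delta_{x_j}\Big),$$ and $D_x=D^1_x$, i.e. $D_xf(\varphi)=f(\varphi+\delta_x)-f(\varphi)$. $\mathbb E_\lambda D^nf(\Phi)$ denotes the function $(x_1,\ldots,x_n)\mapsto\mathbb E_\lambda D^n_{x_1,\ldots,x_n}f(\Phi)$; such functions are understood almost everywhere with respect to the (total variation of the) measure against which they are integrated. $h^{\otimes n}(x_1,\ldots,x_n):=\prod_{j=1}^nh(x_j)$. At an endpoint of $I$ belonging to $I$ the derivative is one-sided. *)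

theory Defs
  imports "HOL-Probability.Probability"
begin

text \<open>
  The space of counting measures. Only the measurable structure of \<open>X\<close> matters; the
  \<open>\<sigma>\<close>-algebra is the one generated by the evaluations, as for \<^const>\<open>subprob_algebra\<close>.
\<close>

definition counting_measures :: "'a measure \<Rightarrow> 'a measure set" where
  "counting_measures X =
    {\<phi>. sets \<phi> = sets X \<and> sigma_finite_measure \<phi> \<and>
        (\<forall>B\<in>sets X. emeasure \<phi> B \<in> range ennreal_of_enat)}"

definition counting_space :: "'a measure \<Rightarrow> 'a measure measure" where
  "counting_space X =
    (SUP B\<in>sets X. vimage_algebra (counting_measures X) (\<lambda>\<phi>. emeasure \<phi> B) borel)"

text \<open>
  The Poisson distribution on \<open>{0, 1, 2, \<dots>} \<union> {\<infinity>}\<close>, including the degenerate parameters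
  \<open>0\<close> and \<open>\<infinity>\<close>; \<^const>\<open>poisson_pmf\<close> is specified for positive finite rates only.
\<close>

definition poisson_dist :: "ennreal \<Rightarrow> ennreal measure" where
  "poisson_dist c =
    (if c = 0 then return borel 0
     else if c = \<infinity> then return borel \<infinity>
     else distr (measure_pmf (poisson_pmf (enn2real c))) borel of_nat)"

text \<open>
  \<open>poisson_law \<lambda> Q\<close> says that \<open>Q\<close> is the distribution \<open>\<Pi>\<^sub>\<lambda>\<close> of a Poisson process with
  intensity measure \<open>\<lambda>\<close>: Poisson distributed counts, independent over disjoint sets.
  These properties fix all finite-dimensional distributions and hence determine \<open>Q\<close>.
\<close>

definition poisson_law :: "'a measure \<Rightarrow> 'a measure measure \<Rightarrow> bool" where
  "poisson_law lam Q \<longleftrightarrow>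
    prob_space Q \<and> sets Q = sets (counting_space lam) \<and>
    (\<forall>B\<in>sets lam. distr Q borel (\<lambda>\<phi>. emeasure \<phi> B) = poisson_dist (emeasure lam B)) \<and>
    (\<forall>(m::nat) B. (\<forall>i<m. B i \<in> sets lam) \<and> disjoint_family_on B {..<m} \<longrightarrow>
       prob_space.indep_vars Q (\<lambda>_. borel) (\<lambda>i \<phi>. emeasure \<phi> (B i)) {..<m})"

text \<open>\<open>\<phi> + (\<Sum>j\<in>J. \<delta>\<^bsub>x j\<^esub>)\<close>, where \<open>\<delta>\<^sub>y\<close> is \<open>return X y\<close>.\<close>

definition add_points :: "'a measure \<Rightarrow> 'a measure \<Rightarrow> (nat \<Rightarrow> 'a) \<Rightarrow> nat set \<Rightarrow> 'a measure" where
  "add_points X \<phi> x J =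
    measure_of (space X) (sets X) (\<lambda>B. emeasure \<phi> B + (\<Sum>j\<in>J. emeasure (return X (x j)) B))"

lemma sets_add_points [simp]: "sets (add_points X \<phi> x J) = sets X"
  by (simp add: add_points_def)

lemma emeasure_add_points:
  assumes "sets \<phi> = sets X" "B \<in> sets X"
  shows "emeasure (add_points X \<phi> x J) B = emeasure \<phi> B + (\<Sum>j\<in>J. indicator B (x j))"
proof -
  have "emeasure (add_points X \<phi> x J) B =
      emeasure \<phi> B + (\<Sum>j\<in>J. emeasure (return X (x j)) B)"
  proof (rule emeasure_measure_of[OF add_points_def])
    show "countably_additive (sets (add_points X \<phi> x J))
       (\<lambda>B. emeasure \<phi> B + (\<Sum>j\<in>J. emeasure (return X (x j)) B))"
    proof (unfold countably_additive_def, intro allI impI)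
      fix A :: "nat \<Rightarrow> 'a set"
      assume A: "range A \<subseteq> sets (add_points X \<phi> x J)" "disjoint_family A"
      have "(\<Sum>i. emeasure \<phi> (A i)) = emeasure \<phi> (\<Union>i. A i)"
        using A assms by (intro suminf_emeasure) auto
      moreover have "(\<Sum>i. emeasure (return X (x j)) (A i)) = emeasure (return X (x j)) (\<Union>i. A i)" for j
        using A by (intro suminf_emeasure) auto
      ultimately show "(\<Sum>i. emeasure \<phi> (A i) + (\<Sum>j\<in>J. emeasure (return X (x j)) (A i))) =
          emeasure \<phi> (\<Union>i. A i) + (\<Sum>j\<in>J. emeasure (return X (x j)) (\<Union>i. A i))"
        by (simp add: suminf_add[symmetric] suminf_sum)
    qed
  qed (use assms sets.sets_into_space in \<open>auto simp: positive_def\<close>)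
  then show ?thesis
    using assms by simp
qed

text \<open>The difference operator \<open>D\<^sup>n\<close> at the points \<open>x 1, \<dots>, x n\<close>, and \<open>D\<^sub>y = D\<^sup>1\<^sub>y\<close>.\<close>

definition diff_op ::
    "'a measure \<Rightarrow> nat \<Rightarrow> (nat \<Rightarrow> 'a) \<Rightarrow> ('a measure \<Rightarrow> real) \<Rightarrow> 'a measure \<Rightarrow> real" where
  "diff_op X n x f \<phi> = (\<Sum>J\<in>Pow {1..n}. (-1) ^ (n - card J) * f (add_points X \<phi> x J))"

definition diff1 ::
    "'a measure \<Rightarrow> 'a \<Rightarrow> ('a measure \<Rightarrow> real) \<Rightarrow> 'a measure \<Rightarrow> real" where
  "diff1 X y f \<phi> = diff_op X 1 (\<lambda>_. y) f \<phi>"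

lemma diff1_eq:
  assumes "sets \<phi> = sets X"
  shows "diff1 X y f \<phi> = f (add_points X \<phi> (\<lambda>_. y) {1}) - f \<phi>"
proof -
  have "add_points X \<phi> (\<lambda>_. y) {} = \<phi>"
    by (rule measure_eqI) (use assms in \<open>auto simp: emeasure_add_points\<close>)
  moreover have "Pow {1..1::nat} = {{}, {1}}"
    by auto
  ultimately show ?thesis
    by (simp add: diff1_def diff_op_def)
qed

text \<open>
  The measure with density \<open>h\<^sub>\<theta> = h\<^sub>\<lambda> + (\<theta> - \<theta>\<^sub>0) h\<close> with respect to \<open>\<rho>\<close>; it is used only
  where this density is nonnegative almost everywhere.
\<close>

definition perturbed :: "'a measure \<Rightarrow> ('a \<Rightarrow> real) \<Rightarrow> ('a \<Rightarrow> real) \<Rightarrow> real \<Rightarrow> real \<Rightarrow> 'a measure" where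
  "perturbed \<rho> hlam h \<theta>0 \<theta> = density \<rho> (\<lambda>x. ennreal (hlam x + (\<theta> - \<theta>0) * h x))"

end

theory Submission
  imports Defs
begin

text \<open>
  For a simple function \<open>u \<ge> 0\<close> supported on a set of finite \<open>\<rho>\<close>-measure put
  \<open>F u \<phi> = exp (- \<integral>u d\<phi>)\<close> and \<open>v = exp (- u) - 1\<close>. If \<open>s = (\<Sum>i. c i * F (u i))\<close> and
  \<open>a i = c i * exp (\<integral>v i d\<rho>)\<close>, then the Laplace functional of a Poisson process gives
  \<open>E\<^sub>\<rho> s\<^sup>2 = (\<Sum>i j. a i * a j * exp \<langle>v i, v j\<rangle>)\<close>, and for the intensity with density \<open>1 + g\<close> it gives
  \<open>E (D\<^sup>n s) = (\<Sum>i. a i * exp \<langle>v i, g\<rangle> * (v i)\<^sup>\<otimes>\<^sup>n)\<close>, because \<open>D\<^sup>n (F u) = F u * v\<^sup>\<otimes>\<^sup>n\<close>.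
  On the span of the \<open>F u\<close> the expansion is therefore the power series of the exponential function.

  Positive semidefiniteness of the kernels \<open>exp \<langle>v i, v j\<rangle>\<close> bounds the \<open>L\<^sup>2(\<rho>\<^sup>n)\<close>-norm of \<open>E (D\<^sup>n s)\<close> by
  \<open>sqrt (n! * 2^n) * exp ((norm g)\<^sup>2)\<close> times the norm of \<open>s\<close> in \<open>L\<^sup>2(\<Pi>\<^sub>\<rho>)\<close>. The span is dense, so both
  sides of the expansion extend continuously to all square integrable \<open>f\<close>. No likelihood ratio, chaos
  expansion or Mecke formula is needed. The derivative at \<open>\<theta>\<close> is the linear coefficient of the expansion
  about \<open>\<theta>\<close> instead of \<open>\<theta>0\<close>.
\<close>

subsection \<open>Laplace functionals of Poisson processes\<close>

text \<open>Closeness of s to f in L2 of \<open>Q0\<close> says nothing by itself about f on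
  configurations with added points, nor about its mean under another intensity: both evaluate f
  along laws whose null sets must first be compared with those of \<open>Q0\<close>. On the span,
  the integral against such a law is again a combination of moments of the numbers <v i, w> for a
  weight w, hence bounded by the norm of s. Density of the span in two L2 spaces at once turns this
  into a bound for all f, so E D^n f exists almost everywhere and depends continuously on f. Only
  then can the sharp L2 bound be carried from s to f.

  The constant comes from exp V = exp (V/2) * exp (V/2). One half pays for the factors exp <v i, g>:
  adjoining the vector 2 g and taking a Schur complement costs exp (2 |g|^2). The other half pays
  for V^n at the price n! 2^n. The square root of the product, divided by n!, is summable against
  every geometric sequence, so the expansion converges however large \<theta> - \<theta>0
  is.\<close>

definition expneg :: "ennreal \<Rightarrow> real" where
  "expneg t = (if t = \<infinity> then 0 else exp (- enn2real t))"

lemma expneg_0 [simp]: "expneg 0 = 1"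
  by (simp add: expneg_def)

lemma expneg_nonneg [simp]: "0 \<le> expneg t"
  by (simp add: expneg_def)

lemma expneg_le_1 [simp]: "expneg t \<le> 1"
  by (simp add: expneg_def)

lemma expneg_ennreal [simp]: "0 \<le> t \<Longrightarrow> expneg (ennreal t) = exp (- t)"
  by (simp add: expneg_def)

text \<open>Also true when a summand is infinite, both sides then being 0; infinite counts thus pass
  through all product formulas.\<close>

lemma expneg_add: "expneg (s + t) = expneg s * expneg t"
  by (cases s; cases t) (auto simp: expneg_def exp_add[symmetric] simp flip: ennreal_plus)

lemma expneg_sum: "expneg (\<Sum>i\<in>A. t i) = (\<Prod>i\<in>A. expneg (t i))"
  by (induction A rule: infinite_finite_induct) (auto simp: expneg_add)

lemma expneg_measurable [measurable]: "expneg \<in> borel_measurable borel"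
  unfolding expneg_def[abs_def] by measurable

lemma space_counting_space: "space (counting_space X) = counting_measures X"
  by (auto simp add: counting_space_def space_Sup_eq_UN)

lemma counting_space_cong: "sets X = sets Y \<Longrightarrow> counting_space X = counting_space Y"
  by (simp add: counting_space_def counting_measures_def)

lemma measurable_emeasure_counting_space [measurable]:
  "B \<in> sets X \<Longrightarrow> (\<lambda>\<phi>. emeasure \<phi> B) \<in> borel_measurable (counting_space X)"
  by (auto intro!: measurable_Sup1 measurable_vimage_algebra1 simp: counting_space_def)

lemma measurable_counting_spaceI:
  assumes "\<And>a. a \<in> space M \<Longrightarrow> K a \<in> counting_measures X"
    and "\<And>B. B \<in> sets X \<Longrightarrow> (\<lambda>a. emeasure (K a) B) \<in> borel_measurable M"
  shows "K \<in> measurable M (counting_space X)"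
  using assms
  by (auto intro!: measurable_Sup2 measurable_vimage_algebra2 simp: counting_space_def)

lemma counting_measuresD:
  assumes "\<phi> \<in> counting_measures X"
  shows "sets \<phi> = sets X" "space \<phi> = space X" "sigma_finite_measure \<phi>"
    "\<And>B. B \<in> sets X \<Longrightarrow> emeasure \<phi> B \<in> range ennreal_of_enat"
  using assms sets_eq_imp_space_eq by (auto simp: counting_measures_def)

text \<open>Supplies the generator for the induction over events in
  \<open>approx_bdd_indicator\<close>. Sublevel sets of counts are chosen because their indicators
  are limits of continuous functions of exp (- \<phi> B).\<close>

lemma sets_counting_space_le:
  "sets (counting_space X) = sigma_sets (counting_measures X)
     {{\<phi>\<in>counting_measures X. emeasure \<phi> B \<le> a} | B a. B \<in> sets X}"
  (is "_ = sigma_sets ?W ?G")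
proof
  show "sigma_sets ?W ?G \<subseteq> sets (counting_space X)"
  proof (rule sets.sigma_sets_subset')
    show "?W \<in> sets (counting_space X)"
      using sets.top[of "counting_space X"] by (simp add: space_counting_space)
    have "{\<phi>\<in>space (counting_space X). emeasure \<phi> B \<le> a} \<in> sets (counting_space X)"
      if "B \<in> sets X" for B a
      using that by measurable
    then show "?G \<subseteq> sets (counting_space X)"
      by (auto simp: space_counting_space)
  qed
next
  let ?M = "sigma ?W ?G"
  have sp: "space ?M = ?W" and st: "sets ?M = sigma_sets ?W ?G"
    by (auto intro!: space_measure_of sets_measure_of)
  have "(\<lambda>\<phi>. \<phi>) \<in> measurable ?M (counting_space X)"
  proof (rule measurable_counting_spaceI)
    fix B assume B: "B \<in> sets X"
    show "(\<lambda>\<phi>. emeasure \<phi> B) \<in> borel_measurable ?M"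
    proof (rule borel_measurableI_le)
      fix a
      have "{\<phi>\<in>?W. emeasure \<phi> B \<le> a} \<in> sigma_sets ?W ?G"
        using B by (intro sigma_sets.Basic) auto
      then show "{\<phi> \<in> space ?M. emeasure \<phi> B \<le> a} \<in> sets ?M"
        unfolding sp st .
    qed
  qed (simp only: sp)
  then have "(\<lambda>\<phi>. \<phi>) -` A \<inter> space ?M \<in> sets ?M" if "A \<in> sets (counting_space X)" for A
    using that by (rule measurable_sets)
  then show "sets (counting_space X) \<subseteq> sigma_sets ?W ?G"
    unfolding sp st using sets.sets_into_space[of _ "counting_space X"]
    by (force simp: space_counting_space Int_absorb2)
qed

text \<open>Simplicity makes \<open>exp_fun u\<close> a function of finitely many counts; a support
  of finite measure puts exp (- u) - 1 into L1 and L2 of R; sums stay in the class, so products of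
  exponentials do too.\<close>

definition test_funs :: "'a measure \<Rightarrow> ('a \<Rightarrow> real) set" where
  "test_funs R = {u. simple_function R u \<and> (\<forall>x. 0 \<le> u x) \<and>
     emeasure R {x\<in>space R. u x \<noteq> 0} < \<infinity>}"

definition exp_fun :: "('a \<Rightarrow> real) \<Rightarrow> 'a measure \<Rightarrow> real" where
  "exp_fun u \<phi> = expneg (\<integral>\<^sup>+x. ennreal (u x) \<partial>\<phi>)"

lemma test_funsD:
  assumes "u \<in> test_funs R"
  shows "simple_function R u" "u \<in> borel_measurable R" "0 \<le> u x"
    "emeasure R {x\<in>space R. u x \<noteq> 0} < \<infinity>" "finite (u ` space R)"
  using assms by (auto simp: test_funs_def borel_measurable_simple_function simple_functionD)

lemma test_funs_add:
  assumes "u \<in> test_funs R" "u' \<in> test_funs R"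
  shows "(\<lambda>x. u x + u' x) \<in> test_funs R"
proof -
  note [measurable] = test_funsD(2)[OF assms(1)] test_funsD(2)[OF assms(2)]
  have "emeasure R {x\<in>space R. u x + u' x \<noteq> 0} \<le>
      emeasure R ({x\<in>space R. u x \<noteq> 0} \<union> {x\<in>space R. u' x \<noteq> 0})"
    by (rule emeasure_mono) auto
  also have "\<dots> \<le> emeasure R {x\<in>space R. u x \<noteq> 0} + emeasure R {x\<in>space R. u' x \<noteq> 0}"
    by (rule emeasure_subadditive) measurable
  also have "\<dots> < \<infinity>"
    using assms by (simp add: test_funs_def)
  finally show ?thesis
    using assms by (auto simp: test_funs_def)
qed

lemma zero_test_fun: "(\<lambda>_. 0) \<in> test_funs R"
  by (simp add: test_funs_def)

lemma indicator_test_fun: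
  assumes "B \<in> sets R" "emeasure R B < \<infinity>" "0 \<le> c"
  shows "(\<lambda>x. c * indicator B x) \<in> test_funs R"
proof -
  have "emeasure R {x\<in>space R. c * indicator B x \<noteq> 0} \<le> emeasure R B"
    using assms by (intro emeasure_mono) (auto split: split_indicator_asm)
  then have "emeasure R {x\<in>space R. c * indicator B x \<noteq> 0} < \<infinity>"
    using assms(2) by (rule le_less_trans)
  moreover have "simple_function R (\<lambda>x. c * indicator B x)"
    using assms(1) by (intro simple_function_mult simple_function_const simple_function_indicator)
  ultimately show ?thesis
    using assms(3) by (simp add: test_funs_def)
qed

lemma exp_fun_bounds [simp]: "0 \<le> exp_fun u \<phi>" "exp_fun u \<phi> \<le> 1"
  by (auto simp: exp_fun_def)

lemma exp_fun_0 [simp]: "exp_fun (\<lambda>_. 0) \<phi> = 1"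
  by (simp add: exp_fun_def)

text \<open>The integral of u groups the points by the value y of u. Through this finite product,
  measurability and expectations reduce to counts. A level set with y = 0 may have infinite count;
  its factor is \<open>expneg (0 * \<infinity>)\<close> = 1.\<close>

lemma exp_fun_simple:
  assumes u: "simple_function R u" "\<And>x. 0 \<le> u x" and \<phi>: "\<phi> \<in> counting_measures R"
  shows "exp_fun u \<phi> =
    (\<Prod>y\<in>u ` space R. expneg (ennreal y * emeasure \<phi> (u -` {y} \<inter> space R)))"
proof -
  have sf: "simple_function \<phi> (\<lambda>x. u x)"
    using u(1) counting_measuresD(1)[OF \<phi>] simple_function_cong_algebra sets_eq_imp_space_eq
    by metis
  have "(\<integral>\<^sup>+x. ennreal (u x) \<partial>\<phi>) = (\<integral>\<^sup>+x. (\<Sum>y\<in>u ` space R. ennreal y * indicator (u -` {y} \<inter> space R) x) \<partial>\<phi>)"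
  proof (rule nn_integral_cong)
    fix x assume "x \<in> space \<phi>"
    then have x: "x \<in> space R" using counting_measuresD(2)[OF \<phi>] by simp
    have "(\<Sum>y\<in>u ` space R. ennreal y * indicator (u -` {y} \<inter> space R) x) =
        (\<Sum>y\<in>{u x}. ennreal y * indicator (u -` {y} \<inter> space R) x)"
      using x u simple_functionD(1) by (intro sum.mono_neutral_right) (auto split: split_indicator)
    then show "ennreal (u x) = (\<Sum>y\<in>u ` space R. ennreal y * indicator (u -` {y} \<inter> space R) x)"
      using x by simp
  qed
  also have "\<dots> = (\<Sum>y\<in>u ` space R. ennreal y * emeasure \<phi> (u -` {y} \<inter> space R))"
  proof -
    have [measurable]: "u -` {y} \<inter> space R \<in> sets \<phi>" for y
      using u(1) counting_measuresD(1)[OF \<phi>] by (simp add: simple_functionD)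
    show ?thesis
      by (subst nn_integral_sum) (auto simp: nn_integral_cmult_indicator)
  qed
  finally show ?thesis
    by (simp add: exp_fun_def expneg_sum)
qed

lemma exp_fun_measurable [measurable]:
  assumes u: "u \<in> test_funs R"
  shows "exp_fun u \<in> borel_measurable (counting_space R)"
proof -
  have [measurable]: "u -` {y} \<inter> space R \<in> sets R" for y
    using test_funsD(1)[OF u] by (simp add: simple_functionD)
  have "(\<lambda>\<phi>. \<Prod>y\<in>u ` space R. expneg (ennreal y * emeasure \<phi> (u -` {y} \<inter> space R)))
      \<in> borel_measurable (counting_space R)"
    by measurable
  then show ?thesis
    using exp_fun_simple[OF test_funsD(1,3)[OF u]]
    by (subst measurable_cong) (auto simp: space_counting_space)
qed

lemma exp_fun_add:
  assumes "u \<in> test_funs R" "u' \<in> test_funs R" "\<phi> \<in> counting_measures R"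
  shows "exp_fun (\<lambda>x. u x + u' x) \<phi> = exp_fun u \<phi> * exp_fun u' \<phi>"
proof -
  have [measurable]: "u \<in> borel_measurable \<phi>" "u' \<in> borel_measurable \<phi>"
    using test_funsD(2)[OF assms(1)] test_funsD(2)[OF assms(2)] counting_measuresD(1)[OF assms(3)]
    by (auto cong: measurable_cong_sets)
  have "(\<integral>\<^sup>+x. ennreal (u x + u' x) \<partial>\<phi>) = (\<integral>\<^sup>+x. ennreal (u x) \<partial>\<phi>) + (\<integral>\<^sup>+x. ennreal (u' x) \<partial>\<phi>)"
    using test_funsD(3)[OF assms(1)] test_funsD(3)[OF assms(2)]
    by (subst nn_integral_add[symmetric]) auto
  then show ?thesis
    by (simp add: exp_fun_def expneg_add)
qed

lemma exp_fun_indicator: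
  assumes "B \<in> sets R" "\<phi> \<in> counting_measures R" "0 \<le> c"
  shows "exp_fun (\<lambda>x. c * indicator B x) \<phi> = expneg (ennreal c * emeasure \<phi> B)"
proof -
  have "(\<integral>\<^sup>+x. ennreal (c * indicator B x) \<partial>\<phi>) = (\<integral>\<^sup>+x. ennreal c * indicator B x \<partial>\<phi>)"
    by (intro nn_integral_cong) (auto split: split_indicator)
  also have "\<dots> = ennreal c * emeasure \<phi> B"
    using assms counting_measuresD(1)[OF assms(2)] by (intro nn_integral_cmult_indicator) auto
  finally show ?thesis by (simp add: exp_fun_def)
qed

text \<open>This is the probability generating function of the Poisson law at exp (- y). Rate 0 is
  split off because there \<open>poisson_dist\<close> is a point mass and not built from
  \<open>poisson_pmf\<close>.\<close>

lemma poisson_dist_expneg: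
  assumes "c < \<infinity>" "0 \<le> y"
  shows "(\<integral>t. expneg (ennreal y * t) \<partial>poisson_dist c) = exp ((exp (- y) - 1) * enn2real c)"
proof (cases "c = 0")
  case True
  then show ?thesis
    by (simp add: poisson_dist_def integral_return)
next
  case False
  define r where "r = enn2real c"
  have r: "0 < r"
    using False assms by (auto simp: r_def enn2real_positive_iff zero_less_iff_neq_zero)
  have "(\<integral>t. expneg (ennreal y * t) \<partial>poisson_dist c) =
      (\<integral>n. expneg (ennreal y * of_nat n) \<partial>measure_pmf (poisson_pmf r))"
    using False assms by (auto simp: poisson_dist_def r_def integral_distr)
  also have "\<dots> = (\<integral>n. exp (- y * real n) \<partial>measure_pmf (poisson_pmf r))"
  proof (rule Bochner_Integration.integral_cong)
    fix n :: nat
    have "ennreal y * of_nat n = ennreal (y * real n)"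
      using assms by (simp add: ennreal_mult ennreal_of_nat_eq_real_of_nat)
    then show "expneg (ennreal y * of_nat n) = exp (- y * real n)"
      using assms by simp
  qed simp
  also have "\<dots> = (\<integral>n. pmf (poisson_pmf r) n *\<^sub>R exp (- y * real n) \<partial>count_space UNIV)"
    unfolding measure_pmf_eq_density by (rule integral_density) auto
  also have "\<dots> = exp ((exp (- y) - 1) * r)"
  proof -
    have eq: "pmf (poisson_pmf r) n *\<^sub>R exp (- y * real n) =
        exp (- r) * ((r * exp (- y)) ^ n /\<^sub>R fact n)" for n
      using r by (simp add: power_mult_distrib exp_of_nat_mult[symmetric] mult_ac divide_inverse)
    have s: "(\<lambda>n. pmf (poisson_pmf r) n *\<^sub>R exp (- y * real n)) sums (exp (- r) * exp (r * exp (- y)))"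
      unfolding eq by (intro sums_mult exp_converges)
    have "integrable (count_space UNIV) (\<lambda>n. pmf (poisson_pmf r) n *\<^sub>R exp (- y * real n))"
      using s by (subst integrable_count_space_nat_iff) (auto simp: sums_iff abs_mult)
    then have "(\<lambda>n. pmf (poisson_pmf r) n *\<^sub>R exp (- y * real n)) sums
        (\<integral>n. pmf (poisson_pmf r) n *\<^sub>R exp (- y * real n) \<partial>count_space UNIV)"
      by (rule sums_integral_count_space_nat)
    then have "(\<integral>n. pmf (poisson_pmf r) n *\<^sub>R exp (- y * real n) \<partial>count_space UNIV)
        = exp (- r) * exp (r * exp (- y))"
      using s sums_unique2 by blast
    then show ?thesis
      by (simp add: exp_add[symmetric] algebra_simps)
  qed
  finally show ?thesis by (simp add: r_def)
qed

text \<open>The counts of the level sets of u are independent Poisson variables, so the mean of the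
  product in \<open>exp_fun_simple\<close> factors into generating functions. The hypothesis
  \<open>fin\<close> is separate because the test functions refer to R, while the intensity is
  \<mu>.\<close>

lemma poisson_law_exp_fun:
  assumes Q: "poisson_law \<mu> Q" and st: "sets \<mu> = sets R" and u: "u \<in> test_funs R"
    and fin: "emeasure \<mu> {x\<in>space R. u x \<noteq> 0} < \<infinity>"
  shows "(\<integral>\<phi>. exp_fun u \<phi> \<partial>Q) = exp (\<integral>x. exp (- u x) - 1 \<partial>\<mu>)"
proof -
  interpret Q: prob_space Q using Q by (simp add: poisson_law_def)
  have sp: "space \<mu> = space R" using st by (rule sets_eq_imp_space_eq)
  have setsQ: "sets Q = sets (counting_space R)"
    using Q counting_space_cong[OF st] by (simp add: poisson_law_def)
  have spQ: "space Q = counting_measures R"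
    using sets_eq_imp_space_eq[OF setsQ] by (simp add: space_counting_space)
  note un = test_funsD(3)[OF u] and us = test_funsD(1)[OF u] and um = test_funsD(2)[OF u]
  \<comment> \<open>The value 0 is left out: its level set may have infinite \<mu>-mass, where
    \<open>poisson_dist_expneg\<close> does not apply. The omitted factor is 1.\<close>
  define Y where "Y = u ` space R - {0}"
  have fY: "finite Y" using test_funsD(5)[OF u] by (simp add: Y_def)
  obtain y :: "nat \<Rightarrow> real" and m where y: "bij_betw y {..<m} Y"
    using ex_bij_betw_nat_finite[OF fY] by (auto simp: atLeast0LessThan)
  define B where "B i = u -` {y i} \<inter> space R" for i
  have Bs [measurable]: "B i \<in> sets R" for i
    using us by (simp add: B_def simple_functionD)
  have y0: "0 \<le> y i" "y i \<noteq> 0" if "i < m" for i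
  proof -
    have "y i \<in> Y" using y that by (auto simp: bij_betw_def)
    then show "0 \<le> y i" "y i \<noteq> 0" using un by (auto simp: Y_def)
  qed
  have Bfin: "emeasure \<mu> (B i) < \<infinity>" if "i < m" for i
  proof -
    have "emeasure \<mu> (B i) \<le> emeasure \<mu> {x\<in>space R. u x \<noteq> 0}"
      using y0[OF that] um st
      by (intro emeasure_mono) (auto simp: B_def cong: measurable_cong_sets)
    then show ?thesis using fin by (rule le_less_trans)
  qed
  have inj: "inj_on y {..<m}" using y by (simp add: bij_betw_def)
  have disj: "disjoint_family_on B {..<m}"
    using inj by (auto simp: disjoint_family_on_def B_def dest: inj_onD)
  have sub: "exp_fun u \<phi> = (\<Prod>i<m. expneg (ennreal (y i) * emeasure \<phi> (B i)))"
    if "\<phi> \<in> space Q" for \<phi>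
  proof -
    have "exp_fun u \<phi> = (\<Prod>y\<in>u ` space R. expneg (ennreal y * emeasure \<phi> (u -` {y} \<inter> space R)))"
      using that spQ by (intro exp_fun_simple us un) auto
    also have "\<dots> = (\<Prod>y\<in>Y. expneg (ennreal y * emeasure \<phi> (u -` {y} \<inter> space R)))"
      using test_funsD(5)[OF u] by (intro prod.mono_neutral_right) (auto simp: Y_def)
    also have "\<dots> = (\<Prod>i<m. expneg (ennreal (y i) * emeasure \<phi> (B i)))"
      unfolding B_def by (rule prod.reindex_bij_betw[OF y, symmetric])
    finally show ?thesis .
  qed
  have ind: "Q.indep_vars (\<lambda>_. borel) (\<lambda>i \<phi>. expneg (ennreal (y i) * emeasure \<phi> (B i))) {..<m}"
  proof -
    have "Q.indep_vars (\<lambda>_. borel) (\<lambda>i \<phi>. emeasure \<phi> (B i)) {..<m}"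
      using Q disj Bs unfolding poisson_law_def st by blast
    then show ?thesis
      by (rule Q.indep_vars_compose2) measurable
  qed
  have int: "integrable Q (\<lambda>\<phi>. expneg (ennreal (y i) * emeasure \<phi> (B i)))" for i
  proof (rule Q.integrable_const_bound[where B=1])
    show "(\<lambda>\<phi>. expneg (ennreal (y i) * emeasure \<phi> (B i))) \<in> borel_measurable Q"
      unfolding measurable_cong_sets[OF setsQ refl] by measurable
  qed auto
  have one: "(\<integral>\<phi>. expneg (ennreal (y i) * emeasure \<phi> (B i)) \<partial>Q) =
      exp ((exp (- y i) - 1) * measure \<mu> (B i))" if "i < m" for i
  proof -
    have "(\<integral>\<phi>. expneg (ennreal (y i) * emeasure \<phi> (B i)) \<partial>Q) =
        (\<integral>t. expneg (ennreal (y i) * t) \<partial>distr Q borel (\<lambda>\<phi>. emeasure \<phi> (B i)))"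
      by (subst integral_distr) (auto simp: measurable_cong_sets[OF setsQ refl])
    also have "distr Q borel (\<lambda>\<phi>. emeasure \<phi> (B i)) = poisson_dist (emeasure \<mu> (B i))"
      using Q Bs unfolding poisson_law_def st by blast
    finally show ?thesis
      using poisson_dist_expneg[OF Bfin[OF that] y0(1)[OF that]] by (simp add: measure_def)
  qed
  have "(\<integral>\<phi>. exp_fun u \<phi> \<partial>Q) = (\<integral>\<phi>. (\<Prod>i<m. expneg (ennreal (y i) * emeasure \<phi> (B i))) \<partial>Q)"
    by (intro Bochner_Integration.integral_cong sub) simp
  also have "\<dots> = (\<Prod>i<m. exp ((exp (- y i) - 1) * measure \<mu> (B i)))"
  proof (cases "m = 0")
    case True
    then show ?thesis by (simp add: Q.prob_space)
  next
    case False
    then have "(\<integral>\<phi>. (\<Prod>i<m. expneg (ennreal (y i) * emeasure \<phi> (B i))) \<partial>Q) =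
        (\<Prod>i<m. \<integral>\<phi>. expneg (ennreal (y i) * emeasure \<phi> (B i)) \<partial>Q)"
      by (intro Q.indep_vars_lebesgue_integral ind int) auto
    then show ?thesis using one by simp
  qed
  also have "\<dots> = exp (\<Sum>i<m. (exp (- y i) - 1) * measure \<mu> (B i))"
    by (simp add: exp_sum)
  also have "(\<Sum>i<m. (exp (- y i) - 1) * measure \<mu> (B i)) = (\<integral>x. (\<Sum>i<m. (exp (- y i) - 1) * indicator (B i) x) \<partial>\<mu>)"
  proof (subst Bochner_Integration.integral_sum)
    show "integrable \<mu> (\<lambda>x. (exp (- y i) - 1) * indicator (B i) x)" if "i \<in> {..<m}" for i
      using that Bfin st by (intro integrable_mult_right integrable_real_indicator) auto
    show "(\<Sum>i<m. (exp (- y i) - 1) * measure \<mu> (B i)) = (\<Sum>i<m. \<integral>x. (exp (- y i) - 1) * indicator (B i) x \<partial>\<mu>)"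
      using st sp Bs sets.sets_into_space[OF Bs] by (intro sum.cong) (auto simp: Int_absorb2)
  qed
  also have "\<dots> = (\<integral>x. exp (- u x) - 1 \<partial>\<mu>)"
  proof (rule Bochner_Integration.integral_cong)
    fix x assume "x \<in> space \<mu>"
    then have x: "x \<in> space R" by (simp add: sp)
    show "(\<Sum>i<m. (exp (- y i) - 1) * indicator (B i) x) = exp (- u x) - 1"
    proof (cases "u x = 0")
      case True
      then have "x \<notin> B i" if "i < m" for i
        using y0[OF that] by (auto simp: B_def)
      then show ?thesis using True by simp
    next
      case False
      then have "u x \<in> y ` {..<m}"
        using x y unfolding bij_betw_def Y_def by simp
      then obtain j where j: "j < m" "y j = u x"
        by auto
      have "(\<Sum>i<m. (exp (- y i) - 1) * indicator (B i) x) = (\<Sum>i\<in>{j}. (exp (- y i) - 1) * indicator (B i) x)"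
      proof (intro sum.mono_neutral_right ballI)
        fix i assume "i \<in> {..<m} - {j}"
        then have "y i \<noteq> u x" using j(1) inj_onD[OF inj, of i j] unfolding j(2)[symmetric] by auto
        then show "(exp (- y i) - 1) * indicator (B i) x = 0" by (simp add: B_def)
      qed (use j in auto)
      then show ?thesis using j x by (simp add: B_def)
    qed
  qed simp
  finally show ?thesis .
qed

subsection \<open>Density of the exponential functionals\<close>

inductive_set exp_span :: "'a measure \<Rightarrow> ('a measure \<Rightarrow> real) set" for R :: "'a measure" where
  exp_fun: "u \<in> test_funs R \<Longrightarrow> exp_fun u \<in> exp_span R"
| scale: "s \<in> exp_span R \<Longrightarrow> (\<lambda>\<phi>. c * s \<phi>) \<in> exp_span R"
| add: "s \<in> exp_span R \<Longrightarrow> s' \<in> exp_span R \<Longrightarrow> (\<lambda>\<phi>. s \<phi> + s' \<phi>) \<in> exp_span R"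

lemma const_exp_span: "(\<lambda>_. c) \<in> exp_span R"
  using exp_span.scale[OF exp_span.exp_fun[OF zero_test_fun], of c] by simp

lemma exp_span_measurable:
  "s \<in> exp_span R \<Longrightarrow> s \<in> borel_measurable (counting_space R)"
  by (induction rule: exp_span.induct) (auto intro: exp_fun_measurable)

lemma exp_span_bounded: "s \<in> exp_span R \<Longrightarrow> \<exists>b. \<forall>\<phi>. \<bar>s \<phi>\<bar> \<le> b"
proof (induction rule: exp_span.induct)
  case (exp_fun u)
  then show ?case by (intro exI[of _ 1]) simp
next
  case (scale s c)
  then obtain b where "\<And>\<phi>. \<bar>s \<phi>\<bar> \<le> b" by auto
  then have "\<forall>\<phi>. \<bar>c * s \<phi>\<bar> \<le> \<bar>c\<bar> * b" by (simp add: abs_mult mult_left_mono)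
  then show ?case by blast
next
  case (add s s')
  then obtain b b' where "\<And>\<phi>. \<bar>s \<phi>\<bar> \<le> b" "\<And>\<phi>. \<bar>s' \<phi>\<bar> \<le> b'" by auto
  then have "\<forall>\<phi>. \<bar>s \<phi> + s' \<phi>\<bar> \<le> b + b'" by (metis abs_triangle_ineq add_mono order_trans)
  then show ?case by blast
qed

text \<open>The span is an algebra because F u * F u' = F (u + u'). Equality is claimed on counting
  measures, where u is measurable for \<phi> and the integral is additive.\<close>

lemma exp_span_mult:
  assumes "s \<in> exp_span R" "s' \<in> exp_span R"
  shows "\<exists>t\<in>exp_span R. \<forall>\<phi>\<in>counting_measures R. t \<phi> = s \<phi> * s' \<phi>"
  using assms(1)
proof (induction rule: exp_span.induct)
  case (exp_fun u)
  show ?case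
    using assms(2)
  proof (induction rule: exp_span.induct)
    case (exp_fun u')
    then show ?case
      using exp_fun_add[OF \<open>u \<in> test_funs R\<close> exp_fun]
      by (intro bexI[of _ "exp_fun (\<lambda>x. u x + u' x)"] exp_span.exp_fun test_funs_add) (use \<open>u \<in> test_funs R\<close> in auto)
  next
    case (scale s c)
    then obtain t where "t \<in> exp_span R" "\<forall>\<phi>\<in>counting_measures R. t \<phi> = exp_fun u \<phi> * s \<phi>" by auto
    then show ?case
      by (intro bexI[of _ "\<lambda>\<phi>. c * t \<phi>"] exp_span.scale) auto
  next
    case (add s s')
    then obtain t t' where "t \<in> exp_span R" "\<forall>\<phi>\<in>counting_measures R. t \<phi> = exp_fun u \<phi> * s \<phi>"
      "t' \<in> exp_span R" "\<forall>\<phi>\<in>counting_measures R. t' \<phi> = exp_fun u \<phi> * s' \<phi>" by auto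
    then show ?case
      by (intro bexI[of _ "\<lambda>\<phi>. t \<phi> + t' \<phi>"] exp_span.add) (auto simp: distrib_left)
  qed
next
  case (scale s c)
  then obtain t where "t \<in> exp_span R" "\<forall>\<phi>\<in>counting_measures R. t \<phi> = s \<phi> * s' \<phi>" by auto
  then show ?case
    by (intro bexI[of _ "\<lambda>\<phi>. c * t \<phi>"] exp_span.scale) auto
next
  case (add s1 s2)
  then obtain t t' where "t \<in> exp_span R" "\<forall>\<phi>\<in>counting_measures R. t \<phi> = s1 \<phi> * s' \<phi>"
    "t' \<in> exp_span R" "\<forall>\<phi>\<in>counting_measures R. t' \<phi> = s2 \<phi> * s' \<phi>" by auto
  then show ?case
    by (intro bexI[of _ "\<lambda>\<phi>. t \<phi> + t' \<phi>"] exp_span.add) (auto simp: distrib_right)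
qed

text \<open>Summands are concatenated without merging equal u. The coefficients are therefore not
  determined by s, and later bounds have to be in terms of the norm of s.\<close>

lemma exp_span_expansion:
  assumes "s \<in> exp_span R"
  obtains m :: nat and c u where "\<And>i. i < m \<Longrightarrow> u i \<in> test_funs R"
    "s = (\<lambda>\<phi>. \<Sum>i<m. c i * exp_fun (u i) \<phi>)"
proof -
  have "\<exists>(m::nat) c u. (\<forall>i<m. u i \<in> test_funs R) \<and> s = (\<lambda>\<phi>. \<Sum>i<m. c i * exp_fun (u i) \<phi>)"
    using assms
  proof (induction rule: exp_span.induct)
    case (exp_fun u)
    then show ?case
      by (intro exI[of _ 1] exI[of _ "\<lambda>_. 1"] exI[of _ "\<lambda>_. u"]) auto
  next
    case (scale s d)
    then obtain m :: nat and c u where *: "\<forall>i<m. u i \<in> test_funs R"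
      "s = (\<lambda>\<phi>. \<Sum>i<m. c i * exp_fun (u i) \<phi>)" by auto
    then show ?case
      by (intro exI[of _ m] exI[of _ "\<lambda>i. d * c i"] exI[of _ u]) (auto simp: sum_distrib_left mult.assoc)
  next
    case (add s s')
    then obtain m m' :: nat and c c' u u' where *: "\<forall>i<m. u i \<in> test_funs R"
      "s = (\<lambda>\<phi>. \<Sum>i<m. c i * exp_fun (u i) \<phi>)" "\<forall>i<m'. u' i \<in> test_funs R"
      "s' = (\<lambda>\<phi>. \<Sum>i<m'. c' i * exp_fun (u' i) \<phi>)" by auto
    let ?c = "\<lambda>i. if i < m then c i else c' (i - m)"
    let ?u = "\<lambda>i. if i < m then u i else u' (i - m)"
    have "s \<phi> + s' \<phi> = (\<Sum>i<m + m'. ?c i * exp_fun (?u i) \<phi>)" for \<phi>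
    proof -
      have "(\<Sum>i<m + m'. ?c i * exp_fun (?u i) \<phi>) =
          (\<Sum>i\<in>{0..<m}. ?c i * exp_fun (?u i) \<phi>) + (\<Sum>i\<in>{m..<m+m'}. ?c i * exp_fun (?u i) \<phi>)"
        using sum.atLeastLessThan_concat[of 0 m "m + m'" "\<lambda>i. ?c i * exp_fun (?u i) \<phi>"]
        by (simp only: lessThan_atLeast0 le_add1 zero_le)
      also have "(\<Sum>i\<in>{m..<m+m'}. ?c i * exp_fun (?u i) \<phi>) = (\<Sum>i\<in>{0..<m'}. c' i * exp_fun (u' i) \<phi>)"
        using sum.shift_bounds_nat_ivl[of "\<lambda>i. ?c i * exp_fun (?u i) \<phi>" 0 m m'] by (simp add: add.commute)
      finally show ?thesis using * by (simp add: lessThan_atLeast0)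
    qed
    then show ?case using *
      by (intro exI[of _ "m + m'"] exI[of _ ?c] exI[of _ ?u]) auto
  qed
  then show ?thesis using that by blast
qed

lemma sq_add_le: "(a + b)\<^sup>2 \<le> 2 * a\<^sup>2 + 2 * b\<^sup>2" for a b :: real
  using zero_le_power2[of "a - b"] by (simp add: power2_eq_square algebra_simps)

lemma integrable_sq_diff:
  assumes "integrable M (\<lambda>x. (f x)\<^sup>2)" "integrable M (\<lambda>x. (g x)\<^sup>2)"
    "f \<in> borel_measurable M" "g \<in> borel_measurable M"
  shows "integrable M (\<lambda>x. (f x - g x :: real)\<^sup>2)"
proof (rule Bochner_Integration.integrable_bound)
  show "integrable M (\<lambda>x. 2 * (f x)\<^sup>2 + 2 * (g x)\<^sup>2)" using assms by auto
  show "AE x in M. norm ((f x - g x)\<^sup>2) \<le> norm (2 * (f x)\<^sup>2 + 2 * (g x)\<^sup>2)"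
    using sq_add_le[of "f x" "- g x" for x] by auto
qed (use assms in measurable)

lemma integral_sq_triangle:
  assumes "integrable M (\<lambda>x. (f x - g x)\<^sup>2)" "integrable M (\<lambda>x. (g x - h x)\<^sup>2)"
    "(\<lambda>x. f x - h x) \<in> borel_measurable M"
  shows "(\<integral>x. (f x - h x :: real)\<^sup>2 \<partial>M) \<le> 2 * (\<integral>x. (f x - g x)\<^sup>2 \<partial>M) + 2 * (\<integral>x. (g x - h x)\<^sup>2 \<partial>M)"
proof -
  have le: "(f x - h x)\<^sup>2 \<le> 2 * (f x - g x)\<^sup>2 + 2 * (g x - h x)\<^sup>2" for x
    using sq_add_le[of "f x - g x" "g x - h x"] by simp
  have "integrable M (\<lambda>x. (f x - h x)\<^sup>2)"
    by (rule Bochner_Integration.integrable_bound[of _ "\<lambda>x. 2 * (f x - g x)\<^sup>2 + 2 * (g x - h x)\<^sup>2"])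
       (use assms le in auto)
  then have "(\<integral>x. (f x - h x)\<^sup>2 \<partial>M) \<le> (\<integral>x. 2 * (f x - g x)\<^sup>2 + 2 * (g x - h x)\<^sup>2 \<partial>M)"
    using assms le by (intro integral_mono) auto
  then show ?thesis using assms by simp
qed

section \<open>Simultaneous L2 approximation for finitely many finite measures\<close>

locale counting_measure_family = R: sigma_finite_measure R for R :: "'a measure" +
  fixes \<M> :: "'a measure measure set"
  assumes finite_family: "finite \<M>"
    and finite_measures: "\<And>M. M \<in> \<M> \<Longrightarrow> finite_measure M"
    and sets_family: "\<And>M. M \<in> \<M> \<Longrightarrow> sets M = sets (counting_space R)"
begin

text \<open>One s has to serve all members of the family. The Bochner integral of a function that is
  not integrable is 0, so the notion is meaningful for square integrable g; the closure lemmas carry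
  integrability hypotheses for this reason.\<close>

definition approx :: "('a measure \<Rightarrow> real) \<Rightarrow> bool" where
  "approx g \<longleftrightarrow> (\<forall>e>0. \<exists>s\<in>exp_span R. \<forall>M\<in>\<M>. (\<integral>\<phi>. (g \<phi> - s \<phi>)\<^sup>2 \<partial>M) < e)"

text \<open>Boundedness makes this class an algebra that is closed under bounded pointwise limits,
  as in a monotone class argument. Unbounded functions return in
  \<open>approx_nonneg\<close>.\<close>

definition approx_bdd :: "('a measure \<Rightarrow> real) \<Rightarrow> bool" where
  "approx_bdd g \<longleftrightarrow> g \<in> borel_measurable (counting_space R) \<and>
     (\<exists>b. \<forall>\<phi>\<in>counting_measures R. \<bar>g \<phi>\<bar> \<le> b) \<and> approx g"

lemma space_family: "M \<in> \<M> \<Longrightarrow> space M = counting_measures R"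
  using sets_eq_imp_space_eq[OF sets_family] by (simp add: space_counting_space)

lemma measurable_family:
  "M \<in> \<M> \<Longrightarrow> g \<in> borel_measurable (counting_space R) \<Longrightarrow> g \<in> borel_measurable M"
  by (simp add: measurable_cong_sets[OF sets_family refl])

lemma integrable_bdd:
  assumes "M \<in> \<M>" "g \<in> borel_measurable (counting_space R)"
    "\<And>\<phi>. \<phi> \<in> counting_measures R \<Longrightarrow> \<bar>g \<phi>\<bar> \<le> (b::real)"
  shows "integrable M g"
  using assms finite_measure.integrable_const_bound[OF finite_measures[OF assms(1)], of g b]
    measurable_family[OF assms(1,2)] space_family[OF assms(1)]
  by auto

lemma integrable_bdd_sq:
  assumes "M \<in> \<M>" "g \<in> borel_measurable (counting_space R)"
    "\<And>\<phi>. \<phi> \<in> counting_measures R \<Longrightarrow> \<bar>g \<phi>\<bar> \<le> (b::real)"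
  shows "integrable M (\<lambda>\<phi>. (g \<phi>)\<^sup>2)"
proof (rule integrable_bdd[OF assms(1), where b="b\<^sup>2"])
  show "\<bar>(g \<phi>)\<^sup>2\<bar> \<le> b\<^sup>2" if "\<phi> \<in> counting_measures R" for \<phi>
    using power_mono[OF assms(3)[OF that], of 2] by simp
qed (use assms(2) in measurable)

lemma exp_span_integrable:
  "M \<in> \<M> \<Longrightarrow> s \<in> exp_span R \<Longrightarrow> integrable M s"
  using exp_span_bounded[of s R] integrable_bdd[of M s] exp_span_measurable[of s R] by auto

lemma exp_span_integrable_sq:
  "M \<in> \<M> \<Longrightarrow> s \<in> exp_span R \<Longrightarrow> integrable M (\<lambda>\<phi>. (s \<phi>)\<^sup>2)"
  using exp_span_bounded[of s R] integrable_bdd_sq[of M s] exp_span_measurable[of s R] by auto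

lemma approx_cong:
  assumes "approx g" "\<And>\<phi>. \<phi> \<in> counting_measures R \<Longrightarrow> g \<phi> = g' \<phi>"
  shows "approx g'"
  unfolding approx_def
proof (intro allI impI)
  fix e :: real assume "0 < e"
  then obtain s where s: "s \<in> exp_span R" "\<forall>M\<in>\<M>. (\<integral>\<phi>. (g \<phi> - s \<phi>)\<^sup>2 \<partial>M) < e"
    using assms(1) unfolding approx_def by blast
  have "(\<integral>\<phi>. (g \<phi> - s \<phi>)\<^sup>2 \<partial>M) = (\<integral>\<phi>. (g' \<phi> - s \<phi>)\<^sup>2 \<partial>M)" if "M \<in> \<M>" for M
    using that assms(2) by (intro Bochner_Integration.integral_cong) (auto simp: space_family)
  then show "\<exists>s\<in>exp_span R. \<forall>M\<in>\<M>. (\<integral>\<phi>. (g' \<phi> - s \<phi>)\<^sup>2 \<partial>M) < e"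
    using s by auto
qed

lemma approx_bdd_cong:
  assumes "approx_bdd g" "\<And>\<phi>. \<phi> \<in> counting_measures R \<Longrightarrow> g \<phi> = g' \<phi>"
  shows "approx_bdd g'"
proof -
  have "g' \<in> borel_measurable (counting_space R)"
    using assms measurable_cong[of "counting_space R" g g' borel]
    by (auto simp: approx_bdd_def space_counting_space)
  then show ?thesis
    using assms approx_cong[of g g'] by (auto simp: approx_bdd_def)
qed

lemma exp_span_approx: "s \<in> exp_span R \<Longrightarrow> approx_bdd s"
  using exp_span_bounded[of s R] exp_span_measurable[of s R]
  by (auto simp: approx_bdd_def approx_def intro!: bexI[of _ s])

lemma approx_bdd_const: "approx_bdd (\<lambda>_. c)"
  by (intro exp_span_approx const_exp_span)

lemma approx_close:
  assumes g: "g \<in> borel_measurable (counting_space R)" "\<And>M. M \<in> \<M> \<Longrightarrow> integrable M (\<lambda>\<phi>. (g \<phi>)\<^sup>2)"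
    and ex: "\<And>e. 0 < e \<Longrightarrow> \<exists>g'. approx g' \<and> g' \<in> borel_measurable (counting_space R) \<and>
      (\<forall>M\<in>\<M>. integrable M (\<lambda>\<phi>. (g' \<phi>)\<^sup>2)) \<and> (\<forall>M\<in>\<M>. (\<integral>\<phi>. (g \<phi> - g' \<phi>)\<^sup>2 \<partial>M) < e)"
  shows "approx g"
  unfolding approx_def
proof (intro allI impI)
  fix e :: real assume e: "0 < e"
  obtain g' where g': "approx g'" "g' \<in> borel_measurable (counting_space R)"
    "\<And>M. M \<in> \<M> \<Longrightarrow> integrable M (\<lambda>\<phi>. (g' \<phi>)\<^sup>2)" "\<And>M. M \<in> \<M> \<Longrightarrow> (\<integral>\<phi>. (g \<phi> - g' \<phi>)\<^sup>2 \<partial>M) < e / 4"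
    using ex[of "e / 4"] e by auto
  have "0 < e / 4" using e by simp
  then obtain s where s: "s \<in> exp_span R" "\<And>M. M \<in> \<M> \<Longrightarrow> (\<integral>\<phi>. (g' \<phi> - s \<phi>)\<^sup>2 \<partial>M) < e / 4"
    using g'(1) unfolding approx_def by blast
  have "(\<integral>\<phi>. (g \<phi> - s \<phi>)\<^sup>2 \<partial>M) < e" if M: "M \<in> \<M>" for M
  proof -
    note [measurable] = measurable_family[OF M g(1)] measurable_family[OF M g'(2)]
      measurable_family[OF M exp_span_measurable[OF s(1)]]
    have "(\<integral>\<phi>. (g \<phi> - s \<phi>)\<^sup>2 \<partial>M) \<le> 2 * (\<integral>\<phi>. (g \<phi> - g' \<phi>)\<^sup>2 \<partial>M) + 2 * (\<integral>\<phi>. (g' \<phi> - s \<phi>)\<^sup>2 \<partial>M)"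
      using g(2)[OF M] g'(3)[OF M] exp_span_integrable_sq[OF M s(1)]
      by (intro integral_sq_triangle integrable_sq_diff) measurable
    then show ?thesis using g'(4)[OF M] s(2)[OF M] by simp
  qed
  then show "\<exists>s\<in>exp_span R. \<forall>M\<in>\<M>. (\<integral>\<phi>. (g \<phi> - s \<phi>)\<^sup>2 \<partial>M) < e"
    using s(1) by blast
qed

lemma approx_add:
  assumes g: "approx g" "g \<in> borel_measurable (counting_space R)" "\<And>M. M \<in> \<M> \<Longrightarrow> integrable M (\<lambda>\<phi>. (g \<phi>)\<^sup>2)"
    and h: "approx h" "h \<in> borel_measurable (counting_space R)" "\<And>M. M \<in> \<M> \<Longrightarrow> integrable M (\<lambda>\<phi>. (h \<phi>)\<^sup>2)"
  shows "approx (\<lambda>\<phi>. g \<phi> + h \<phi>)"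
  unfolding approx_def
proof (intro allI impI)
  fix e :: real assume "0 < e"
  then have e: "0 < e / 4" by simp
  obtain s where s: "s \<in> exp_span R" "\<And>M. M \<in> \<M> \<Longrightarrow> (\<integral>\<phi>. (g \<phi> - s \<phi>)\<^sup>2 \<partial>M) < e / 4"
    using g(1) e unfolding approx_def by blast
  obtain t where t: "t \<in> exp_span R" "\<And>M. M \<in> \<M> \<Longrightarrow> (\<integral>\<phi>. (h \<phi> - t \<phi>)\<^sup>2 \<partial>M) < e / 4"
    using h(1) e unfolding approx_def by blast
  have "(\<integral>\<phi>. (g \<phi> + h \<phi> - (s \<phi> + t \<phi>))\<^sup>2 \<partial>M) < e" if M: "M \<in> \<M>" for M
  proof -
    note [measurable] = measurable_family[OF M g(2)] measurable_family[OF M h(2)]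
      measurable_family[OF M exp_span_measurable[OF s(1)]]
      measurable_family[OF M exp_span_measurable[OF t(1)]]
    have "(\<integral>\<phi>. ((g \<phi> - s \<phi>) - (t \<phi> - h \<phi>))\<^sup>2 \<partial>M) \<le>
        2 * (\<integral>\<phi>. ((g \<phi> - s \<phi>) - 0)\<^sup>2 \<partial>M) + 2 * (\<integral>\<phi>. (0 - (t \<phi> - h \<phi>))\<^sup>2 \<partial>M)"
    proof (rule integral_sq_triangle)
      show "integrable M (\<lambda>\<phi>. ((g \<phi> - s \<phi>) - 0)\<^sup>2)"
        using integrable_sq_diff[OF g(3)[OF M] exp_span_integrable_sq[OF M s(1)]] by simp
      show "integrable M (\<lambda>\<phi>. (0 - (t \<phi> - h \<phi>))\<^sup>2)"
        using integrable_sq_diff[OF h(3)[OF M] exp_span_integrable_sq[OF M t(1)]] by simp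
    qed measurable
    then have "(\<integral>\<phi>. (g \<phi> + h \<phi> - (s \<phi> + t \<phi>))\<^sup>2 \<partial>M) \<le>
        2 * (\<integral>\<phi>. (g \<phi> - s \<phi>)\<^sup>2 \<partial>M) + 2 * (\<integral>\<phi>. (h \<phi> - t \<phi>)\<^sup>2 \<partial>M)"
      by (simp add: algebra_simps)
    then show ?thesis using s(2)[OF M] t(2)[OF M] by simp
  qed
  then show "\<exists>s\<in>exp_span R. \<forall>M\<in>\<M>. (\<integral>\<phi>. (g \<phi> + h \<phi> - s \<phi>)\<^sup>2 \<partial>M) < e"
    using exp_span.add[OF s(1) t(1)] by (intro bexI) auto
qed

lemma approx_scale:
  assumes "approx g"
  shows "approx (\<lambda>\<phi>. c * g \<phi>)"
  unfolding approx_def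
proof (intro allI impI)
  fix e :: real assume e: "0 < e"
  then have "0 < e / (c\<^sup>2 + 1)" by (simp add: add_nonneg_pos)
  then obtain s where s: "s \<in> exp_span R" "\<And>M. M \<in> \<M> \<Longrightarrow> (\<integral>\<phi>. (g \<phi> - s \<phi>)\<^sup>2 \<partial>M) < e / (c\<^sup>2 + 1)"
    using assms unfolding approx_def by blast
  have "(\<integral>\<phi>. (c * g \<phi> - c * s \<phi>)\<^sup>2 \<partial>M) < e" if M: "M \<in> \<M>" for M
  proof -
    have "(\<integral>\<phi>. (c * g \<phi> - c * s \<phi>)\<^sup>2 \<partial>M) = c\<^sup>2 * (\<integral>\<phi>. (g \<phi> - s \<phi>)\<^sup>2 \<partial>M)"
      by (simp add: power_mult_distrib flip: right_diff_distrib)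
    also have "\<dots> \<le> (c\<^sup>2 + 1) * (\<integral>\<phi>. (g \<phi> - s \<phi>)\<^sup>2 \<partial>M)"
      by (intro mult_right_mono) auto
    also have "\<dots> < e"
      using s(2)[OF M] by (simp add: pos_less_divide_eq add_nonneg_pos mult.commute)
    finally show ?thesis .
  qed
  then show "\<exists>s\<in>exp_span R. \<forall>M\<in>\<M>. (\<integral>\<phi>. (c * g \<phi> - s \<phi>)\<^sup>2 \<partial>M) < e"
    using exp_span.scale[OF s(1), of c] by (intro bexI) auto
qed

lemma approx_bdd_sq: "approx_bdd g \<Longrightarrow> M \<in> \<M> \<Longrightarrow> integrable M (\<lambda>\<phi>. (g \<phi>)\<^sup>2)"
  by (auto simp: approx_bdd_def intro: integrable_bdd_sq)

lemma approx_bdd_add: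
  assumes "approx_bdd g" "approx_bdd h"
  shows "approx_bdd (\<lambda>\<phi>. g \<phi> + h \<phi>)"
proof -
  obtain b b' where "\<And>\<phi>. \<phi> \<in> counting_measures R \<Longrightarrow> \<bar>g \<phi>\<bar> \<le> b"
    "\<And>\<phi>. \<phi> \<in> counting_measures R \<Longrightarrow> \<bar>h \<phi>\<bar> \<le> b'"
    using assms by (auto simp: approx_bdd_def)
  then have "\<forall>\<phi>\<in>counting_measures R. \<bar>g \<phi> + h \<phi>\<bar> \<le> b + b'"
    by (metis abs_triangle_ineq add_mono order_trans)
  then show ?thesis
    using assms approx_add[of g h] approx_bdd_sq[OF assms(1)] approx_bdd_sq[OF assms(2)]
    by (auto simp: approx_bdd_def)
qed

lemma approx_bdd_scale:
  assumes "approx_bdd g"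
  shows "approx_bdd (\<lambda>\<phi>. c * g \<phi>)"
proof -
  obtain b where "\<And>\<phi>. \<phi> \<in> counting_measures R \<Longrightarrow> \<bar>g \<phi>\<bar> \<le> b"
    using assms by (auto simp: approx_bdd_def)
  then have "\<forall>\<phi>\<in>counting_measures R. \<bar>c * g \<phi>\<bar> \<le> \<bar>c\<bar> * b"
    by (simp add: abs_mult mult_left_mono)
  then show ?thesis
    using assms approx_scale[of g c] by (auto simp: approx_bdd_def)
qed

text \<open>Multiplication by the bounded function g is continuous in each L2 space, so h may be
  replaced by an element s of the span; the product g * s is covered by \<open>gs\<close>.\<close>

lemma approx_bdd_multI:
  assumes g: "approx_bdd g" and h: "approx_bdd h"
    and gs: "\<And>s. s \<in> exp_span R \<Longrightarrow> approx (\<lambda>\<phi>. g \<phi> * s \<phi>)"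
  shows "approx_bdd (\<lambda>\<phi>. g \<phi> * h \<phi>)"
proof -
  have [measurable]: "g \<in> borel_measurable (counting_space R)" "h \<in> borel_measurable (counting_space R)"
    using g h by (auto simp: approx_bdd_def)
  obtain b b' where b: "\<And>\<phi>. \<phi> \<in> counting_measures R \<Longrightarrow> \<bar>g \<phi>\<bar> \<le> b"
    and b': "\<And>\<phi>. \<phi> \<in> counting_measures R \<Longrightarrow> \<bar>h \<phi>\<bar> \<le> b'"
    using g h unfolding approx_bdd_def by blast
  have bb': "\<bar>g \<phi> * h \<phi>\<bar> \<le> b * b'" if "\<phi> \<in> counting_measures R" for \<phi>
    using b[OF that] b'[OF that] by (simp add: abs_mult mult_mono')
  have "approx (\<lambda>\<phi>. g \<phi> * h \<phi>)"
  proof (rule approx_close)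
    show "integrable M (\<lambda>\<phi>. (g \<phi> * h \<phi>)\<^sup>2)" if "M \<in> \<M>" for M
      using bb' by (intro integrable_bdd_sq[OF that]) auto
    fix e :: real assume "0 < e"
    then have e: "0 < e / (b\<^sup>2 + 1)" by (simp add: add_nonneg_pos)
    obtain s where s: "s \<in> exp_span R" "\<And>M. M \<in> \<M> \<Longrightarrow> (\<integral>\<phi>. (h \<phi> - s \<phi>)\<^sup>2 \<partial>M) < e / (b\<^sup>2 + 1)"
      using h e unfolding approx_bdd_def approx_def by blast
    note [measurable] = exp_span_measurable[OF s(1)]
    obtain c where c: "\<And>\<phi>. \<bar>s \<phi>\<bar> \<le> c" using exp_span_bounded[OF s(1)] by auto
    have "(\<integral>\<phi>. (g \<phi> * h \<phi> - g \<phi> * s \<phi>)\<^sup>2 \<partial>M) < e" if M: "M \<in> \<M>" for M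
    proof -
      have i: "integrable M (\<lambda>\<phi>. (h \<phi> - s \<phi>)\<^sup>2)"
        using approx_bdd_sq[OF h M] exp_span_integrable_sq[OF M s(1)]
        by (intro integrable_sq_diff measurable_family[OF M]) auto
      have le: "(g \<phi> * h \<phi> - g \<phi> * s \<phi>)\<^sup>2 \<le> (b\<^sup>2 + 1) * (h \<phi> - s \<phi>)\<^sup>2" if "\<phi> \<in> counting_measures R" for \<phi>
      proof -
        have "(g \<phi>)\<^sup>2 \<le> b\<^sup>2" using b[OF that] abs_le_square_iff[of "g \<phi>" b] by auto
        then have "(g \<phi>)\<^sup>2 * (h \<phi> - s \<phi>)\<^sup>2 \<le> (b\<^sup>2 + 1) * (h \<phi> - s \<phi>)\<^sup>2"
          by (intro mult_right_mono) auto
        then show ?thesis by (simp add: power_mult_distrib flip: right_diff_distrib)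
      qed
      have m: "(\<lambda>\<phi>. (g \<phi> * h \<phi> - g \<phi> * s \<phi>)\<^sup>2) \<in> borel_measurable M"
        by (intro measurable_family[OF M]) measurable
      have i2: "integrable M (\<lambda>\<phi>. (g \<phi> * h \<phi> - g \<phi> * s \<phi>)\<^sup>2)"
        by (rule Bochner_Integration.integrable_bound[OF integrable_mult_right[OF i, of "b\<^sup>2 + 1"] m])
           (use le space_family[OF M] in auto)
      have "(\<integral>\<phi>. (g \<phi> * h \<phi> - g \<phi> * s \<phi>)\<^sup>2 \<partial>M) \<le> (\<integral>\<phi>. (b\<^sup>2 + 1) * (h \<phi> - s \<phi>)\<^sup>2 \<partial>M)"
        using le space_family[OF M] by (intro integral_mono i2 integrable_mult_right i) auto
      also have "\<dots> = (b\<^sup>2 + 1) * (\<integral>\<phi>. (h \<phi> - s \<phi>)\<^sup>2 \<partial>M)" by simp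
      also have "\<dots> < e" using s(2)[OF M] by (simp add: pos_less_divide_eq add_nonneg_pos mult.commute)
      finally show ?thesis .
    qed
    moreover have "integrable M (\<lambda>\<phi>. (g \<phi> * s \<phi>)\<^sup>2)" if "M \<in> \<M>" for M
      using b c by (intro integrable_bdd_sq[OF that, where b="b * c"]) (auto simp: abs_mult mult_mono')
    moreover have "(\<lambda>\<phi>. g \<phi> * s \<phi>) \<in> borel_measurable (counting_space R)" by measurable
    ultimately show "\<exists>g'. approx g' \<and> g' \<in> borel_measurable (counting_space R) \<and>
        (\<forall>M\<in>\<M>. integrable M (\<lambda>\<phi>. (g' \<phi>)\<^sup>2)) \<and> (\<forall>M\<in>\<M>. (\<integral>\<phi>. (g \<phi> * h \<phi> - g' \<phi>)\<^sup>2 \<partial>M) < e)"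
      using gs[OF s(1)] by (intro exI[of _ "\<lambda>\<phi>. g \<phi> * s \<phi>"]) auto
  qed measurable
  then show ?thesis using bb' by (auto simp: approx_bdd_def)
qed

text \<open>The preceding lemma is applied twice. With a factor s from the span its hypothesis
  \<open>gs\<close> is \<open>exp_span_mult\<close>, and the resulting statement about s * g is the
  hypothesis for the product of g and h.\<close>

lemma approx_bdd_mult:
  assumes g: "approx_bdd g" and h: "approx_bdd h"
  shows "approx_bdd (\<lambda>\<phi>. g \<phi> * h \<phi>)"
proof (rule approx_bdd_multI[OF g h])
  fix s assume s: "s \<in> exp_span R"
  have "approx (\<lambda>\<phi>. s \<phi> * t \<phi>)" if t: "t \<in> exp_span R" for t
  proof -
    obtain r where "r \<in> exp_span R" "\<forall>\<phi>\<in>counting_measures R. r \<phi> = s \<phi> * t \<phi>"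
      using exp_span_mult[OF s t] by blast
    then show ?thesis
      using exp_span_approx[of r] approx_cong[of r "\<lambda>\<phi>. s \<phi> * t \<phi>"] by (auto simp: approx_bdd_def)
  qed
  then have "approx_bdd (\<lambda>\<phi>. s \<phi> * g \<phi>)"
    by (rule approx_bdd_multI[OF exp_span_approx[OF s] g])
  then show "approx (\<lambda>\<phi>. g \<phi> * s \<phi>)"
    by (simp add: approx_bdd_def mult.commute)
qed

text \<open>Dominated convergence in each L2 space; finiteness of the family gives one index k for
  all M. The dominating function 4 H comes from (g - G k)^2 \<le> 2 g^2 + 2 (G k)^2.\<close>

lemma approx_sequence:
  assumes g: "g \<in> borel_measurable (counting_space R)"
    and H: "\<And>M. M \<in> \<M> \<Longrightarrow> integrable M (H M)"
    and G: "\<And>k. approx (G k)" "\<And>k. G k \<in> borel_measurable (counting_space R)"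
    and bd: "\<And>k M \<phi>. M \<in> \<M> \<Longrightarrow> \<phi> \<in> counting_measures R \<Longrightarrow> (G k \<phi>)\<^sup>2 \<le> H M \<phi>"
    and lim: "\<And>\<phi>. \<phi> \<in> counting_measures R \<Longrightarrow> (\<lambda>k. G k \<phi>) \<longlonglongrightarrow> g \<phi>"
  shows "approx g"
proof (rule approx_close[OF g])
  have gH: "(g \<phi>)\<^sup>2 \<le> H M \<phi>" if "M \<in> \<M>" "\<phi> \<in> counting_measures R" for M \<phi>
    using bd[OF that] by (intro LIMSEQ_le_const2[OF tendsto_power[OF lim[OF that(2)]]]) auto
  show int: "integrable M (\<lambda>\<phi>. (g \<phi>)\<^sup>2)" if M: "M \<in> \<M>" for M
    using g gH[OF M] space_family[OF M]
    by (intro Bochner_Integration.integrable_bound[OF H[OF M]] measurable_family[OF M])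
       (auto intro: order_trans[OF _ abs_ge_self])
  have intG: "integrable M (\<lambda>\<phi>. (G k \<phi>)\<^sup>2)" if M: "M \<in> \<M>" for M k
    using G(2)[of k] order_trans[OF bd[OF M] abs_ge_self] space_family[OF M]
    by (intro Bochner_Integration.integrable_bound[OF H[OF M]] measurable_family[OF M]) auto
  have conv: "(\<lambda>k. \<integral>\<phi>. (g \<phi> - G k \<phi>)\<^sup>2 \<partial>M) \<longlonglongrightarrow> (\<integral>\<phi>. 0 \<partial>M)" if M: "M \<in> \<M>" for M
  proof (rule integral_dominated_convergence[where w="\<lambda>\<phi>. 4 * H M \<phi>"])
    show "integrable M (\<lambda>\<phi>. 4 * H M \<phi>)" using H[OF M] by auto
    show "(\<lambda>\<phi>. (g \<phi> - G k \<phi>)\<^sup>2) \<in> borel_measurable M" for k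
      using g G(2)[of k] by (intro measurable_family[OF M]) measurable
    have "(\<lambda>k. (g \<phi> - G k \<phi>)\<^sup>2) \<longlonglongrightarrow> 0" if "\<phi> \<in> counting_measures R" for \<phi>
      using tendsto_power[OF tendsto_diff[OF tendsto_const lim[OF that]], of "g \<phi>" 2] by simp
    then show "AE \<phi> in M. (\<lambda>k. (g \<phi> - G k \<phi>)\<^sup>2) \<longlonglongrightarrow> 0"
      using space_family[OF M] by auto
    have "(g \<phi> - G k \<phi>)\<^sup>2 \<le> 4 * H M \<phi>" if "\<phi> \<in> counting_measures R" for \<phi> k
      using sq_add_le[of "g \<phi>" "- G k \<phi>"] gH[OF M that] bd[OF M that, of k] by simp
    then show "AE \<phi> in M. norm ((g \<phi> - G k \<phi>)\<^sup>2) \<le> 4 * H M \<phi>" for k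
      using space_family[OF M] by auto
  qed simp
  fix e :: real assume e: "0 < e"
  have "\<forall>\<^sub>F k in sequentially. \<forall>M\<in>\<M>. (\<integral>\<phi>. (g \<phi> - G k \<phi>)\<^sup>2 \<partial>M) < e"
    using conv e by (intro eventually_ball_finite finite_family ballI order_tendstoD(2)[OF conv]) auto
  then obtain k where "\<forall>M\<in>\<M>. (\<integral>\<phi>. (g \<phi> - G k \<phi>)\<^sup>2 \<partial>M) < e"
    using eventually_happens[of _ sequentially] by auto
  then show "\<exists>g'. approx g' \<and> g' \<in> borel_measurable (counting_space R) \<and>
      (\<forall>M\<in>\<M>. integrable M (\<lambda>\<phi>. (g' \<phi>)\<^sup>2)) \<and> (\<forall>M\<in>\<M>. (\<integral>\<phi>. (g \<phi> - g' \<phi>)\<^sup>2 \<partial>M) < e)"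
    using G intG by blast
qed

lemma approx_bdd_sequence:
  assumes G: "\<And>k. approx_bdd (G k)"
    and bd: "\<And>k \<phi>. \<phi> \<in> counting_measures R \<Longrightarrow> \<bar>G k \<phi>\<bar> \<le> b"
    and lim: "\<And>\<phi>. \<phi> \<in> counting_measures R \<Longrightarrow> (\<lambda>k. G k \<phi>) \<longlonglongrightarrow> g \<phi>"
  shows "approx_bdd g"
proof -
  have m: "g \<in> borel_measurable (counting_space R)"
    by (rule borel_measurable_LIMSEQ_real[where u=G])
       (use G lim in \<open>auto simp: approx_bdd_def space_counting_space\<close>)
  have "\<bar>g \<phi>\<bar> \<le> b" if "\<phi> \<in> counting_measures R" for \<phi>
    using bd[OF that] by (intro LIMSEQ_le_const2[OF tendsto_rabs[OF lim[OF that]]]) auto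
  moreover have "approx g"
  proof (rule approx_sequence[OF m, where G=G and H="\<lambda>_ _. b\<^sup>2"])
    show "integrable M (\<lambda>_. b\<^sup>2)" if "M \<in> \<M>" for M
      by (rule finite_measure.integrable_const[OF finite_measures[OF that]])
    show "(G k \<phi>)\<^sup>2 \<le> b\<^sup>2" if "\<phi> \<in> counting_measures R" for k \<phi>
      using bd[OF that, of k] abs_le_square_iff[of "G k \<phi>" b] by simp
  qed (use G lim in \<open>auto simp: approx_bdd_def\<close>)
  ultimately show ?thesis using m by (auto simp: approx_bdd_def)
qed

lemma approx_bdd_polynomial:
  assumes "real_polynomial_function p" "approx_bdd g"
  shows "approx_bdd (\<lambda>\<phi>. p (g \<phi>))"
  using assms(1)
proof (induction rule: real_polynomial_function.induct)
  case (linear f)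
  then have "f x = f 1 * x" for x :: real
    using real_bounded_linear[of f] by auto
  then have "(\<lambda>\<phi>. f (g \<phi>)) = (\<lambda>\<phi>. f 1 * g \<phi>)" by metis
  then show ?case using approx_bdd_scale[OF assms(2)] by simp
qed (auto intro: approx_bdd_add approx_bdd_mult approx_bdd_const)

text \<open>Weierstrass approximation: polynomials in g stay in the class because it is an algebra,
  and uniform convergence on [0, 1] passes to q.\<close>

lemma approx_bdd_continuous:
  assumes g: "approx_bdd g" "\<And>\<phi>. \<phi> \<in> counting_measures R \<Longrightarrow> g \<phi> \<in> {0..1}"
    and q: "continuous_on {0..1} q"
  shows "approx_bdd (\<lambda>\<phi>. q (g \<phi>))"
proof -
  have "\<exists>p. real_polynomial_function p \<and> (\<forall>x\<in>{0..1}. \<bar>q x - p x\<bar> < inverse (real (Suc k)))" for k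
    using Stone_Weierstrass_real_polynomial_function[OF compact_Icc q, of "inverse (real (Suc k))"]
    by (metis inverse_positive_iff_positive of_nat_0_less_iff zero_less_Suc)
  then obtain p where p: "\<And>k. real_polynomial_function (p k)"
    "\<And>k x. x \<in> {0..1} \<Longrightarrow> \<bar>q x - p k x\<bar> < inverse (real (Suc k))" by metis
  obtain b where "\<forall>y\<in>q ` {0..1}. norm y \<le> b"
    using compact_imp_bounded[OF compact_continuous_image[OF q compact_Icc]]
    unfolding bounded_iff by blast
  then have b: "\<bar>q x\<bar> \<le> b" if "x \<in> {0..1}" for x
    using that by simp
  show ?thesis
  proof (rule approx_bdd_sequence[where G="\<lambda>k \<phi>. p k (g \<phi>)" and b="b + 1"])
    show "approx_bdd (\<lambda>\<phi>. p k (g \<phi>))" for k by (rule approx_bdd_polynomial[OF p(1) g(1)])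
    fix \<phi> assume \<phi>: "\<phi> \<in> counting_measures R"
    show "\<bar>p k (g \<phi>)\<bar> \<le> b + 1" for k
    proof -
      have "inverse (real (Suc k)) \<le> 1" by (simp add: field_simps)
      then show ?thesis
        using b[OF g(2)[OF \<phi>]] p(2)[OF g(2)[OF \<phi>], of k] by linarith
    qed
    have "(\<lambda>k. p k (g \<phi>) - q (g \<phi>)) \<longlonglongrightarrow> 0"
      using p(2)[OF g(2)[OF \<phi>]]
      by (intro Lim_null_comparison[OF _ LIMSEQ_inverse_real_of_nat] eventuallyI)
         (auto simp: abs_minus_commute less_imp_le)
    then show "(\<lambda>k. p k (g \<phi>)) \<longlonglongrightarrow> q (g \<phi>)" by (simp add: LIM_zero_iff)
  qed
qed

lemma le_iff_expneg: "t \<le> ennreal a \<longleftrightarrow> exp (- a) \<le> expneg t" if "0 \<le> a"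
  using that by (cases t) (auto simp: expneg_def top_unique)

text \<open>For y = exp (- \<phi> B) and a = r the number min 1 (y / exp (- r)) is 1 exactly when
  \<phi> B \<le> r, and otherwise it lies in [0, 1). Its k-th powers, continuous in y, therefore
  tend to the indicator. For a = \<infinity> the event is everything.\<close>

lemma approx_bdd_level_finite:
  assumes B: "B \<in> sets R" "emeasure R B < \<infinity>"
  shows "approx_bdd (indicator {\<phi>\<in>counting_measures R. emeasure \<phi> B \<le> a})"
proof (cases a)
  case (real r)
  let ?q = "\<lambda>k y. (min 1 (y / exp (- r))) ^ k"
  let ?y = "exp_fun (\<lambda>x. 1 * indicator B x)"
  have y: "?y \<phi> = expneg (emeasure \<phi> B)" if "\<phi> \<in> counting_measures R" for \<phi>
    using exp_fun_indicator[OF B(1) that, of 1] by simp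
  show ?thesis
  proof (rule approx_bdd_sequence[where G="\<lambda>k \<phi>. ?q k (?y \<phi>)" and b=1])
    show "approx_bdd (\<lambda>\<phi>. ?q k (?y \<phi>))" for k
      by (rule approx_bdd_continuous[OF exp_span_approx[OF exp_span.exp_fun[OF indicator_test_fun[OF B]]]])
         (auto intro!: continuous_intros)
    fix \<phi> assume \<phi>: "\<phi> \<in> counting_measures R"
    have nn: "0 \<le> min 1 (?y \<phi> / exp (- r))" by auto
    show "\<bar>?q k (?y \<phi>)\<bar> \<le> 1" for k
      using power_le_one[OF nn, of k] nn by simp
    show "(\<lambda>k. ?q k (?y \<phi>)) \<longlonglongrightarrow> indicator {\<phi>\<in>counting_measures R. emeasure \<phi> B \<le> a} \<phi>"
    proof (cases "emeasure \<phi> B \<le> a")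
      case True
      then have "min 1 (?y \<phi> / exp (- r)) = 1"
        using le_iff_expneg[OF real(1)] real(2) y[OF \<phi>] by (simp add: field_simps min_def)
      then show ?thesis using True \<phi> by simp
    next
      case False
      then have "min 1 (?y \<phi> / exp (- r)) < 1"
        using le_iff_expneg[OF real(1)] real(2) y[OF \<phi>] by (simp add: field_simps min_def)
      then have "(\<lambda>k. ?q k (?y \<phi>)) \<longlonglongrightarrow> 0" using nn by (intro LIMSEQ_realpow_zero)
      then show ?thesis using False by simp
    qed
  qed
next
  case top
  show ?thesis
    by (rule approx_bdd_cong[OF approx_bdd_const[of 1]]) (simp add: top)
qed

text \<open>Along an exhaustion by sets of finite measure, \<phi> (B \<inter> A k) increases to
  \<phi> B. If \<phi> B > a, the inequality fails from some k on, so the indicators converge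
  pointwise.\<close>

lemma approx_bdd_level:
  assumes B: "B \<in> sets R"
  shows "approx_bdd (indicator {\<phi>\<in>counting_measures R. emeasure \<phi> B \<le> a})"
proof -
  obtain A :: "nat \<Rightarrow> 'a set" where A: "range A \<subseteq> sets R" "(\<Union>i. A i) = space R"
    "\<And>i. emeasure R (A i) \<noteq> \<infinity>" "incseq A"
    using R.sigma_finite_incseq by metis
  let ?G = "\<lambda>k. indicator {\<phi>\<in>counting_measures R. emeasure \<phi> (B \<inter> A k) \<le> a} :: _ \<Rightarrow> real"
  show ?thesis
  proof (rule approx_bdd_sequence[where G="?G" and b=1])
    show "approx_bdd (?G k)" for k
    proof (rule approx_bdd_level_finite)
      show "B \<inter> A k \<in> sets R" using A B by auto
      have "emeasure R (B \<inter> A k) \<le> emeasure R (A k)" using A by (intro emeasure_mono) auto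
      then show "emeasure R (B \<inter> A k) < \<infinity>" using A(3)[of k] by (auto simp: less_top order.strict_trans1)
    qed
    show "\<bar>?G k \<phi>\<bar> \<le> 1" for k \<phi> by (simp add: indicator_def)
    fix \<phi> assume \<phi>: "\<phi> \<in> counting_measures R"
    note D = counting_measuresD[OF \<phi>]
    have inc: "incseq (\<lambda>k. B \<inter> A k)" using A(4) by (auto simp: incseq_def)
    have lim: "(\<lambda>k. emeasure \<phi> (B \<inter> A k)) \<longlonglongrightarrow> emeasure \<phi> (\<Union>k. B \<inter> A k)"
      using A(1) B D(1) inc by (intro Lim_emeasure_incseq) auto
    have un: "(\<Union>k. B \<inter> A k) = B" using A(2) sets.sets_into_space[OF B] by auto
    have mono: "emeasure \<phi> (B \<inter> A k) \<le> emeasure \<phi> B" for k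
      using B D(1) by (intro emeasure_mono) auto
    show "(\<lambda>k. ?G k \<phi>) \<longlonglongrightarrow> indicator {\<phi>\<in>counting_measures R. emeasure \<phi> B \<le> a} \<phi>"
    proof (cases "emeasure \<phi> B \<le> a")
      case True
      then have "emeasure \<phi> (B \<inter> A k) \<le> a" for k using mono order_trans by blast
      then show ?thesis using True \<phi> by simp
    next
      case False
      then have "\<forall>\<^sub>F k in sequentially. a < emeasure \<phi> (B \<inter> A k)"
        using lim un by (intro order_tendstoD(1)[OF lim]) auto
      then have "\<forall>\<^sub>F k in sequentially. ?G k \<phi> = 0"
        by eventually_elim (simp add: not_le[symmetric])
      then show ?thesis using False by (simp add: tendsto_eventually)
    qed
  qed
qed

lemma approx_bdd_indicator:
  assumes "A \<in> sets (counting_space R)"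
  shows "approx_bdd (indicator A)"
  using assms unfolding sets_counting_space_le
proof (induction rule: sigma_sets.induct)
  case (Basic A)
  then show ?case using approx_bdd_level by auto
next
  case Empty
  show ?case
    by (rule approx_bdd_cong[OF approx_bdd_const[of 0]]) simp
next
  case (Compl A)
  have "approx_bdd (\<lambda>\<phi>. 1 + (-1) * indicator A \<phi>)"
    by (intro approx_bdd_add approx_bdd_scale Compl approx_bdd_const)
  then show ?case by (rule approx_bdd_cong) (simp add: indicator_def)
next
  case (Union A)
  \<comment> \<open>A union is the complement of the product of the complements. Since the class is
    closed under products, the sets need not be disjoint and the induction can run over the whole
    sigma-algebra at once.\<close>
  let ?G = "\<lambda>k \<phi>. 1 + (-1) * (\<Prod>i<k. 1 + (-1) * indicator (A i) \<phi>) :: real"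
  have G: "?G k \<phi> = indicator (\<Union>i<k. A i) \<phi>" for k \<phi>
    by (induction k) (auto simp: indicator_def lessThan_Suc)
  show ?case
  proof (rule approx_bdd_sequence[where G="?G" and b=1])
    have "approx_bdd (\<lambda>\<phi>. \<Prod>i<k. 1 + (-1) * indicator (A i) \<phi>)" for k
    proof (induction k)
      case 0
      then show ?case using approx_bdd_const[of 1] by simp
    next
      case (Suc k)
      then show ?case
        unfolding prod.lessThan_Suc
        by (intro approx_bdd_mult approx_bdd_add approx_bdd_scale Suc Union approx_bdd_const)
    qed
    then show "approx_bdd (?G k)" for k
      by (intro approx_bdd_add approx_bdd_scale approx_bdd_const)
    show "\<bar>?G k \<phi>\<bar> \<le> 1" for k \<phi> unfolding G by (simp add: indicator_def)
    show "(\<lambda>k. ?G k \<phi>) \<longlonglongrightarrow> indicator (\<Union>i. A i) \<phi>" for \<phi>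
      unfolding G by (rule LIMSEQ_indicator_UN)
  qed
qed

text \<open>Induction over nonnegative measurable functions. The fact \<open>dom\<close> passes
  square integrability from a function down to its parts, as the induction hypotheses ask for
  it.\<close>

lemma approx_nonneg:
  assumes f: "f \<in> borel_measurable (counting_space R)" "\<And>\<phi>. 0 \<le> f \<phi>"
    and int: "\<And>M. M \<in> \<M> \<Longrightarrow> integrable M (\<lambda>\<phi>. (f \<phi>)\<^sup>2)"
  shows "approx f"
proof -
  have dom: "integrable M (\<lambda>\<phi>. (u \<phi>)\<^sup>2)"
    if "integrable M (\<lambda>\<phi>. (v \<phi>)\<^sup>2)" "M \<in> \<M>" "u \<in> borel_measurable (counting_space R)"
      "\<And>\<phi>. \<phi> \<in> counting_measures R \<Longrightarrow> 0 \<le> u \<phi> \<and> u \<phi> \<le> v \<phi>" for u v :: "'a measure \<Rightarrow> real" and M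
  proof (rule Bochner_Integration.integrable_bound[OF that(1)])
    show "(\<lambda>\<phi>. (u \<phi>)\<^sup>2) \<in> borel_measurable M"
      using that(3) by (intro measurable_family[OF that(2)]) measurable
    show "AE \<phi> in M. norm ((u \<phi>)\<^sup>2) \<le> norm ((v \<phi>)\<^sup>2)"
      using that(4) space_family[OF that(2)] by (auto intro!: AE_I2 power_mono)
  qed
  show ?thesis
    using f(1) f(2) int
  proof (induction rule: borel_measurable_induct_real)
    case (set A)
    then show ?case using approx_bdd_indicator by (auto simp: approx_bdd_def)
  next
    case (mult u c)
    show ?case
    \<comment> \<open>For c = 0 the integrability of the square of c * u says nothing about u, and
      the induction hypothesis cannot be used.\<close>
    proof (cases "c = 0")
      case True
      then show ?thesis using approx_bdd_const[of 0] by (simp add: approx_bdd_def)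
    next
      case False
      then have "integrable M (\<lambda>\<phi>. (u \<phi>)\<^sup>2)" if "M \<in> \<M>" for M
        using mult.prems[OF that] by (simp add: power_mult_distrib)
      then show ?thesis using mult by (intro approx_scale) auto
    qed
  next
    case (add u v)
    have "integrable M (\<lambda>\<phi>. (u \<phi>)\<^sup>2)" "integrable M (\<lambda>\<phi>. (v \<phi>)\<^sup>2)" if "M \<in> \<M>" for M
      using add by (auto intro!: dom[OF add.prems[OF that] that])
    then show ?case using add by (intro approx_add) auto
  next
    case (seq U)
    have le: "U i \<phi> \<le> f \<phi>" if "\<phi> \<in> counting_measures R" for i \<phi>
      using that seq.hyps(3) seq.hyps(4)[of \<phi>] incseq_le[of "\<lambda>i. U i \<phi>" "f \<phi>" i]
      by (auto simp: incseq_def le_fun_def space_counting_space)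
    show ?case
    proof (rule approx_sequence[OF f(1), where G=U and H="\<lambda>_ \<phi>. (f \<phi>)\<^sup>2"])
      show "approx (U k)" for k
        using seq le by (intro seq.IH dom[OF seq.prems]) auto
      show "(U k \<phi>)\<^sup>2 \<le> (f \<phi>)\<^sup>2" if "\<phi> \<in> counting_measures R" for k \<phi>
        using le[OF that] seq.hyps(2) by (intro power_mono) auto
    qed (use seq in \<open>auto simp: space_counting_space\<close>)
  qed
qed

lemma approx_L2:
  assumes f: "f \<in> borel_measurable (counting_space R)"
    and int: "\<And>M. M \<in> \<M> \<Longrightarrow> integrable M (\<lambda>\<phi>. (f \<phi>)\<^sup>2)"
  shows "approx f"
proof -
  have "approx (\<lambda>\<phi>. max 0 (f \<phi>))" (is ?p) "approx (\<lambda>\<phi>. max 0 (- f \<phi>))" (is ?n)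
    "\<And>M. M \<in> \<M> \<Longrightarrow> integrable M (\<lambda>\<phi>. (max 0 (f \<phi>))\<^sup>2)"
    "\<And>M. M \<in> \<M> \<Longrightarrow> integrable M (\<lambda>\<phi>. (- 1 * max 0 (- f \<phi>))\<^sup>2)"
  proof -
    have i: "integrable M (\<lambda>\<phi>. (g \<phi>)\<^sup>2)" if "M \<in> \<M>" "g \<in> borel_measurable (counting_space R)" "\<And>\<phi>. \<bar>g \<phi>\<bar> \<le> \<bar>f \<phi>\<bar>"
      for M and g :: "'a measure \<Rightarrow> real"
      using that(2,3)
      by (intro Bochner_Integration.integrable_bound[OF int[OF that(1)]] measurable_family[OF that(1)])
         (auto simp: abs_le_square_iff[symmetric])
    show ?p ?n "\<And>M. M \<in> \<M> \<Longrightarrow> integrable M (\<lambda>\<phi>. (max 0 (f \<phi>))\<^sup>2)"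
      "\<And>M. M \<in> \<M> \<Longrightarrow> integrable M (\<lambda>\<phi>. (- 1 * max 0 (- f \<phi>))\<^sup>2)"
      using f by (auto intro!: approx_nonneg i)
  qed
  then have "approx (\<lambda>\<phi>. max 0 (f \<phi>) + (- 1) * max 0 (- f \<phi>))"
    using f by (intro approx_add approx_scale) auto
  then show ?thesis
    by (rule approx_cong) auto
qed

end

subsection \<open>Square integrable functions\<close>

lemma integrable_mult_L2:
  assumes "f \<in> borel_measurable M" "g \<in> borel_measurable M"
    "integrable M (\<lambda>x. (f x)\<^sup>2)" "integrable M (\<lambda>x. (g x)\<^sup>2)"
  shows "integrable M (\<lambda>x. f x * g x :: real)"
proof (rule Bochner_Integration.integrable_bound)
  show "integrable M (\<lambda>x. (f x)\<^sup>2 + (g x)\<^sup>2)" using assms by auto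
  have "\<bar>f x * g x\<bar> \<le> (f x)\<^sup>2 + (g x)\<^sup>2" for x
  proof -
    have "2 * \<bar>f x * g x\<bar> \<le> (f x)\<^sup>2 + (g x)\<^sup>2"
      using sum_squares_bound[of "\<bar>f x\<bar>" "\<bar>g x\<bar>"] by (simp add: abs_mult)
    then show ?thesis using abs_ge_zero[of "f x * g x"] by linarith
  qed
  then show "AE x in M. norm (f x * g x) \<le> norm ((f x)\<^sup>2 + (g x)\<^sup>2)" by auto
qed (use assms in measurable)

lemma integrable_add_L2:
  assumes "f \<in> borel_measurable M" "g \<in> borel_measurable M"
    "integrable M (\<lambda>x. (f x)\<^sup>2)" "integrable M (\<lambda>x. (g x)\<^sup>2)"
  shows "integrable M (\<lambda>x. (f x + g x :: real)\<^sup>2)"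
  using assms integrable_mult_L2[OF assms] by (auto simp: power2_sum mult.assoc)

text \<open>The discriminant argument for the quadratic polynomial t |-> \<integral> (f + t g)^2,
  which is nonnegative.\<close>

lemma Cauchy_Schwarz_integral_sq:
  assumes "f \<in> borel_measurable M" "g \<in> borel_measurable M"
    "integrable M (\<lambda>x. (f x)\<^sup>2)" "integrable M (\<lambda>x. (g x)\<^sup>2)"
  shows "(\<integral>x. f x * g x \<partial>M)\<^sup>2 \<le> (\<integral>x. (f x)\<^sup>2 \<partial>M) * (\<integral>x. (g x :: real)\<^sup>2 \<partial>M)"
proof -
  let ?A = "\<integral>x. (f x)\<^sup>2 \<partial>M" and ?B = "\<integral>x. f x * g x \<partial>M" and ?C = "\<integral>x. (g x)\<^sup>2 \<partial>M"
  note fg = integrable_mult_L2[OF assms]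
  have quad: "0 \<le> ?A + 2 * t * ?B + t\<^sup>2 * ?C" for t
  proof -
    have "0 \<le> (\<integral>x. (f x + t * g x)\<^sup>2 \<partial>M)" by simp
    also have "(\<lambda>x. (f x + t * g x)\<^sup>2) = (\<lambda>x. (f x)\<^sup>2 + (2 * t) * (f x * g x) + t\<^sup>2 * (g x)\<^sup>2)"
      by (auto simp: power2_eq_square algebra_simps)
    also have "(\<integral>x. (f x)\<^sup>2 + (2 * t) * (f x * g x) + t\<^sup>2 * (g x)\<^sup>2 \<partial>M) = ?A + 2 * t * ?B + t\<^sup>2 * ?C"
      using assms fg by simp
    finally show ?thesis .
  qed
  show ?thesis
  proof (cases "?C = 0")
    case True
    have "?B = 0"
    proof (rule ccontr)
      assume B: "?B \<noteq> 0"
      \<comment> \<open>Without the quadratic term the polynomial is affine; at this t it takes the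
        value -1.\<close>
      show False using quad[of "- (?A + 1) / (2 * ?B)"] B True by (simp add: field_simps)
    qed
    then show ?thesis using True by simp
  next
    case False
    moreover have "0 \<le> ?C" by simp
    ultimately have C: "0 < ?C" by linarith
    have "?A + 2 * (- ?B / ?C) * ?B + (- ?B / ?C)\<^sup>2 * ?C = ?A - ?B\<^sup>2 / ?C"
      using C by (simp add: power2_eq_square field_simps)
    then have "?B\<^sup>2 / ?C \<le> ?A" using quad[of "- ?B / ?C"] by linarith
    then show ?thesis using C by (simp add: pos_divide_le_eq)
  qed
qed

definition L2_norm :: "'b measure \<Rightarrow> ('b \<Rightarrow> real) \<Rightarrow> real" where
  "L2_norm M f = sqrt (\<integral>x. (f x)\<^sup>2 \<partial>M)"

lemma L2_norm_nonneg [simp]: "0 \<le> L2_norm M f"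
  by (simp add: L2_norm_def)

lemma L2_norm_power2: "(L2_norm M f)\<^sup>2 = (\<integral>x. (f x)\<^sup>2 \<partial>M)"
  by (simp add: L2_norm_def)

lemma L2_norm_abs [simp]: "L2_norm M (\<lambda>x. \<bar>f x\<bar>) = L2_norm M f"
  by (simp add: L2_norm_def)

lemma L2_norm_diff_commute: "L2_norm M (\<lambda>x. f x - g x) = L2_norm M (\<lambda>x. g x - f x)"
  by (simp add: L2_norm_def power2_commute)

lemma Cauchy_Schwarz_integral:
  assumes "f \<in> borel_measurable M" "g \<in> borel_measurable M"
    "integrable M (\<lambda>x. (f x)\<^sup>2)" "integrable M (\<lambda>x. (g x)\<^sup>2)"
  shows "\<bar>\<integral>x. f x * g x \<partial>M\<bar> \<le> L2_norm M f * L2_norm M g"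
  by (rule power2_le_imp_le)
     (use Cauchy_Schwarz_integral_sq[OF assms] in \<open>simp_all add: power_mult_distrib L2_norm_power2\<close>)

lemma L2_norm_triangle:
  assumes "f \<in> borel_measurable M" "g \<in> borel_measurable M"
    "integrable M (\<lambda>x. (f x)\<^sup>2)" "integrable M (\<lambda>x. (g x)\<^sup>2)"
  shows "L2_norm M (\<lambda>x. f x + g x) \<le> L2_norm M f + L2_norm M g"
proof (rule power2_le_imp_le)
  have "(L2_norm M (\<lambda>x. f x + g x))\<^sup>2 = (L2_norm M f)\<^sup>2 + (L2_norm M g)\<^sup>2 + 2 * (\<integral>x. f x * g x \<partial>M)"
    using assms integrable_mult_L2[OF assms] by (simp add: L2_norm_power2 power2_sum mult.assoc)
  also have "\<dots> \<le> (L2_norm M f)\<^sup>2 + (L2_norm M g)\<^sup>2 + 2 * (L2_norm M f * L2_norm M g)"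
    using Cauchy_Schwarz_integral[OF assms] by simp
  finally show "(L2_norm M (\<lambda>x. f x + g x))\<^sup>2 \<le> (L2_norm M f + L2_norm M g)\<^sup>2"
    by (simp add: power2_sum)
qed simp

lemma abs_integral_le_L2_norm:
  assumes "finite_measure M" "f \<in> borel_measurable M" "integrable M (\<lambda>x. (f x)\<^sup>2)"
  shows "integrable M f" "(\<integral>x. \<bar>f x\<bar> \<partial>M) \<le> L2_norm M f * sqrt (measure M (space M))"
proof -
  interpret finite_measure M by fact
  have one: "integrable M (\<lambda>x. 1\<^sup>2 :: real)" by simp
  show "integrable M f"
    using integrable_mult_L2[OF assms(2) _ assms(3) one] by simp
  have "(\<integral>x. \<bar>f x\<bar> * 1 \<partial>M) \<le> L2_norm M (\<lambda>x. \<bar>f x\<bar>) * L2_norm M (\<lambda>_. 1)"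
    using assms one by (intro order_trans[OF abs_ge_self Cauchy_Schwarz_integral]) auto
  then show "(\<integral>x. \<bar>f x\<bar> \<partial>M) \<le> L2_norm M f * sqrt (measure M (space M))"
    by (simp add: L2_norm_def[of M "\<lambda>_. 1"])
qed

subsection \<open>Positive semidefinite kernels\<close>

definition psd :: "'i set \<Rightarrow> ('i \<Rightarrow> 'i \<Rightarrow> real) \<Rightarrow> bool" where
  "psd T K \<longleftrightarrow> (\<forall>a. 0 \<le> (\<Sum>i\<in>T. \<Sum>j\<in>T. a i * a j * K i j))"

lemma psdD: "psd T K \<Longrightarrow> 0 \<le> (\<Sum>i\<in>T. \<Sum>j\<in>T. a i * a j * K i j)"
  by (simp add: psd_def)

lemma quad_square: "(\<Sum>i\<in>T. \<Sum>j\<in>T. b i * b j) = (\<Sum>i\<in>T. b i :: real)\<^sup>2"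
  by (simp add: power2_eq_square sum_product)

lemma psd_one: "psd T (\<lambda>_ _. 1)"
  by (simp add: psd_def quad_square)

text \<open>The index type is arbitrary because the argument for the tilt enlarges the family by one
  vector with index \<open>None\<close>. In the application M is R and v i is exp (- u i) -
  1.\<close>

locale gram =
  fixes M :: "'b measure" and T :: "'i set" and v :: "'i \<Rightarrow> 'b \<Rightarrow> real"
  assumes fin: "finite T"
    and meas: "\<And>i. i \<in> T \<Longrightarrow> v i \<in> borel_measurable M"
    and sq: "\<And>i. i \<in> T \<Longrightarrow> integrable M (\<lambda>x. (v i x)\<^sup>2)"
begin

definition V :: "'i \<Rightarrow> 'i \<Rightarrow> real" where
  "V i j = (\<integral>x. v i x * v j x \<partial>M)"

lemma int_V: "i \<in> T \<Longrightarrow> j \<in> T \<Longrightarrow> integrable M (\<lambda>x. v i x * v j x)"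
  by (intro integrable_mult_L2 meas sq)

text \<open>A special case of the Schur product theorem: the quadratic form of the product is the
  integral over \<open>x\<close> of the form of \<open>K\<close> at the vector \<open>a i * v i x\<close>.\<close>

lemma psd_mult_V:
  assumes "psd T K"
  shows "psd T (\<lambda>i j. K i j * V i j)"
  unfolding psd_def
proof
  fix a
  have "(\<Sum>i\<in>T. \<Sum>j\<in>T. a i * a j * (K i j * V i j)) =
      (\<Sum>i\<in>T. \<Sum>j\<in>T. \<integral>x. a i * a j * K i j * (v i x * v j x) \<partial>M)"
    by (simp add: V_def mult.assoc)
  also have "\<dots> = (\<integral>x. (\<Sum>i\<in>T. \<Sum>j\<in>T. a i * a j * K i j * (v i x * v j x)) \<partial>M)"
    using int_V by (simp add: Bochner_Integration.integral_sum)
  also have "\<dots> = (\<integral>x. (\<Sum>i\<in>T. \<Sum>j\<in>T. (a i * v i x) * (a j * v j x) * K i j) \<partial>M)"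
    by (simp add: mult_ac)
  also have "0 \<le> \<dots>"
    using psdD[OF assms] by (intro integral_nonneg_AE) auto
  finally show "0 \<le> (\<Sum>i\<in>T. \<Sum>j\<in>T. a i * a j * (K i j * V i j))" .
qed

lemma psd_mult_V_power: "psd T K \<Longrightarrow> psd T (\<lambda>i j. K i j * V i j ^ n)"
proof (induction n)
  case (Suc n)
  then show ?case using psd_mult_V[of "\<lambda>i j. K i j * V i j ^ n"] by (simp add: mult_ac)
qed simp

lemma quad_exp_sums:
  "(\<lambda>n. c ^ n / fact n * (\<Sum>i\<in>T. \<Sum>j\<in>T. a i * a j * (K i j * V i j ^ n))) sums
     (\<Sum>i\<in>T. \<Sum>j\<in>T. a i * a j * (K i j * exp (c * V i j)))"
proof -
  have "(\<lambda>n. a i * a j * K i j * ((c * V i j) ^ n /\<^sub>R fact n)) sums (a i * a j * K i j * exp (c * V i j))" for i j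
    by (intro sums_mult exp_converges)
  then have "(\<lambda>n. \<Sum>i\<in>T. \<Sum>j\<in>T. a i * a j * K i j * ((c * V i j) ^ n /\<^sub>R fact n)) sums
      (\<Sum>i\<in>T. \<Sum>j\<in>T. a i * a j * K i j * exp (c * V i j))"
    by (intro sums_sum)
  also have "(\<lambda>n. \<Sum>i\<in>T. \<Sum>j\<in>T. a i * a j * K i j * ((c * V i j) ^ n /\<^sub>R fact n)) =
      (\<lambda>n. c ^ n / fact n * (\<Sum>i\<in>T. \<Sum>j\<in>T. a i * a j * (K i j * V i j ^ n)))"
    by (simp add: sum_distrib_left power_mult_distrib divide_inverse mult_ac)
  finally show ?thesis by (simp add: mult.assoc)
qed

text \<open>The kernel is an exponential series of Schur powers whose coefficients c^n / n! are
  nonnegative.\<close>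

lemma psd_mult_exp:
  assumes "psd T K" "0 \<le> c"
  shows "psd T (\<lambda>i j. K i j * exp (c * V i j))"
  unfolding psd_def
proof
  fix a
  have "0 \<le> c ^ n / fact n * (\<Sum>i\<in>T. \<Sum>j\<in>T. a i * a j * (K i j * V i j ^ n))" for n
    using psdD[OF psd_mult_V_power[OF assms(1), of n], of a] assms(2) by simp
  then have "0 \<le> (\<Sum>n. c ^ n / fact n * (\<Sum>i\<in>T. \<Sum>j\<in>T. a i * a j * (K i j * V i j ^ n)))"
    using quad_exp_sums[of c a K] by (intro suminf_nonneg) (auto simp: sums_iff)
  then show "0 \<le> (\<Sum>i\<in>T. \<Sum>j\<in>T. a i * a j * (K i j * exp (c * V i j)))"
    using quad_exp_sums[of c a K] by (simp add: sums_iff)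
qed

text \<open>One term of the exponential series of \<open>V / 2\<close> is dominated by the whole series.\<close>

lemma quad_power_le_exp:
  "(\<Sum>i\<in>T. \<Sum>j\<in>T. a i * a j * (exp (V i j / 2) * V i j ^ n)) \<le>
    fact n * 2 ^ n * (\<Sum>i\<in>T. \<Sum>j\<in>T. a i * a j * exp (V i j))"
proof -
  let ?q = "\<lambda>n. (\<Sum>i\<in>T. \<Sum>j\<in>T. a i * a j * (exp (1 / 2 * V i j) * V i j ^ n))"
  have p: "psd T (\<lambda>i j. exp (1 / 2 * V i j))"
    using psd_mult_exp[OF psd_one, of "1/2"] by simp
  have nn: "0 \<le> (1/2) ^ n / fact n * ?q n" for n
    using psdD[OF psd_mult_V_power[OF p, of n], of a] by simp
  have s: "(\<lambda>n. (1/2) ^ n / fact n * ?q n) sums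
      (\<Sum>i\<in>T. \<Sum>j\<in>T. a i * a j * (exp (1 / 2 * V i j) * exp (1 / 2 * V i j)))"
    by (rule quad_exp_sums)
  have "(1/2) ^ n / fact n * ?q n \<le> (\<Sum>i\<in>T. \<Sum>j\<in>T. a i * a j * (exp (1 / 2 * V i j) * exp (1 / 2 * V i j)))"
    using sum_le_suminf[of "\<lambda>n. (1/2) ^ n / fact n * ?q n" "{n}"] s nn by (simp add: sums_iff)
  also have "\<dots> = (\<Sum>i\<in>T. \<Sum>j\<in>T. a i * a j * exp (V i j))"
    by (simp flip: exp_add)
  finally show ?thesis
    by (simp add: field_simps)
qed

end

text \<open>The kernel \<open>exp (V / 2)\<close> is positive semidefinite also after the vector \<open>2 g\<close> has been added
  to the family \<open>v\<close>; the Schur complement of that vector is the assertion.\<close>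

lemma (in gram) psd_exp_tilt:
  assumes g: "g \<in> borel_measurable M" "integrable M (\<lambda>x. (g x)\<^sup>2)"
  shows "psd T (\<lambda>i j. exp (2 * (\<integral>x. (g x)\<^sup>2 \<partial>M)) * exp (V i j / 2) -
    exp (\<integral>x. v i x * g x \<partial>M) * exp (\<integral>x. v j x * g x \<partial>M))"
  unfolding psd_def
proof
  fix a
  define G where "G = exp (2 * (\<integral>x. (g x)\<^sup>2 \<partial>M))"
  define P where "P i = exp (\<integral>x. v i x * g x \<partial>M)" for i
  define W where "W = (\<Sum>i\<in>T. a i * P i)"
  define Q where "Q = (\<Sum>i\<in>T. \<Sum>j\<in>T. a i * a j * exp (V i j / 2))"
  let ?T = "insert None (Some ` T)"
  \<comment> \<open>The factor 2 cancels the 1/2 in the kernel: the mixed entries become exp <v i,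
    g>, and the new diagonal entry is exp (4 |g|^2 / 2) = exp (2 |g|^2), which is the constant of
    the statement.\<close>
  let ?v = "case_option (\<lambda>x. 2 * g x) v"
  interpret E: gram M ?T ?v
    by unfold_locales (use fin meas sq g in \<open>auto simp: power_mult_distrib\<close>)
  have psd: "psd ?T (\<lambda>i j. exp (E.V i j / 2))"
    using E.psd_mult_exp[OF psd_one, of "1/2"] by simp
  have VV: "E.V (Some i) (Some j) = V i j" for i j by (simp add: E.V_def V_def)
  have VN: "exp (E.V (Some i) None / 2) = P i" "exp (E.V None (Some i) / 2) = P i" for i
  proof -
    have "E.V (Some i) None = 2 * (\<integral>x. v i x * g x \<partial>M)" "E.V None (Some i) = 2 * (\<integral>x. v i x * g x \<partial>M)"
      unfolding E.V_def by (simp_all add: mult_ac flip: integral_mult_right_zero)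
    then show "exp (E.V (Some i) None / 2) = P i" "exp (E.V None (Some i) / 2) = P i"
      by (simp_all add: P_def)
  qed
  have NN: "exp (E.V None None / 2) = G"
  proof -
    have "E.V None None = 4 * (\<integral>x. (g x)\<^sup>2 \<partial>M)"
      unfolding E.V_def by (simp add: power2_eq_square mult_ac flip: integral_mult_right_zero)
    then show ?thesis by (simp add: G_def)
  qed
  \<comment> \<open>This is the minimiser of b^2 G + 2 b W + Q, the quadratic form with coefficient
    b at the adjoined vector.\<close>
  define b where "b = - W / G"
  have G: "0 < G" by (simp add: G_def)
  have "0 \<le> (\<Sum>i\<in>?T. \<Sum>j\<in>?T. case_option b a i * case_option b a j * exp (E.V i j / 2))"
    by (rule psdD[OF psd])
  also have "\<dots> = b * b * G + (\<Sum>j\<in>T. b * a j * P j) + (\<Sum>i\<in>T. a i * b * P i + (\<Sum>j\<in>T. a i * a j * exp (V i j / 2)))"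
    using fin by (simp add: sum.reindex VV VN NN)
  also have "\<dots> = b * b * G + 2 * b * W + Q"
    by (simp add: W_def Q_def sum.distrib sum_distrib_left mult_ac)
  also have "\<dots> = Q - W\<^sup>2 / G"
    using G by (simp add: b_def power2_eq_square field_simps)
  finally have "W\<^sup>2 \<le> G * Q" using G by (simp add: field_simps)
  moreover have "(\<Sum>i\<in>T. \<Sum>j\<in>T. a i * a j * (G * exp (V i j / 2) - P i * P j)) =
      G * Q - (\<Sum>i\<in>T. \<Sum>j\<in>T. (a i * P i) * (a j * P j))"
    by (simp add: Q_def right_diff_distrib sum_subtractf sum_distrib_left mult_ac)
  ultimately show "0 \<le> (\<Sum>i\<in>T. \<Sum>j\<in>T. a i * a j * (exp (2 * (\<integral>x. (g x)\<^sup>2 \<partial>M)) * exp (V i j / 2) -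
      exp (\<integral>x. v i x * g x \<partial>M) * exp (\<integral>x. v j x * g x \<partial>M)))"
    unfolding quad_square W_def[symmetric] G_def[symmetric] P_def[symmetric] by simp
qed

text \<open>Each half of exp V = exp (V/2) * exp (V/2) is spent once. The Schur product of V^n with
  the kernel of \<open>psd_exp_tilt\<close> replaces the rank-one factor exp <v i, g> * exp <v j, g>
  by a multiple of exp (V/2); then \<open>quad_power_le_exp\<close> exchanges V^n for the second
  half.\<close>

lemma (in gram) quad_tilt_le:
  assumes g: "g \<in> borel_measurable M" "integrable M (\<lambda>x. (g x)\<^sup>2)"
  shows "(\<Sum>i\<in>T. \<Sum>j\<in>T. (a i * exp (\<integral>x. v i x * g x \<partial>M)) * (a j * exp (\<integral>x. v j x * g x \<partial>M)) * V i j ^ n) \<le>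
    exp (2 * (\<integral>x. (g x)\<^sup>2 \<partial>M)) * (fact n * 2 ^ n * (\<Sum>i\<in>T. \<Sum>j\<in>T. a i * a j * exp (V i j)))"
proof -
  let ?G = "exp (2 * (\<integral>x. (g x)\<^sup>2 \<partial>M))" and ?P = "\<lambda>i. exp (\<integral>x. v i x * g x \<partial>M)"
  have "0 \<le> (\<Sum>i\<in>T. \<Sum>j\<in>T. a i * a j * ((?G * exp (V i j / 2) - ?P i * ?P j) * V i j ^ n))"
    by (rule psdD[OF psd_mult_V_power[OF psd_exp_tilt[OF g]]])
  also have "\<dots> = ?G * (\<Sum>i\<in>T. \<Sum>j\<in>T. a i * a j * (exp (V i j / 2) * V i j ^ n)) -
      (\<Sum>i\<in>T. \<Sum>j\<in>T. (a i * ?P i) * (a j * ?P j) * V i j ^ n)"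
    by (simp add: left_diff_distrib right_diff_distrib sum_subtractf sum_distrib_left mult_ac)
  finally have "(\<Sum>i\<in>T. \<Sum>j\<in>T. (a i * ?P i) * (a j * ?P j) * V i j ^ n) \<le>
      ?G * (\<Sum>i\<in>T. \<Sum>j\<in>T. a i * a j * (exp (V i j / 2) * V i j ^ n))" by simp
  also have "\<dots> \<le> ?G * (fact n * 2 ^ n * (\<Sum>i\<in>T. \<Sum>j\<in>T. a i * a j * exp (V i j)))"
    by (intro mult_left_mono quad_power_le_exp) simp
  finally show ?thesis .
qed

subsection \<open>Difference operators on exponential functionals\<close>

text \<open>Finitely many unit masses keep sets of finite mass finite, so the countable cover for
  \<phi> still witnesses sigma-finiteness.\<close>

lemma add_points_counting_measures:
  assumes \<phi>: "\<phi> \<in> counting_measures R" and J: "finite J"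
  shows "add_points R \<phi> x J \<in> counting_measures R"
proof -
  note D = counting_measuresD[OF \<phi>]
  have e: "emeasure (add_points R \<phi> x J) B = emeasure \<phi> B + (\<Sum>j\<in>J. indicator B (x j))"
    if "B \<in> sets R" for B
    using that D(1) by (rule emeasure_add_points[rotated])
  have card: "(\<Sum>j\<in>J. indicator B (x j)) = (of_nat (card {j\<in>J. x j \<in> B}) :: ennreal)" for B
    using J by (simp add: indicator_def sum.If_cases Int_def)
  interpret \<phi>: sigma_finite_measure \<phi> by (rule D(3))
  obtain A where A: "countable A" "A \<subseteq> sets \<phi>" "\<Union> A = space \<phi>" "\<And>a. a \<in> A \<Longrightarrow> emeasure \<phi> a \<noteq> \<infinity>"
    using \<phi>.sigma_finite_countable by metis
  have "sigma_finite_measure (add_points R \<phi> x J)"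
  proof
    have "emeasure (add_points R \<phi> x J) a \<noteq> \<infinity>" if "a \<in> A" for a
      using that A D(1) e[of a] unfolding card by (auto simp: subset_eq)
    then show "\<exists>A. countable A \<and> A \<subseteq> sets (add_points R \<phi> x J) \<and>
        \<Union> A = space (add_points R \<phi> x J) \<and> (\<forall>a\<in>A. emeasure (add_points R \<phi> x J) a \<noteq> \<infinity>)"
      using A D(1,2) sets_eq_imp_space_eq[OF sets_add_points[of R \<phi> x J]]
      by (intro exI[of _ A]) auto
  qed
  moreover have "emeasure (add_points R \<phi> x J) B \<in> range ennreal_of_enat" if "B \<in> sets R" for B
  proof -
    obtain k where k: "emeasure \<phi> B = ennreal_of_enat k" using D(4)[OF \<open>B \<in> sets R\<close>] by auto
    then have "emeasure (add_points R \<phi> x J) B = ennreal_of_enat (k + enat (card {j\<in>J. x j \<in> B}))"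
      using e[OF that] k card[of B] by (cases k) (auto simp: ennreal_of_enat_enat)
    then show ?thesis by blast
  qed
  ultimately show ?thesis by (auto simp: counting_measures_def)
qed

lemma exp_fun_add_points:
  assumes u: "u \<in> test_funs R" and \<phi>: "\<phi> \<in> counting_measures R" and J: "finite J"
    and x: "\<And>j. j \<in> J \<Longrightarrow> x j \<in> space R"
  shows "exp_fun u (add_points R \<phi> x J) = exp_fun u \<phi> * (\<Prod>j\<in>J. exp (- u (x j)))"
proof -
  note us = test_funsD(1)[OF u] and un = test_funsD(3)[OF u] and fin = test_funsD(5)[OF u]
  let ?B = "\<lambda>y. u -` {y} \<inter> space R"
  have B: "?B y \<in> sets R" for y using us by (simp add: simple_functionD)
  have one: "(\<Prod>y\<in>u ` space R. expneg (ennreal y * indicator (?B y) (x j))) = exp (- u (x j))" if "j \<in> J" for j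
  proof -
    have "(\<Prod>y\<in>u ` space R. expneg (ennreal y * indicator (?B y) (x j))) =
        (\<Prod>y\<in>{u (x j)}. expneg (ennreal y * indicator (?B y) (x j)))"
      using fin x[OF that] by (intro prod.mono_neutral_right) auto
    then show ?thesis using x[OF that] un by simp
  qed
  have "exp_fun u (add_points R \<phi> x J) =
      (\<Prod>y\<in>u ` space R. expneg (ennreal y * (emeasure \<phi> (?B y) + (\<Sum>j\<in>J. indicator (?B y) (x j)))))"
    using exp_fun_simple[OF us un add_points_counting_measures[OF \<phi> J]]
    by (simp add: emeasure_add_points[OF counting_measuresD(1)[OF \<phi>] B])
  also have "\<dots> = (\<Prod>y\<in>u ` space R. expneg (ennreal y * emeasure \<phi> (?B y))) *
      (\<Prod>y\<in>u ` space R. \<Prod>j\<in>J. expneg (ennreal y * indicator (?B y) (x j)))"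
    by (simp add: distrib_left expneg_add sum_distrib_left expneg_sum prod.distrib)
  also have "(\<Prod>y\<in>u ` space R. \<Prod>j\<in>J. expneg (ennreal y * indicator (?B y) (x j))) = (\<Prod>j\<in>J. exp (- u (x j)))"
    by (subst prod.swap) (simp add: one)
  finally show ?thesis
    using exp_fun_simple[OF us un \<phi>] by simp
qed

text \<open>Joint measurability in points and configuration, as Fubini requires. It suffices to look
  at counts, which are \<phi> B plus finitely many indicators of B.\<close>

lemma add_points_measurable:
  assumes J: "J \<subseteq> I" "finite J"
  shows "(\<lambda>(x, \<phi>). add_points R \<phi> x J) \<in>
    measurable (PiM I (\<lambda>_. R) \<Otimes>\<^sub>M counting_space R) (counting_space R)"
proof (rule measurable_counting_spaceI)
  fix a assume "a \<in> space (PiM I (\<lambda>_. R) \<Otimes>\<^sub>M counting_space R)"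
  then show "(case a of (x, \<phi>) \<Rightarrow> add_points R \<phi> x J) \<in> counting_measures R"
    using add_points_counting_measures[OF _ J(2)] by (auto simp: space_pair_measure space_counting_space)
next
  fix B assume B: "B \<in> sets R"
  have [measurable]: "(\<lambda>a. fst a j) \<in> measurable (PiM I (\<lambda>_. R) \<Otimes>\<^sub>M counting_space R) R" if "j \<in> J" for j
    using that J by (intro measurable_compose[OF measurable_fst] measurable_component_singleton) auto
  have "(\<lambda>a. emeasure (snd a) B + (\<Sum>j\<in>J. indicator B (fst a j))) \<in>
      borel_measurable (PiM I (\<lambda>_. R) \<Otimes>\<^sub>M counting_space R)"
    using B by (intro borel_measurable_add borel_measurable_sum
        measurable_compose[OF measurable_snd measurable_emeasure_counting_space]
        measurable_compose[OF _ borel_measurable_indicator]) auto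
  then show "(\<lambda>a. emeasure (case a of (x, \<phi>) \<Rightarrow> add_points R \<phi> x J) B) \<in>
      borel_measurable (PiM I (\<lambda>_. R) \<Otimes>\<^sub>M counting_space R)"
    by (rule iffD1[OF measurable_cong, rotated])
       (use B in \<open>auto simp: space_pair_measure space_counting_space emeasure_add_points dest: counting_measuresD(1)\<close>)
qed

lemma diff_op_exp_fun:
  assumes u: "u \<in> test_funs R" and \<phi>: "\<phi> \<in> counting_measures R"
    and x: "\<And>j. j \<in> {1..n} \<Longrightarrow> x j \<in> space R"
  shows "diff_op R n x (exp_fun u) \<phi> = exp_fun u \<phi> * (\<Prod>j=1..n. exp (- u (x j)) - 1)"
proof -
  have "diff_op R n x (exp_fun u) \<phi> =
      (\<Sum>J\<in>Pow {1..n}. (-1) ^ (n - card J) * (exp_fun u \<phi> * (\<Prod>j\<in>J. exp (- u (x j)))))"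
    unfolding diff_op_def
  proof (rule sum.cong)
    fix J assume "J \<in> Pow {1..n}"
    then have J: "J \<subseteq> {1..n}" "finite J" by (auto intro: finite_subset)
    show "(-1) ^ (n - card J) * exp_fun u (add_points R \<phi> x J) =
        (-1) ^ (n - card J) * (exp_fun u \<phi> * (\<Prod>j\<in>J. exp (- u (x j))))"
      using exp_fun_add_points[OF u \<phi> J(2), of x] x J(1) by (simp add: subset_eq)
  qed simp
  \<comment> \<open>The sign is read as a product of -1 over the complement of J. The sum over J is
    then the expansion of a product of n binomials exp (- u (x j)) + (-1).\<close>
  also have "\<dots> = exp_fun u \<phi> * (\<Sum>J\<in>Pow {1..n}. (\<Prod>j\<in>J. exp (- u (x j))) * (\<Prod>j\<in>{1..n} - J. -1))"
    unfolding sum_distrib_left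
    by (rule sum.cong) (auto simp: card_Diff_subset finite_subset)
  also have "(\<Sum>J\<in>Pow {1..n}. (\<Prod>j\<in>J. exp (- u (x j))) * (\<Prod>j\<in>{1..n} - J. -1)) =
      (\<Prod>j=1..n. exp (- u (x j)) + (-1))"
    by (rule prod_add[symmetric]) simp
  finally show ?thesis by simp
qed

lemma diff_op_sum:
  "diff_op R n x (\<lambda>\<phi>. \<Sum>i\<in>T. c i * F i \<phi>) \<phi> = (\<Sum>i\<in>T. c i * diff_op R n x (F i) \<phi>)"
  unfolding diff_op_def sum_distrib_left
  by (subst sum.swap) (simp add: mult_ac)

lemma test_funs_minus_one:
  assumes u: "u \<in> test_funs R"
  shows "(\<lambda>x. exp (- u x) - 1) \<in> borel_measurable R"
    "\<bar>exp (- u x) - 1\<bar> \<le> 1"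
    "integrable R (\<lambda>x. exp (- u x) - 1)"
    "integrable R (\<lambda>x. (exp (- u x) - 1)\<^sup>2)"
proof -
  note [measurable] = test_funsD(2)[OF u]
  show [measurable]: "(\<lambda>x. exp (- u x) - 1) \<in> borel_measurable R" by measurable
  show bd: "\<bar>exp (- u x) - 1\<bar> \<le> 1" for x
    using test_funsD(3)[OF u, of x] by (simp add: abs_real_def)
  let ?B = "{x\<in>space R. u x \<noteq> 0}"
  have B: "?B \<in> sets R" by measurable
  have i: "integrable R (indicator ?B :: _ \<Rightarrow> real)"
    using B test_funsD(4)[OF u] by (intro integrable_real_indicator) auto
  show "integrable R (\<lambda>x. exp (- u x) - 1)"
    by (rule Bochner_Integration.integrable_bound[OF i])
       (use bd in \<open>auto simp: indicator_def intro!: AE_I2\<close>)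
  have "(exp (- u x) - 1)\<^sup>2 \<le> 1" for x
    using bd[of x] abs_square_le_1 by blast
  then show "integrable R (\<lambda>x. (exp (- u x) - 1)\<^sup>2)"
    by (intro Bochner_Integration.integrable_bound[OF i])
       (auto simp: indicator_def intro!: AE_I2)
qed

text \<open>Since the indicator of the support of u and g both lie in L2, the density 1 + g has
  finite mass there and the Laplace functional applies. Its exponent splits into \<integral> v and
  <v, g>.\<close>

lemma poisson_expectation_exp_fun:
  assumes Q: "poisson_law (density R (\<lambda>x. ennreal (1 + g x))) Q"
    and g: "g \<in> borel_measurable R" "integrable R (\<lambda>x. (g x)\<^sup>2)" "AE x in R. 0 \<le> 1 + g x"
    and u: "u \<in> test_funs R"
  shows "(\<integral>\<phi>. exp_fun u \<phi> \<partial>Q) = exp (\<integral>x. exp (- u x) - 1 \<partial>R) * exp (\<integral>x. (exp (- u x) - 1) * g x \<partial>R)"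
proof -
  note [measurable] = test_funsD(2)[OF u] g(1)
  note v = test_funs_minus_one[OF u]
  let ?B = "{x\<in>space R. u x \<noteq> 0}" and ?D = "density R (\<lambda>x. ennreal (1 + g x))"
  have B: "?B \<in> sets R" by measurable
  have i: "integrable R (indicator ?B :: _ \<Rightarrow> real)"
    using B test_funsD(4)[OF u] by (intro integrable_real_indicator) auto
  have "(\<lambda>x. (indicator ?B x)\<^sup>2) = (indicator ?B :: _ \<Rightarrow> real)" by (auto simp: indicator_def)
  then have "integrable R (\<lambda>x. indicator ?B x * g x)"
    using i B g by (intro integrable_mult_L2) auto
  then have "integrable R (\<lambda>x. (1 + g x) * indicator ?B x)"
    using i by (simp add: distrib_right mult.commute)
  moreover have "AE x in R. 0 \<le> (1 + g x) * indicator ?B x"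
    using g(3) by eventually_elim (auto simp: indicator_def)
  ultimately have "(\<integral>\<^sup>+x. ennreal ((1 + g x) * indicator ?B x) \<partial>R) < \<infinity>"
    by (simp add: nn_integral_eq_integral)
  moreover have "emeasure ?D ?B = (\<integral>\<^sup>+x. ennreal ((1 + g x) * indicator ?B x) \<partial>R)"
    using B by (subst emeasure_density) (auto intro!: nn_integral_cong simp: indicator_def)
  ultimately have fin: "emeasure ?D ?B < \<infinity>" by simp
  have "(\<integral>\<phi>. exp_fun u \<phi> \<partial>Q) = exp (\<integral>x. exp (- u x) - 1 \<partial>?D)"
    by (rule poisson_law_exp_fun[OF Q _ u fin]) simp
  also have "(\<integral>x. exp (- u x) - 1 \<partial>?D) = (\<integral>x. (1 + g x) *\<^sub>R (exp (- u x) - 1) \<partial>R)"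
    using g(3) by (intro integral_density) auto
  also have "\<dots> = (\<integral>x. (exp (- u x) - 1) + (exp (- u x) - 1) * g x \<partial>R)"
    by (intro Bochner_Integration.integral_cong) (auto simp: algebra_simps)
  also have "\<dots> = (\<integral>x. exp (- u x) - 1 \<partial>R) + (\<integral>x. (exp (- u x) - 1) * g x \<partial>R)"
    using v g by (intro Bochner_Integration.integral_add integrable_mult_L2) auto
  finally show ?thesis by (simp add: exp_add)
qed

lemma poisson_law_sets:
  assumes "poisson_law \<mu> Q" "sets \<mu> = sets R"
  shows "prob_space Q" "sets Q = sets (counting_space R)" "space Q = counting_measures R"
  using assms counting_space_cong[OF assms(2)] sets_eq_imp_space_eq[of Q "counting_space R"]
  by (auto simp: poisson_law_def space_counting_space)

lemma exp_fun_integrable: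
  assumes "prob_space Q" "sets Q = sets (counting_space R)" "u \<in> test_funs R"
  shows "integrable Q (exp_fun u)"
proof -
  interpret prob_space Q by fact
  show ?thesis
    using exp_fun_measurable[OF assms(3)]
    by (intro integrable_const_bound[where B=1]) (auto simp: measurable_cong_sets[OF assms(2) refl])
qed

subsection \<open>Bounds on the span\<close>

lemma integral_double_sum:
  fixes f :: "'i \<Rightarrow> 'i \<Rightarrow> 'b \<Rightarrow> real"
  assumes "\<And>i j. i \<in> T \<Longrightarrow> j \<in> T \<Longrightarrow> integrable M (f i j)"
  shows "integrable M (\<lambda>x. \<Sum>i\<in>T. \<Sum>j\<in>T. k i j * f i j x)"
    and "(\<integral>x. (\<Sum>i\<in>T. \<Sum>j\<in>T. k i j * f i j x) \<partial>M) = (\<Sum>i\<in>T. \<Sum>j\<in>T. k i j * (\<integral>x. f i j x \<partial>M))"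
proof -
  have i: "integrable M (\<lambda>x. \<Sum>j\<in>T. k i j * f i j x)" if "i \<in> T" for i
    using assms that by (intro Bochner_Integration.integrable_sum integrable_mult_right) auto
  then show "integrable M (\<lambda>x. \<Sum>i\<in>T. \<Sum>j\<in>T. k i j * f i j x)"
    by (rule Bochner_Integration.integrable_sum)
  show "(\<integral>x. (\<Sum>i\<in>T. \<Sum>j\<in>T. k i j * f i j x) \<partial>M) = (\<Sum>i\<in>T. \<Sum>j\<in>T. k i j * (\<integral>x. f i j x \<partial>M))"
    using i assms by (simp add: Bochner_Integration.integral_sum)
qed

text \<open>The square root of the constant in \<open>quad_tilt_le\<close>, because there the norms
  appear squared.\<close>

definition tilt_const :: "'a measure \<Rightarrow> ('a \<Rightarrow> real) \<Rightarrow> nat \<Rightarrow> real" where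
  "tilt_const R g n = sqrt (exp (2 * (\<integral>x. (g x)\<^sup>2 \<partial>R)) * (fact n * 2 ^ n))"

lemma tilt_const_nonneg [simp]: "0 \<le> tilt_const R g n"
  by (simp add: tilt_const_def)

text \<open>The law \<open>Q0\<close> is the reference in whose L2 space everything is measured. In
  the theorem R is \<rho> and g is h_\<theta> - 1, so there is one instance for each \<theta> in I,
  all with the same \<open>Q0\<close>.\<close>

locale poisson_tilt = R: sigma_finite_measure R for R :: "'a measure" +
  fixes Q0 Q :: "'a measure measure" and g :: "'a \<Rightarrow> real"
  assumes Q0: "poisson_law R Q0"
    and Q: "poisson_law (density R (\<lambda>x. ennreal (1 + g x))) Q"
    and g: "g \<in> borel_measurable R" "integrable R (\<lambda>x. (g x)\<^sup>2)" "AE x in R. 0 \<le> 1 + g x"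
begin

sublocale Q0: prob_space Q0
  by (rule poisson_law_sets(1)[OF Q0 refl])

sublocale Q: prob_space Q
  by (rule poisson_law_sets(1)[OF Q]) simp

sublocale prod: product_sigma_finite "\<lambda>_::nat. R" ..

lemma sets_Q0 [measurable_cong]: "sets Q0 = sets (counting_space R)"
  by (rule poisson_law_sets(2)[OF Q0 refl])

lemma sets_Q [measurable_cong]: "sets Q = sets (counting_space R)"
  by (rule poisson_law_sets(2)[OF Q]) simp

lemma space_Q0: "space Q0 = counting_measures R"
  by (rule poisson_law_sets(3)[OF Q0 refl])

lemma space_Q: "space Q = counting_measures R"
  by (rule poisson_law_sets(3)[OF Q]) simp

definition mean_diff :: "nat \<Rightarrow> ('a measure \<Rightarrow> real) \<Rightarrow> (nat \<Rightarrow> 'a) \<Rightarrow> real" where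
  "mean_diff n f x = (\<integral>\<phi>. diff_op R n x f \<phi> \<partial>Q)"

lemma expectation_Q:
  "u \<in> test_funs R \<Longrightarrow> (\<integral>\<phi>. exp_fun u \<phi> \<partial>Q) =
     exp (\<integral>x. exp (- u x) - 1 \<partial>R) * exp (\<integral>x. (exp (- u x) - 1) * g x \<partial>R)"
  by (rule poisson_expectation_exp_fun[OF Q g])

lemma expectation_Q0:
  assumes "u \<in> test_funs R"
  shows "(\<integral>\<phi>. exp_fun u \<phi> \<partial>Q0) = exp (\<integral>x. exp (- u x) - 1 \<partial>R)"
proof -
  have "poisson_law (density R (\<lambda>x. ennreal (1 + 0))) Q0" using Q0 by (simp add: density_1)
  from poisson_expectation_exp_fun[OF this _ _ _ assms] show ?thesis by simp
qed

end

locale tilt_span = poisson_tilt R Q0 Q g for R :: "'a measure" and Q0 Q g +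
  fixes m :: nat and c :: "nat \<Rightarrow> real" and u :: "nat \<Rightarrow> 'a \<Rightarrow> real"
  assumes u: "\<And>i. i < m \<Longrightarrow> u i \<in> test_funs R"
begin

abbreviation v :: "nat \<Rightarrow> 'a \<Rightarrow> real" where "v i x \<equiv> exp (- u i x) - 1"
abbreviation s :: "'a measure \<Rightarrow> real" where "s \<phi> \<equiv> \<Sum>i<m. c i * exp_fun (u i) \<phi>"

text \<open>These are the coefficients of s with respect to the normalised functionals F (u i) / E F
  (u i), the mean being taken under \<open>Q0\<close>. Their Gram matrix in L2 of \<open>Q0\<close>
  is exp V, as for the exponential vectors of Fock space. The number \<open>b i\<close> below is c i
  times the mean of F (u i) under \<open>Q\<close>.\<close>

definition a :: "nat \<Rightarrow> real" where "a i = c i * exp (\<integral>x. v i x \<partial>R)"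
definition b :: "nat \<Rightarrow> real" where "b i = a i * exp (\<integral>x. v i x * g x \<partial>R)"

sublocale gram R "{..<m}" v
  using test_funs_minus_one(1)[OF u] test_funs_minus_one(4)[OF u] by unfold_locales auto

text \<open>With v = exp (- u) - 1 one has exp (- (u + u')) - 1 = v + v' + v v'. The first two terms
  are absorbed in the coefficients \<open>a i\<close>, and the last one produces exp V.\<close>

lemma integral_s_sq: "(\<integral>\<phi>. (s \<phi>)\<^sup>2 \<partial>Q0) = (\<Sum>i<m. \<Sum>j<m. a i * a j * exp (V i j))"
proof -
  have uu: "(\<lambda>x. u i x + u j x) \<in> test_funs R" if "i < m" "j < m" for i j
    using that by (intro test_funs_add u)
  have "(\<integral>\<phi>. (s \<phi>)\<^sup>2 \<partial>Q0) = (\<integral>\<phi>. (\<Sum>i<m. \<Sum>j<m. c i * c j * exp_fun (\<lambda>x. u i x + u j x) \<phi>) \<partial>Q0)"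
    by (intro Bochner_Integration.integral_cong refl)
       (simp add: power2_eq_square sum_product space_Q0 exp_fun_add[OF u u] mult_ac)
  also have "\<dots> = (\<Sum>i<m. \<Sum>j<m. c i * c j * (\<integral>\<phi>. exp_fun (\<lambda>x. u i x + u j x) \<phi> \<partial>Q0))"
    by (rule integral_double_sum(2)) (simp add: exp_fun_integrable[OF Q0.prob_space_axioms sets_Q0 uu])
  also have "\<dots> = (\<Sum>i<m. \<Sum>j<m. a i * a j * exp (V i j))"
  proof (intro sum.cong refl)
    fix i j assume "i \<in> {..<m}" "j \<in> {..<m}"
    then have ij: "i < m" "j < m" by auto
    have "(\<integral>x. exp (- (u i x + u j x)) - 1 \<partial>R) = (\<integral>x. v i x + v j x + v i x * v j x \<partial>R)"
      by (intro Bochner_Integration.integral_cong) (auto simp: algebra_simps exp_add[symmetric])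
    also have "\<dots> = (\<integral>x. v i x \<partial>R) + (\<integral>x. v j x \<partial>R) + V i j"
    proof -
      note i = test_funs_minus_one(3)[OF u[OF ij(1)]] and j = test_funs_minus_one(3)[OF u[OF ij(2)]]
      have "integrable R (\<lambda>x. v i x * v j x)" using ij by (intro int_V) auto
      from Bochner_Integration.integral_add[OF Bochner_Integration.integrable_add[OF i j] this]
      show ?thesis unfolding V_def Bochner_Integration.integral_add[OF i j] .
    qed
    finally show "c i * c j * (\<integral>\<phi>. exp_fun (\<lambda>x. u i x + u j x) \<phi> \<partial>Q0) = a i * a j * exp (V i j)"
      by (simp add: expectation_Q0[OF uu[OF ij]] a_def exp_add)
  qed
  finally show ?thesis .
qed

lemma mean_diff_s:
  assumes x: "x \<in> space (PiM {1..n} (\<lambda>_. R))"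
  shows "mean_diff n s x = (\<Sum>i<m. b i * (\<Prod>j=1..n. v i (x j)))"
proof -
  have xj: "x j \<in> space R" if "j \<in> {1..n}" for j
    using x that by (auto simp: space_PiM)
  have "mean_diff n s x = (\<integral>\<phi>. (\<Sum>i<m. c i * (exp_fun (u i) \<phi> * (\<Prod>j=1..n. v i (x j)))) \<partial>Q)"
    unfolding mean_diff_def diff_op_sum
  proof (intro Bochner_Integration.integral_cong sum.cong refl)
    fix \<phi> i assume "\<phi> \<in> space Q" "i \<in> {..<m}"
    then have "diff_op R n x (exp_fun (u i)) \<phi> = exp_fun (u i) \<phi> * (\<Prod>j=1..n. v i (x j))"
      by (intro diff_op_exp_fun u xj) (auto simp: space_Q)
    then show "c i * diff_op R n x (exp_fun (u i)) \<phi> = c i * (exp_fun (u i) \<phi> * (\<Prod>j=1..n. v i (x j)))"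
      by simp
  qed
  also have "\<dots> = (\<Sum>i<m. c i * ((\<integral>\<phi>. exp_fun (u i) \<phi> \<partial>Q) * (\<Prod>j=1..n. v i (x j))))"
    using exp_fun_integrable[OF Q.prob_space_axioms sets_Q u]
    by (simp add: Bochner_Integration.integral_sum)
  also have "\<dots> = (\<Sum>i<m. b i * (\<Prod>j=1..n. v i (x j)))"
    by (simp add: expectation_Q[OF u] a_def b_def mult_ac)
  finally show ?thesis .
qed

lemma prod_v_measurable [measurable]:
  "i < m \<Longrightarrow> (\<lambda>x. \<Prod>j=1..n. v i (x j)) \<in> borel_measurable (PiM {1..n} (\<lambda>_. R))"
  using meas[of i]
  by (intro borel_measurable_prod measurable_compose[OF measurable_component_singleton]) auto

lemma mean_diff_s_measurable: "mean_diff n s \<in> borel_measurable (PiM {1..n} (\<lambda>_. R))"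
proof -
  have "(\<lambda>x. \<Sum>i<m. b i * (\<Prod>j=1..n. v i (x j))) \<in> borel_measurable (PiM {1..n} (\<lambda>_. R))"
    by measurable
  then show ?thesis
    by (rule iffD1[OF measurable_cong, rotated]) (rule mean_diff_s[symmetric])
qed

text \<open>Fubini: the inner product of two tensor powers is the power of the inner
  product.\<close>

lemma
  assumes ij: "i < m" "j < m"
  shows integrable_prod_vv: "integrable (PiM {1..n} (\<lambda>_. R)) (\<lambda>x. (\<Prod>k=1..n. v i (x k)) * (\<Prod>k=1..n. v j (x k)))"
    and integral_prod_vv: "(\<integral>x. (\<Prod>k=1..n. v i (x k)) * (\<Prod>k=1..n. v j (x k)) \<partial>PiM {1..n} (\<lambda>_. R)) = V i j ^ n"
  using int_V[of i j] ij prod.product_integrable_prod[of "{1..n}" "\<lambda>_ x. v i x * v j x"]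
    prod.product_integral_prod[of "{1..n}" "\<lambda>_ x. v i x * v j x"]
  by (simp_all add: prod.distrib[symmetric] V_def)

lemma mean_diff_s_sq:
  shows "integrable (PiM {1..n} (\<lambda>_. R)) (\<lambda>x. (mean_diff n s x)\<^sup>2)"
    and "(\<integral>x. (mean_diff n s x)\<^sup>2 \<partial>PiM {1..n} (\<lambda>_. R)) = (\<Sum>i<m. \<Sum>j<m. b i * b j * V i j ^ n)"
proof -
  have eq: "(mean_diff n s x)\<^sup>2 =
      (\<Sum>i<m. \<Sum>j<m. b i * b j * ((\<Prod>k=1..n. v i (x k)) * (\<Prod>k=1..n. v j (x k))))"
    if "x \<in> space (PiM {1..n} (\<lambda>_. R))" for x
    by (simp add: mean_diff_s[OF that] power2_eq_square sum_product mult_ac)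
  have int: "integrable (PiM {1..n} (\<lambda>_. R))
      (\<lambda>x. \<Sum>i<m. \<Sum>j<m. b i * b j * ((\<Prod>k=1..n. v i (x k)) * (\<Prod>k=1..n. v j (x k))))"
    by (rule integral_double_sum(1)) (simp add: integrable_prod_vv del: One_nat_def)
  then show "integrable (PiM {1..n} (\<lambda>_. R)) (\<lambda>x. (mean_diff n s x)\<^sup>2)"
    by (rule iffD1[OF Bochner_Integration.integrable_cong, rotated -1]) (simp_all add: eq)
  have "(\<integral>x. (mean_diff n s x)\<^sup>2 \<partial>PiM {1..n} (\<lambda>_. R)) =
      (\<integral>x. (\<Sum>i<m. \<Sum>j<m. b i * b j * ((\<Prod>k=1..n. v i (x k)) * (\<Prod>k=1..n. v j (x k)))) \<partial>PiM {1..n} (\<lambda>_. R))"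
    by (intro Bochner_Integration.integral_cong eq) simp
  also have "\<dots> = (\<Sum>i<m. \<Sum>j<m. b i * b j * V i j ^ n)"
    by (subst integral_double_sum(2)) (simp_all add: integrable_prod_vv integral_prod_vv del: One_nat_def)
  finally show "(\<integral>x. (mean_diff n s x)\<^sup>2 \<partial>PiM {1..n} (\<lambda>_. R)) = (\<Sum>i<m. \<Sum>j<m. b i * b j * V i j ^ n)" .
qed

lemma mean_diff_s_norm: "L2_norm (PiM {1..n} (\<lambda>_. R)) (mean_diff n s) \<le> tilt_const R g n * L2_norm Q0 s"
proof -
  have "(\<Sum>i<m. \<Sum>j<m. b i * b j * V i j ^ n) \<le>
      exp (2 * (\<integral>x. (g x)\<^sup>2 \<partial>R)) * (fact n * 2 ^ n * (\<Sum>i<m. \<Sum>j<m. a i * a j * exp (V i j)))"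
    unfolding b_def by (rule quad_tilt_le[OF g(1,2)])
  then show ?thesis
    unfolding L2_norm_def tilt_const_def real_sqrt_mult[symmetric] mean_diff_s_sq integral_s_sq
    by (simp add: mult_ac)
qed

lemma integral_mean_diff_s:
  assumes h: "h \<in> borel_measurable R" "integrable R (\<lambda>x. (h x)\<^sup>2)"
  shows "(\<integral>x. mean_diff n s x * (\<Prod>j=1..n. h (x j)) \<partial>PiM {1..n} (\<lambda>_. R)) =
    (\<Sum>i<m. b i * (\<integral>x. v i x * h x \<partial>R) ^ n)"
proof -
  have vh: "integrable R (\<lambda>x. v i x * h x)" if "i < m" for i
    using that by (intro integrable_mult_L2 meas sq h) auto
  have i: "integrable (PiM {1..n} (\<lambda>_. R)) (\<lambda>x. \<Prod>j=1..n. v i (x j) * h (x j))"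
    "(\<integral>x. (\<Prod>j=1..n. v i (x j) * h (x j)) \<partial>PiM {1..n} (\<lambda>_. R)) = (\<integral>x. v i x * h x \<partial>R) ^ n" if "i < m" for i
    using vh[OF that] prod.product_integrable_prod[of "{1..n}" "\<lambda>_ x. v i x * h x"]
      prod.product_integral_prod[of "{1..n}" "\<lambda>_ x. v i x * h x"] by simp_all
  have "(\<integral>x. mean_diff n s x * (\<Prod>j=1..n. h (x j)) \<partial>PiM {1..n} (\<lambda>_. R)) =
      (\<integral>x. (\<Sum>i<m. b i * (\<Prod>j=1..n. v i (x j) * h (x j))) \<partial>PiM {1..n} (\<lambda>_. R))"
    by (intro Bochner_Integration.integral_cong refl)
       (simp add: mean_diff_s sum_distrib_right prod.distrib mult.assoc)
  also have "\<dots> = (\<Sum>i<m. b i * (\<integral>x. v i x * h x \<partial>R) ^ n)"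
    using i by (simp add: Bochner_Integration.integral_sum)
  finally show ?thesis .
qed

end

context poisson_tilt
begin

lemma L2_prod:
  assumes h: "h \<in> borel_measurable R" "integrable R (\<lambda>x. (h x)\<^sup>2)"
  shows "(\<lambda>x. \<Prod>j=1..n. h (x j)) \<in> borel_measurable (PiM {1..n} (\<lambda>_. R))"
    and "integrable (PiM {1..n} (\<lambda>_. R)) (\<lambda>x. (\<Prod>j=1..n. h (x j))\<^sup>2)"
    and "L2_norm (PiM {1..n} (\<lambda>_. R)) (\<lambda>x. \<Prod>j=1..n. h (x j)) = L2_norm R h ^ n"
proof -
  show "(\<lambda>x. \<Prod>j=1..n. h (x j)) \<in> borel_measurable (PiM {1..n} (\<lambda>_. R))"
    using h(1) by (intro borel_measurable_prod measurable_compose[OF measurable_component_singleton]) auto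
  show "integrable (PiM {1..n} (\<lambda>_. R)) (\<lambda>x. (\<Prod>j=1..n. h (x j))\<^sup>2)"
    unfolding prod_power_distrib
    by (rule prod.product_integrable_prod) (use h in auto)
  have "(\<integral>x. (\<Prod>j=1..n. (h (x j))\<^sup>2) \<partial>PiM {1..n} (\<lambda>_. R)) = (\<integral>x. (h x)\<^sup>2 \<partial>R) ^ n"
    using prod.product_integral_prod[of "{1..n}" "\<lambda>_ x. (h x)\<^sup>2"] h(2) by simp
  then show "L2_norm (PiM {1..n} (\<lambda>_. R)) (\<lambda>x. \<Prod>j=1..n. h (x j)) = L2_norm R h ^ n"
    by (simp add: L2_norm_def prod_power_distrib real_sqrt_power)
qed

lemma exp_span_tilt:
  assumes "s \<in> exp_span R"
  obtains m c u where "tilt_span R Q0 Q g m u" "s = (\<lambda>\<phi>. \<Sum>i<m. c i * exp_fun (u i) \<phi>)"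
  using exp_span_expansion[OF assms] poisson_tilt_axioms
  by (metis tilt_span.intro tilt_span_axioms.intro)

lemma mean_diff_span:
  assumes "s \<in> exp_span R"
  shows "mean_diff n s \<in> borel_measurable (PiM {1..n} (\<lambda>_. R))"
    and "integrable (PiM {1..n} (\<lambda>_. R)) (\<lambda>x. (mean_diff n s x)\<^sup>2)"
    and "L2_norm (PiM {1..n} (\<lambda>_. R)) (mean_diff n s) \<le> tilt_const R g n * L2_norm Q0 s"
proof -
  obtain m c u where *: "tilt_span R Q0 Q g m u" "s = (\<lambda>\<phi>. \<Sum>i<m. c i * exp_fun (u i) \<phi>)"
    using exp_span_tilt[OF assms] .
  interpret tilt_span R Q0 Q g m c u by fact
  show "mean_diff n s \<in> borel_measurable (PiM {1..n} (\<lambda>_. R))"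
    "integrable (PiM {1..n} (\<lambda>_. R)) (\<lambda>x. (mean_diff n s x)\<^sup>2)"
    "L2_norm (PiM {1..n} (\<lambda>_. R)) (mean_diff n s) \<le> tilt_const R g n * L2_norm Q0 s"
    unfolding * by (rule mean_diff_s_measurable mean_diff_s_sq mean_diff_s_norm)+
qed

end

text \<open>The sum is the inner product of E D^n s with the n-th tensor power of h, so
  Cauchy-Schwarz bounds it by the norm of s, independently of the chosen representation. Besides the
  direction h of the theorem, it is used for weights w and for n = 0.\<close>

lemma (in tilt_span) moment_bound:
  assumes h: "h \<in> borel_measurable R" "integrable R (\<lambda>x. (h x)\<^sup>2)"
  shows "\<bar>\<Sum>i<m. b i * (\<integral>x. v i x * h x \<partial>R) ^ n\<bar> \<le> tilt_const R g n * L2_norm R h ^ n * L2_norm Q0 s"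
proof -
  have "\<bar>\<integral>x. mean_diff n s x * (\<Prod>j=1..n. h (x j)) \<partial>PiM {1..n} (\<lambda>_. R)\<bar> \<le>
      L2_norm (PiM {1..n} (\<lambda>_. R)) (mean_diff n s) * L2_norm (PiM {1..n} (\<lambda>_. R)) (\<lambda>x. \<Prod>j=1..n. h (x j))"
    by (intro Cauchy_Schwarz_integral mean_diff_s_measurable mean_diff_s_sq L2_prod h)
  also have "\<dots> \<le> (tilt_const R g n * L2_norm Q0 s) * L2_norm R h ^ n"
    unfolding L2_prod(3)[OF h] by (intro mult_right_mono mean_diff_s_norm) simp
  finally show ?thesis
    unfolding integral_mean_diff_s[OF h] by (simp add: mult_ac)
qed

section \<open>Laws of Poisson configurations with added random points\<close>

context poisson_tilt
begin

text \<open>The points are distributed according to w R, a finite measure, because R is only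
  sigma-finite. All n coordinates are drawn but only those in J are added, so that every summand of
  D^n lives on the same product space.\<close>

definition shifted :: "('a \<Rightarrow> real) \<Rightarrow> nat \<Rightarrow> nat set \<Rightarrow> 'a measure measure" where
  "shifted w n J = distr (PiM {1..n} (\<lambda>_. density R w) \<Otimes>\<^sub>M Q) (counting_space R)
     (\<lambda>(x, \<phi>). add_points R \<phi> x J)"

context
  fixes w :: "'a \<Rightarrow> real"
  assumes w: "w \<in> borel_measurable R" "\<And>x. 0 \<le> w x" "integrable R w" "integrable R (\<lambda>x. (w x)\<^sup>2)"
begin

lemma finite_W: "finite_measure (density R (\<lambda>x. ennreal (w x)))"
proof
  have "emeasure (density R (\<lambda>x. ennreal (w x))) (space R) = (\<integral>\<^sup>+x. ennreal (w x) \<partial>R)"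
    using w(1) by (subst emeasure_density) (auto intro!: nn_integral_cong)
  also have "\<dots> < \<infinity>" using w by (simp add: nn_integral_eq_integral)
  finally show "emeasure (density R (\<lambda>x. ennreal (w x))) (space (density R (\<lambda>x. ennreal (w x)))) \<noteq> \<infinity>"
    by simp
qed

lemma prod_W: "product_sigma_finite (\<lambda>_::nat. density R (\<lambda>x. ennreal (w x)))"
proof -
  interpret finite_measure "density R (\<lambda>x. ennreal (w x))" by (rule finite_W)
  show ?thesis ..
qed

lemma finite_PiM_W: "finite_measure (PiM {1..n::nat} (\<lambda>_. density R (\<lambda>x. ennreal (w x))))"
proof
  interpret W: finite_measure "density R (\<lambda>x. ennreal (w x))" by (rule finite_W)
  interpret pW: product_sigma_finite "\<lambda>_::nat. density R (\<lambda>x. ennreal (w x))" by (rule prod_W)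
  show "emeasure (PiM {1..n} (\<lambda>_. density R (\<lambda>x. ennreal (w x))))
      (space (PiM {1..n} (\<lambda>_. density R (\<lambda>x. ennreal (w x))))) \<noteq> \<infinity>"
    unfolding space_PiM by (subst pW.emeasure_PiM) (auto simp: power_eq_top_ennreal)
qed

lemma sets_PiM_W: "sets (PiM {1..n::nat} (\<lambda>_. density R (\<lambda>x. ennreal (w x)))) = sets (PiM {1..n} (\<lambda>_. R))"
  by (rule sets_PiM_cong) auto

lemma finite_pair_W: "finite_measure (PiM {1..n::nat} (\<lambda>_. density R (\<lambda>x. ennreal (w x))) \<Otimes>\<^sub>M Q)"
  by (intro finite_measure_pair_measure finite_PiM_W Q.finite_measure_axioms)

lemma add_points_measurable_W:
  assumes "J \<subseteq> {1..n}"
  shows "(\<lambda>(x, \<phi>). add_points R \<phi> x J) \<in>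
    measurable (PiM {1..n} (\<lambda>_. density R (\<lambda>x. ennreal (w x))) \<Otimes>\<^sub>M Q) (counting_space R)"
proof -
  have "sets (PiM {1..n} (\<lambda>_. density R (\<lambda>x. ennreal (w x))) \<Otimes>\<^sub>M Q) =
      sets (PiM {1..n} (\<lambda>_. R) \<Otimes>\<^sub>M counting_space R)"
    by (rule sets_pair_measure_cong[OF sets_PiM_W sets_Q])
  from measurable_cong_sets[OF this refl] show ?thesis
    using add_points_measurable[OF assms finite_subset[OF assms finite_atLeastAtMost]] by blast
qed

lemma finite_shifted: "J \<subseteq> {1..n} \<Longrightarrow> finite_measure (shifted w n J)"
  unfolding shifted_def
  by (intro finite_measure.finite_measure_distr finite_pair_W add_points_measurable_W)

text \<open>An added point multiplies the exponential by exp (- u), whose integral against w R is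
  <v, w> plus the mass of w R; a coordinate outside J contributes that mass alone.\<close>

lemma integral_shifted_exp_fun:
  assumes J: "J \<subseteq> {1..n}" and u: "u \<in> test_funs R"
  shows "(\<integral>\<phi>. exp_fun u \<phi> \<partial>shifted w n J) = (\<integral>\<phi>. exp_fun u \<phi> \<partial>Q) *
    (((\<integral>x. (exp (- u x) - 1) * w x \<partial>R) + (\<integral>x. w x \<partial>R)) ^ card J * (\<integral>x. w x \<partial>R) ^ (n - card J))"
proof -
  let ?W = "density R (\<lambda>x. ennreal (w x))"
  let ?\<alpha> = "\<integral>x. w x \<partial>R" and ?q = "\<integral>x. (exp (- u x) - 1) * w x \<partial>R"
  let ?F = "\<lambda>j y. if j \<in> J then exp (- u y) else 1"
  interpret W: finite_measure ?W by (rule finite_W)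
  interpret pW: product_sigma_finite "\<lambda>_::nat. ?W" by (rule prod_W)
  interpret PW: finite_measure "PiM {1..n} (\<lambda>_. ?W)" by (rule finite_PiM_W)
  interpret pair_sigma_finite "PiM {1..n} (\<lambda>_. ?W)" Q ..
  have fJ: "finite J" using J by (rule finite_subset) simp
  note [measurable] = test_funsD(2)[OF u] w(1)
  have e1: "exp (- u x) \<le> 1" for x using test_funsD(3)[OF u] by simp
  have Fint: "integrable ?W (?F j)" for j
    by (rule W.integrable_const_bound[where B=1]) (use e1 in auto)
  have wint: "integrable R (\<lambda>x. (exp (- u x) - 1) * w x)"
    using test_funs_minus_one[OF u] w by (intro integrable_mult_L2) auto
  have W1: "(\<integral>x. exp (- u x) \<partial>?W) = ?q + ?\<alpha>"
  proof -
    have "(\<integral>x. exp (- u x) \<partial>?W) = (\<integral>x. w x *\<^sub>R exp (- u x) \<partial>R)"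
      using w by (intro integral_density) auto
    also have "\<dots> = (\<integral>x. (exp (- u x) - 1) * w x + w x \<partial>R)"
      by (intro Bochner_Integration.integral_cong) (auto simp: algebra_simps)
    finally show ?thesis using wint w by simp
  qed
  have W2: "(\<integral>x. 1 \<partial>?W) = ?\<alpha>"
    using w by (subst integral_density) auto
  have prodF: "(\<integral>x. (\<Prod>j\<in>J. exp (- u (x j))) \<partial>PiM {1..n} (\<lambda>_. ?W)) = (?q + ?\<alpha>) ^ card J * ?\<alpha> ^ (n - card J)"
  proof -
    have "(\<integral>x. (\<Prod>j\<in>J. exp (- u (x j))) \<partial>PiM {1..n} (\<lambda>_. ?W)) = (\<integral>x. (\<Prod>j=1..n. ?F j (x j)) \<partial>PiM {1..n} (\<lambda>_. ?W))"
      using J by (intro Bochner_Integration.integral_cong refl) (simp add: prod.If_cases Int_absorb1)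
    also have "\<dots> = (\<Prod>j=1..n. \<integral>x. ?F j x \<partial>?W)"
      by (rule pW.product_integral_prod) (use Fint in auto)
    also have "\<dots> = (\<Prod>j=1..n. if j \<in> J then ?q + ?\<alpha> else ?\<alpha>)"
      by (intro prod.cong) (auto simp: W1 W2[simplified])
    also have "\<dots> = (?q + ?\<alpha>) ^ card J * ?\<alpha> ^ (n - card J)"
    proof -
      have "{1..n} \<inter> - {j. j \<in> J} = {1..n} - J" by auto
      then show ?thesis using J fJ by (simp add: prod.If_cases Int_absorb1 card_Diff_subset)
    qed
    finally show ?thesis .
  qed
  have m: "(\<lambda>(x, \<phi>). exp_fun u (add_points R \<phi> x J)) \<in> borel_measurable (PiM {1..n} (\<lambda>_. ?W) \<Otimes>\<^sub>M Q)"
    using measurable_compose[OF add_points_measurable_W[OF J] exp_fun_measurable[OF u]]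
    by (simp add: case_prod_beta')
  have int: "integrable (PiM {1..n} (\<lambda>_. ?W) \<Otimes>\<^sub>M Q) (\<lambda>(x, \<phi>). exp_fun u (add_points R \<phi> x J))"
    by (rule finite_measure.integrable_const_bound[OF finite_pair_W, where B=1])
       (use m in \<open>auto simp: case_prod_beta'\<close>)
  have "(\<integral>\<phi>. exp_fun u \<phi> \<partial>shifted w n J) =
      (\<integral>(x, \<phi>). exp_fun u (add_points R \<phi> x J) \<partial>(PiM {1..n} (\<lambda>_. ?W) \<Otimes>\<^sub>M Q))"
    unfolding shifted_def
    by (subst integral_distr[OF add_points_measurable_W[OF J] exp_fun_measurable[OF u]])
       (simp add: case_prod_beta')
  also have "\<dots> = (\<integral>x. \<integral>\<phi>. exp_fun u (add_points R \<phi> x J) \<partial>Q \<partial>PiM {1..n} (\<lambda>_. ?W))"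
    using integral_fst'[OF int] by simp
  also have "\<dots> = (\<integral>x. (\<integral>\<phi>. exp_fun u \<phi> \<partial>Q) * (\<Prod>j\<in>J. exp (- u (x j))) \<partial>PiM {1..n} (\<lambda>_. ?W))"
  proof (rule Bochner_Integration.integral_cong[OF refl])
    fix x assume "x \<in> space (PiM {1..n} (\<lambda>_. ?W))"
    then have "x j \<in> space R" if "j \<in> J" for j
      using J that by (auto simp: space_PiM)
    then have "(\<integral>\<phi>. exp_fun u (add_points R \<phi> x J) \<partial>Q) = (\<integral>\<phi>. exp_fun u \<phi> * (\<Prod>j\<in>J. exp (- u (x j))) \<partial>Q)"
      by (intro Bochner_Integration.integral_cong refl exp_fun_add_points[OF u _ fJ]) (auto simp: space_Q)
    then show "(\<integral>\<phi>. exp_fun u (add_points R \<phi> x J) \<partial>Q) = (\<integral>\<phi>. exp_fun u \<phi> \<partial>Q) * (\<Prod>j\<in>J. exp (- u (x j)))"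
      by simp
  qed
  finally show ?thesis by (simp add: prodF del: One_nat_def)
qed

text \<open>The binomial theorem turns (<v i, w> + \<alpha>)^k into powers of <v i, w>. After
  exchanging the sums these are the moments of \<open>moment_bound\<close> with h = w, and C
  collects the binomial weights. This yields absolute continuity of the shifted law, the role
  usually played by the Mecke formula.\<close>

lemma shifted_bound:
  assumes J: "J \<subseteq> {1..n}"
  obtains C where "0 \<le> C" "\<And>s. s \<in> exp_span R \<Longrightarrow> \<bar>\<integral>\<phi>. s \<phi> \<partial>shifted w n J\<bar> \<le> C * L2_norm Q0 s"
proof -
  let ?\<alpha> = "\<integral>x. w x \<partial>R" and ?k = "card J"
  have \<alpha>: "0 \<le> ?\<alpha>" using w by simp
  define C where "C = ?\<alpha> ^ (n - ?k) * (\<Sum>l\<le>?k. real (?k choose l) * ?\<alpha> ^ (?k - l) * (tilt_const R g l * L2_norm R w ^ l))"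
  have "0 \<le> C" unfolding C_def using \<alpha> by (intro mult_nonneg_nonneg sum_nonneg) auto
  moreover have "\<bar>\<integral>\<phi>. s \<phi> \<partial>shifted w n J\<bar> \<le> C * L2_norm Q0 s" if s: "s \<in> exp_span R" for s
  proof -
    obtain m c u where *: "tilt_span R Q0 Q g m u" "s = (\<lambda>\<phi>. \<Sum>i<m. c i * exp_fun (u i) \<phi>)"
      using exp_span_tilt[OF s] .
    interpret S: tilt_span R Q0 Q g m c u by fact
    let ?q = "\<lambda>i. \<integral>x. S.v i x * w x \<partial>R"
    have int: "integrable (shifted w n J) (exp_fun (u i))" if "i < m" for i
      using exp_fun_measurable[OF S.u[OF that]]
      by (intro finite_measure.integrable_const_bound[OF finite_shifted[OF J], where B=1])
         (auto simp: shifted_def)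
    have "(\<integral>\<phi>. s \<phi> \<partial>shifted w n J) = (\<Sum>i<m. c i * (\<integral>\<phi>. exp_fun (u i) \<phi> \<partial>shifted w n J))"
      unfolding * using int by (simp add: Bochner_Integration.integral_sum)
    also have "\<dots> = (\<Sum>i<m. S.b i * ((?q i + ?\<alpha>) ^ ?k * ?\<alpha> ^ (n - ?k)))"
      by (intro sum.cong refl)
         (simp add: integral_shifted_exp_fun[OF J S.u] expectation_Q[OF S.u] S.a_def S.b_def mult_ac)
    also have "\<dots> = ?\<alpha> ^ (n - ?k) * (\<Sum>l\<le>?k. real (?k choose l) * ?\<alpha> ^ (?k - l) * (\<Sum>i<m. S.b i * ?q i ^ l))"
      by (simp add: binomial_ring sum_distrib_left sum_distrib_right sum.swap[of _ "{..?k}"] mult_ac)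
    finally have "\<bar>\<integral>\<phi>. s \<phi> \<partial>shifted w n J\<bar> =
        ?\<alpha> ^ (n - ?k) * \<bar>\<Sum>l\<le>?k. real (?k choose l) * ?\<alpha> ^ (?k - l) * (\<Sum>i<m. S.b i * ?q i ^ l)\<bar>"
      using \<alpha> by (simp add: abs_mult)
    also have "\<dots> \<le> ?\<alpha> ^ (n - ?k) * (\<Sum>l\<le>?k. \<bar>real (?k choose l) * ?\<alpha> ^ (?k - l) * (\<Sum>i<m. S.b i * ?q i ^ l)\<bar>)"
      using \<alpha> by (intro mult_left_mono sum_abs) auto
    also have "\<dots> \<le> ?\<alpha> ^ (n - ?k) * (\<Sum>l\<le>?k. real (?k choose l) * ?\<alpha> ^ (?k - l) *
        (tilt_const R g l * L2_norm R w ^ l * L2_norm Q0 s))"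
    proof (intro mult_left_mono sum_mono)
      fix l
      have "\<bar>\<Sum>i<m. S.b i * ?q i ^ l\<bar> \<le> tilt_const R g l * L2_norm R w ^ l * L2_norm Q0 s"
        using S.moment_bound[OF w(1,4), of l] unfolding * .
      then show "\<bar>real (?k choose l) * ?\<alpha> ^ (?k - l) * (\<Sum>i<m. S.b i * ?q i ^ l)\<bar> \<le>
          real (?k choose l) * ?\<alpha> ^ (?k - l) * (tilt_const R g l * L2_norm R w ^ l * L2_norm Q0 s)"
        using \<alpha> by (simp add: abs_mult mult_left_mono)
    qed (use \<alpha> in auto)
    also have "\<dots> = C * L2_norm Q0 s"
      by (simp add: C_def sum_distrib_left sum_distrib_right mult_ac)
    finally show ?thesis .
  qed
  ultimately show ?thesis using that by blast
qed

end

end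

subsection \<open>Extension to square integrable functionals\<close>

lemma nn_integral_limit_le:
  assumes m: "\<And>k. u k \<in> borel_measurable M"
    and lim: "AE x in M. (\<lambda>k. u k x) \<longlonglongrightarrow> f x"
    and le: "\<And>k. (\<integral>\<^sup>+x. u k x \<partial>M) \<le> B"
  shows "(\<integral>\<^sup>+x. f x \<partial>M) \<le> (B :: ennreal)"
proof -
  have "(\<integral>\<^sup>+x. f x \<partial>M) = (\<integral>\<^sup>+x. liminf (\<lambda>k. u k x) \<partial>M)"
    by (rule nn_integral_cong_AE) (use lim in \<open>eventually_elim, auto dest: lim_imp_Liminf[rotated]\<close>)
  also have "\<dots> \<le> liminf (\<lambda>k. \<integral>\<^sup>+x. u k x \<partial>M)"
    by (rule nn_integral_liminf[OF m])
  also have "\<dots> \<le> B" by (rule Liminf_le) (use le in auto)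
  finally show ?thesis .
qed

text \<open>Fatou's lemma; the uniform bound B also yields integrability of the limit.\<close>

lemma integrable_limit_le:
  fixes f :: "'b \<Rightarrow> real"
  assumes m: "\<And>k. integrable M (u k)" "\<And>k x. 0 \<le> u k x" "f \<in> borel_measurable M" "\<And>x. 0 \<le> f x"
    and lim: "AE x in M. (\<lambda>k. u k x) \<longlonglongrightarrow> f x"
    and le: "\<And>k. (\<integral>x. u k x \<partial>M) \<le> B"
  shows "integrable M f" "(\<integral>x. f x \<partial>M) \<le> B"
proof -
  have B: "0 \<le> B" using le[of 0] m(2) by (meson Bochner_Integration.integral_nonneg order_trans)
  have "(\<integral>\<^sup>+x. ennreal (f x) \<partial>M) \<le> ennreal B"
  proof (rule nn_integral_limit_le[where u="\<lambda>k x. ennreal (u k x)"])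
    show "AE x in M. (\<lambda>k. ennreal (u k x)) \<longlonglongrightarrow> ennreal (f x)"
      using lim by eventually_elim (rule tendsto_ennrealI)
    show "(\<integral>\<^sup>+x. ennreal (u k x) \<partial>M) \<le> ennreal B" for k
      using m le[of k] by (simp add: nn_integral_eq_integral ennreal_leI)
  qed (use m in auto)
  note this2 = this
  then have "(\<integral>\<^sup>+x. ennreal (f x) \<partial>M) < \<infinity>" using le_less_trans by fastforce
  then show i: "integrable M f" using m by (intro integrableI_nonneg) auto
  show "(\<integral>x. f x \<partial>M) \<le> B"
    using this2 B m by (simp add: nn_integral_eq_integral[OF i])
qed

text \<open>The result of the approximation argument in terms of norms and outside its locale, so
  that the family can be chosen at each use: \<open>Q0\<close> alone, or \<open>Q0\<close> together
  with another finite measure.\<close>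

lemma exp_span_dense:
  assumes "sigma_finite_measure R" "finite \<M>"
    and "\<And>M. M \<in> \<M> \<Longrightarrow> finite_measure M" "\<And>M. M \<in> \<M> \<Longrightarrow> sets M = sets (counting_space R)"
    and "f \<in> borel_measurable (counting_space R)" "\<And>M. M \<in> \<M> \<Longrightarrow> integrable M (\<lambda>\<phi>. (f \<phi>)\<^sup>2)"
    and "0 < e"
  shows "\<exists>s\<in>exp_span R. \<forall>M\<in>\<M>. L2_norm M (\<lambda>\<phi>. f \<phi> - s \<phi>) < e"
proof -
  interpret counting_measure_family R \<M>
    using assms by (intro counting_measure_family.intro counting_measure_family_axioms.intro) auto
  have "approx f" by (rule approx_L2) (use assms in auto)
  then obtain s where s: "s \<in> exp_span R" "\<forall>M\<in>\<M>. (\<integral>\<phi>. (f \<phi> - s \<phi>)\<^sup>2 \<partial>M) < e\<^sup>2"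
    using assms(7) unfolding approx_def by (meson zero_less_power)
  then have "L2_norm M (\<lambda>\<phi>. f \<phi> - s \<phi>) < e" if "M \<in> \<M>" for M
    using that real_sqrt_less_mono[of "\<integral>\<phi>. (f \<phi> - s \<phi>)\<^sup>2 \<partial>M" "e\<^sup>2"] assms(7)
    by (simp add: L2_norm_def)
  then show ?thesis using s(1) by blast
qed

context poisson_tilt
begin

lemma exp_span_Q0:
  assumes "s \<in> exp_span R"
  shows "s \<in> borel_measurable (counting_space R)" "integrable Q0 (\<lambda>\<phi>. (s \<phi>)\<^sup>2)"
proof -
  interpret counting_measure_family R "{Q0}"
    by (intro counting_measure_family.intro counting_measure_family_axioms.intro R.sigma_finite_measure_axioms)
       (simp_all only: finite.intros singleton_iff Q0.finite_measure_axioms sets_Q0)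
  show "s \<in> borel_measurable (counting_space R)" "integrable Q0 (\<lambda>\<phi>. (s \<phi>)\<^sup>2)"
    using exp_span_measurable[OF assms] exp_span_integrable_sq[OF _ assms] by auto
qed

text \<open>A bound on the span passes to \<open>L\<^sup>2\<close> because bounded functions can be approximated in
  \<open>L\<^sup>2(Q0)\<close> and in \<open>L\<^sup>2(M)\<close> by the same elements of the span. In particular \<open>M\<close> is absolutely
  continuous with respect to \<open>Q0\<close>; no density has to be exhibited.\<close>

lemma L2_bound_extension_bounded:
  assumes M: "finite_measure M" "sets M = sets (counting_space R)"
    and C: "0 \<le> C" "\<And>s. s \<in> exp_span R \<Longrightarrow> \<bar>\<integral>\<phi>. s \<phi> \<partial>M\<bar> \<le> C * L2_norm Q0 s"
    and f: "f \<in> borel_measurable (counting_space R)" "\<And>\<phi>. \<bar>f \<phi>\<bar> \<le> b"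
  shows "integrable M f" "(\<integral>\<phi>. f \<phi> \<partial>M) \<le> C * L2_norm Q0 f"
proof -
  interpret M: finite_measure M by fact
  interpret F: counting_measure_family R "{M, Q0}"
  proof (intro counting_measure_family.intro counting_measure_family_axioms.intro R.sigma_finite_measure_axioms)
    fix L assume "L \<in> {M, Q0}"
    then consider "L = M" | "L = Q0" by blast
    then show "finite_measure L" "sets L = sets (counting_space R)"
      using M Q0.finite_measure_axioms sets_Q0 by (cases; simp only:)+
  qed simp
  have fm: "f \<in> borel_measurable M" "f \<in> borel_measurable Q0"
    using F.measurable_family[OF _ f(1)] by auto
  show i: "integrable M f"
    by (rule M.integrable_const_bound[where B=b]) (use f fm in auto)
  have sq: "integrable M (\<lambda>\<phi>. (f \<phi>)\<^sup>2)" "integrable Q0 (\<lambda>\<phi>. (f \<phi>)\<^sup>2)"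
    using f by (auto intro!: F.integrable_bdd_sq)
  let ?K = "sqrt (measure M (space M))"
  have close: "(\<integral>\<phi>. f \<phi> \<partial>M) \<le> C * L2_norm Q0 f + e * (C + ?K)" if e: "0 < e" for e
  proof -
    have "\<exists>s\<in>exp_span R. \<forall>L\<in>{M, Q0}. L2_norm L (\<lambda>\<phi>. f \<phi> - s \<phi>) < e"
      by (rule exp_span_dense[OF R.sigma_finite_measure_axioms F.finite_family F.finite_measures F.sets_family f(1)])
         (use sq e in auto)
    then obtain s where s: "s \<in> exp_span R" "L2_norm M (\<lambda>\<phi>. f \<phi> - s \<phi>) < e" "L2_norm Q0 (\<lambda>\<phi>. f \<phi> - s \<phi>) < e"
      by auto
    have sm: "s \<in> borel_measurable M" "s \<in> borel_measurable Q0"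
      using F.measurable_family[OF _ exp_span_measurable[OF s(1)]] by auto
    have ssq: "integrable M (\<lambda>\<phi>. (s \<phi>)\<^sup>2)" "integrable Q0 (\<lambda>\<phi>. (s \<phi>)\<^sup>2)" and si: "integrable M s"
      using F.exp_span_integrable_sq[OF _ s(1)] F.exp_span_integrable[OF _ s(1)] by auto
    have dM: "integrable M (\<lambda>\<phi>. (f \<phi> - s \<phi>)\<^sup>2)" "integrable Q0 (\<lambda>\<phi>. (s \<phi> - f \<phi>)\<^sup>2)"
      by (auto intro!: integrable_sq_diff sq ssq fm sm)
    have "(\<integral>\<phi>. f \<phi> - s \<phi> \<partial>M) \<le> (\<integral>\<phi>. \<bar>f \<phi> - s \<phi>\<bar> \<partial>M)"
      using i si by (intro integral_mono) auto
    also have "\<dots> \<le> L2_norm M (\<lambda>\<phi>. f \<phi> - s \<phi>) * ?K"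
      by (rule abs_integral_le_L2_norm(2)[OF M(1) borel_measurable_diff[OF fm(1) sm(1)] dM(1)])
    also have "\<dots> \<le> e * ?K" using s(2) by (intro mult_right_mono) auto
    finally have 1: "(\<integral>\<phi>. f \<phi> \<partial>M) \<le> (\<integral>\<phi>. s \<phi> \<partial>M) + e * ?K" using i si by simp
    have "L2_norm Q0 (\<lambda>\<phi>. f \<phi> + (s \<phi> - f \<phi>)) \<le> L2_norm Q0 f + L2_norm Q0 (\<lambda>\<phi>. s \<phi> - f \<phi>)"
      by (rule L2_norm_triangle[OF fm(2) borel_measurable_diff[OF sm(2) fm(2)] sq(2) dM(2)])
    then have "L2_norm Q0 s \<le> L2_norm Q0 f + e"
      using s(3) L2_norm_diff_commute[of Q0 s f] by simp
    then have "(\<integral>\<phi>. s \<phi> \<partial>M) \<le> C * (L2_norm Q0 f + e)"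
      using C(2)[OF s(1)] mult_left_mono[OF _ C(1)] by fastforce
    then show ?thesis using 1 by (simp add: algebra_simps)
  qed
  show "(\<integral>\<phi>. f \<phi> \<partial>M) \<le> C * L2_norm Q0 f"
  proof (rule field_le_epsilon)
    fix e :: real assume e: "0 < e"
    have K: "0 \<le> C + ?K" using C(1) by simp
    have "(\<integral>\<phi>. f \<phi> \<partial>M) \<le> C * L2_norm Q0 f + e / (C + ?K + 1) * (C + ?K)"
      using e K by (intro close) simp
    also have "e / (C + ?K + 1) * (C + ?K) \<le> e"
      using e K by (simp add: field_simps)
    finally show "(\<integral>\<phi>. f \<phi> \<partial>M) \<le> C * L2_norm Q0 f + e" by simp
  qed
qed

text \<open>The function f need not be square integrable under M, so the span cannot be used to
  approximate it there directly. The truncations min |f| k are bounded, satisfy the bound with a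
  norm at most that of f, and increase to |f|.\<close>

lemma L2_bound_extension:
  assumes M: "finite_measure M" "sets M = sets (counting_space R)"
    and C: "0 \<le> C" "\<And>s. s \<in> exp_span R \<Longrightarrow> \<bar>\<integral>\<phi>. s \<phi> \<partial>M\<bar> \<le> C * L2_norm Q0 s"
    and f: "f \<in> borel_measurable (counting_space R)" "integrable Q0 (\<lambda>\<phi>. (f \<phi>)\<^sup>2)"
  shows "integrable M f" "(\<integral>\<phi>. \<bar>f \<phi>\<bar> \<partial>M) \<le> C * L2_norm Q0 f"
proof -
  let ?u = "\<lambda>k \<phi>. min \<bar>f \<phi>\<bar> (real k)"
  have fm: "f \<in> borel_measurable M" "f \<in> borel_measurable Q0"
    using f(1) M(2) by (auto simp: measurable_cong_sets[OF M(2) refl] measurable_cong_sets[OF sets_Q0 refl])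
  have um: "?u k \<in> borel_measurable (counting_space R)" for k
    using f(1) by measurable
  have ui: "integrable M (?u k)" and ule: "(\<integral>\<phi>. ?u k \<phi> \<partial>M) \<le> C * L2_norm Q0 (?u k)" for k
    using L2_bound_extension_bounded[OF M C um[of k], of "real k"] by auto
  have norm_le: "L2_norm Q0 (?u k) \<le> L2_norm Q0 f" for k
    unfolding L2_norm_def
  proof (rule real_sqrt_le_mono, rule integral_mono_AE')
    show "AE \<phi> in Q0. (?u k \<phi>)\<^sup>2 \<le> (f \<phi>)\<^sup>2"
      by (rule AE_I2) (simp add: abs_le_square_iff[symmetric])
  qed (use f in auto)
  have lim: "(\<lambda>k. ?u k \<phi>) \<longlonglongrightarrow> \<bar>f \<phi>\<bar>" for \<phi>
  proof (rule tendsto_eventually)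
    obtain K :: nat where "\<bar>f \<phi>\<bar> \<le> real K" using real_arch_simple by blast
    then show "\<forall>\<^sub>F k in sequentially. ?u k \<phi> = \<bar>f \<phi>\<bar>"
      by (intro eventually_sequentiallyI[of K]) simp
  qed
  have le: "(\<integral>\<phi>. ?u k \<phi> \<partial>M) \<le> C * L2_norm Q0 f" for k
    using ule[of k] mult_left_mono[OF norm_le C(1), of k] by linarith
  have "integrable M (\<lambda>\<phi>. \<bar>f \<phi>\<bar>)" "(\<integral>\<phi>. \<bar>f \<phi>\<bar> \<partial>M) \<le> C * L2_norm Q0 f"
    using integrable_limit_le[where u="?u" and f="\<lambda>\<phi>. \<bar>f \<phi>\<bar>", OF ui _ _ _ AE_I2[OF lim] le] fm(1)
    by simp_all
  then show "integrable M f" "(\<integral>\<phi>. \<bar>f \<phi>\<bar> \<partial>M) \<le> C * L2_norm Q0 f"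
    using fm(1) by (auto simp: integrable_abs_iff)
qed

lemma Q_bound: "s \<in> exp_span R \<Longrightarrow> \<bar>\<integral>\<phi>. s \<phi> \<partial>Q\<bar> \<le> tilt_const R g 0 * L2_norm Q0 s"
proof -
  assume s: "s \<in> exp_span R"
  obtain m c u where *: "tilt_span R Q0 Q g m u" "s = (\<lambda>\<phi>. \<Sum>i<m. c i * exp_fun (u i) \<phi>)"
    using exp_span_tilt[OF s] .
  interpret S: tilt_span R Q0 Q g m c u by fact
  have "(\<integral>\<phi>. s \<phi> \<partial>Q) = (\<Sum>i<m. S.b i)"
    unfolding * using exp_fun_integrable[OF Q.prob_space_axioms sets_Q S.u]
    by (simp add: Bochner_Integration.integral_sum expectation_Q[OF S.u] S.a_def S.b_def mult_ac)
  then show ?thesis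
    \<comment> \<open>For n = 0 the convention 0^0 = 1 reduces the moment to the sum of the
      \<open>b i\<close>; any square integrable direction would serve, and 0 is the
      simplest.\<close>
    using S.moment_bound[of "\<lambda>_. 0" 0] unfolding * by simp
qed

lemma Q_integrable:
  assumes "f \<in> borel_measurable (counting_space R)" "integrable Q0 (\<lambda>\<phi>. (f \<phi>)\<^sup>2)"
  shows "integrable Q f" "\<bar>\<integral>\<phi>. f \<phi> \<partial>Q\<bar> \<le> tilt_const R g 0 * L2_norm Q0 f"
proof -
  note * = L2_bound_extension[OF Q.finite_measure_axioms sets_Q tilt_const_nonneg Q_bound assms]
  show "integrable Q f" by (rule *)
  have "\<bar>\<integral>\<phi>. f \<phi> \<partial>Q\<bar> \<le> (\<integral>\<phi>. \<bar>f \<phi>\<bar> \<partial>Q)" by (rule integral_abs_bound)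
  then show "\<bar>\<integral>\<phi>. f \<phi> \<partial>Q\<bar> \<le> tilt_const R g 0 * L2_norm Q0 f" using *(2) by linarith
qed

text \<open>A strictly positive weight makes a sigma-finite measure finite without changing its null
  sets. The cap at 1 gives w^2 \<le> w, hence square integrability.\<close>

lemma exists_weight:
  obtains w :: "'a \<Rightarrow> real" where "w \<in> borel_measurable R" "\<And>x. 0 \<le> w x" "integrable R w"
    "integrable R (\<lambda>x. (w x)\<^sup>2)" "\<And>x. x \<in> space R \<Longrightarrow> 0 < w x"
proof -
  obtain h where h: "h \<in> borel_measurable R" "integral\<^sup>N R h \<noteq> \<infinity>" "\<And>x. x \<in> space R \<Longrightarrow> 0 < h x \<and> h x < \<infinity>"
    using R.Ex_finite_integrable_function by blast
  define w where "w x = min 1 (enn2real (h x))" for x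
  have w: "w \<in> borel_measurable R" "\<And>x. 0 \<le> w x" using h(1) by (auto simp: w_def[abs_def])
  have "(\<integral>\<^sup>+x. ennreal (w x) \<partial>R) \<le> integral\<^sup>N R h"
  proof (rule nn_integral_mono)
    fix x assume "x \<in> space R"
    then have "ennreal (enn2real (h x)) = h x" using h(3) by simp
    then show "ennreal (w x) \<le> h x" by (metis ennreal_leI min.cobounded2 w_def)
  qed
  then have "(\<integral>\<^sup>+x. ennreal (w x) \<partial>R) < \<infinity>" using h(2) by (simp add: less_top top.not_eq_extremum order.strict_trans1)
  then have i: "integrable R w" using w by (intro integrableI_nonneg) auto
  have "(w x)\<^sup>2 \<le> w x" for x
    using mult_left_le_one_le[of "w x" "w x"] w(2)[of x] by (simp add: power2_eq_square) (simp add: w_def)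
  then have "integrable R (\<lambda>x. (w x)\<^sup>2)"
    using w by (intro Bochner_Integration.integrable_bound[OF i]) auto
  moreover have "0 < w x" if "x \<in> space R" for x
    using h(3)[OF that] by (simp add: w_def enn2real_positive_iff)
  ultimately show ?thesis using that w i by blast
qed

text \<open>Both measures agree on rectangles, where the integral of a product factors.\<close>

lemma PiM_density:
  assumes w: "w \<in> borel_measurable R" "\<And>x. 0 \<le> w x" "integrable R w" "integrable R (\<lambda>x. (w x)\<^sup>2)"
  shows "PiM {1..n::nat} (\<lambda>_. density R (\<lambda>x. ennreal (w x))) =
    density (PiM {1..n} (\<lambda>_. R)) (\<lambda>x. \<Prod>j=1..n. ennreal (w (x j)))"
proof -
  have "finite_measure (density R (\<lambda>x. ennreal (w x)))" by (rule finite_W[OF w])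
  then interpret W: finite_measure "density R (\<lambda>x. ennreal (w x))" .
  interpret pW: product_sigma_finite "\<lambda>_::nat. density R (\<lambda>x. ennreal (w x))" ..
  have m: "(\<lambda>x. \<Prod>j=1..n. ennreal (w (x j))) \<in> borel_measurable (PiM {1..n} (\<lambda>_. R))"
    using w(1) by (intro borel_measurable_prod_ennreal measurable_compose[OF measurable_component_singleton]) auto
  show ?thesis
  proof (rule pW.PiM_eqI[symmetric])
    show "sets (density (PiM {1..n} (\<lambda>_. R)) (\<lambda>x. \<Prod>j=1..n. ennreal (w (x j)))) =
        sets (PiM {1..n} (\<lambda>_. density R (\<lambda>x. ennreal (w x))))"
      unfolding sets_density by (rule sets_PiM_cong) auto
    fix A :: "nat \<Rightarrow> 'a set" assume "\<And>i. i \<in> {1..n} \<Longrightarrow> A i \<in> sets (density R (\<lambda>x. ennreal (w x)))"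
    then have A: "A i \<in> sets R" if "i \<in> {1..n}" for i using that by simp
    have "emeasure (density (PiM {1..n} (\<lambda>_. R)) (\<lambda>x. \<Prod>j=1..n. ennreal (w (x j)))) (Pi\<^sub>E {1..n} A) =
        (\<integral>\<^sup>+x. (\<Prod>j=1..n. ennreal (w (x j))) * indicator (Pi\<^sub>E {1..n} A) x \<partial>PiM {1..n} (\<lambda>_. R))"
      using A by (intro emeasure_density m sets_PiM_I_finite) auto
    also have "\<dots> = (\<integral>\<^sup>+x. (\<Prod>j=1..n. ennreal (w (x j)) * indicator (A j) (x j)) \<partial>PiM {1..n} (\<lambda>_. R))"
    proof (rule nn_integral_cong)
      fix x assume "x \<in> space (PiM {1..n} (\<lambda>_. R))"
      then have "indicator (Pi\<^sub>E {1..n} A) x = (\<Prod>j=1..n. indicator (A j) (x j) :: ennreal)"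
        by (auto simp: indicator_def space_PiM PiE_iff prod_zero_iff)
      then show "(\<Prod>j=1..n. ennreal (w (x j))) * indicator (Pi\<^sub>E {1..n} A) x =
          (\<Prod>j=1..n. ennreal (w (x j)) * indicator (A j) (x j))"
        by (simp add: prod.distrib)
    qed
    also have "\<dots> = (\<Prod>j=1..n. \<integral>\<^sup>+x. ennreal (w x) * indicator (A j) x \<partial>R)"
      using A w(1) by (intro prod.product_nn_integral_prod) auto
    also have "\<dots> = (\<Prod>j=1..n. emeasure (density R (\<lambda>x. ennreal (w x))) (A j))"
      using A w(1) by (intro prod.cong) (auto simp: emeasure_density)
    finally show "emeasure (density (PiM {1..n} (\<lambda>_. R)) (\<lambda>x. \<Prod>j=1..n. ennreal (w (x j)))) (Pi\<^sub>E {1..n} A) =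
        (\<Prod>j=1..n. emeasure (density R (\<lambda>x. ennreal (w x))) (A j))" .
  qed simp
qed

text \<open>The product density is strictly positive, so the two product measures have the same null
  sets. Statements proved for the finite weighted measure return in this way to R^n.\<close>

lemma AE_PiM_density:
  assumes w: "w \<in> borel_measurable R" "\<And>x. 0 \<le> w x" "integrable R w" "integrable R (\<lambda>x. (w x)\<^sup>2)"
    and pos: "\<And>x. x \<in> space R \<Longrightarrow> 0 < w x"
  shows "(AE x in PiM {1..n::nat} (\<lambda>_. density R (\<lambda>x. ennreal (w x))). P x) \<longleftrightarrow> (AE x in PiM {1..n} (\<lambda>_. R). P x)"
proof -
  have m: "(\<lambda>x. \<Prod>j=1..n. ennreal (w (x j))) \<in> borel_measurable (PiM {1..n} (\<lambda>_. R))"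
    using w(1) by (intro borel_measurable_prod_ennreal measurable_compose[OF measurable_component_singleton]) auto
  have pos': "0 < (\<Prod>j=1..n. ennreal (w (x j)))" if "x \<in> space (PiM {1..n} (\<lambda>_. R))" for x
    using that pos by (force simp: zero_less_iff_neq_zero prod_zero_iff space_PiM PiE_iff ennreal_eq_0_iff)
  show ?thesis
    unfolding PiM_density[OF w] AE_density[OF m]
    by (rule AE_cong) (use pos' in auto)
qed

end

lemma diff_op_diff:
  "diff_op R n x (\<lambda>\<phi>. f \<phi> - f' \<phi>) \<phi> = diff_op R n x f \<phi> - diff_op R n x f' \<phi>"
  by (simp add: diff_op_def right_diff_distrib sum_subtractf)

lemma diff_op_measurable:
  assumes "f \<in> borel_measurable (counting_space R)"
  shows "(\<lambda>(x, \<phi>). diff_op R n x f \<phi>) \<in> borel_measurable (PiM {1..n} (\<lambda>_. R) \<Otimes>\<^sub>M counting_space R)"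
proof -
  have "(\<lambda>z. f (add_points R (snd z) (fst z) J)) \<in>
      borel_measurable (PiM {1..n} (\<lambda>_. R) \<Otimes>\<^sub>M counting_space R)" if "J \<in> Pow {1..n}" for J
    using that measurable_compose[OF add_points_measurable[of J "{1..n}"] assms]
    by (auto simp: case_prod_beta' finite_subset)
  then show ?thesis
    unfolding diff_op_def case_prod_beta' by (intro borel_measurable_sum borel_measurable_times) auto
qed

context poisson_tilt
begin

definition square_integrable :: "('a measure \<Rightarrow> real) \<Rightarrow> bool" where
  "square_integrable f \<longleftrightarrow> f \<in> borel_measurable (counting_space R) \<and> integrable Q0 (\<lambda>\<phi>. (f \<phi>)\<^sup>2)"

lemma square_integrable_span: "s \<in> exp_span R \<Longrightarrow> square_integrable s"
  using exp_span_Q0 by (simp add: square_integrable_def)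

lemma square_integrable_diff:
  assumes "square_integrable f" "square_integrable f'"
  shows "square_integrable (\<lambda>\<phi>. f \<phi> - f' \<phi>)"
proof -
  have "f \<in> borel_measurable Q0" "f' \<in> borel_measurable Q0"
    using assms by (auto simp: square_integrable_def measurable_cong_sets[OF sets_Q0 refl])
  then show ?thesis
    using assms integrable_sq_diff[of Q0 f f'] by (auto simp: square_integrable_def)
qed

lemma square_integrable_approx:
  assumes f: "square_integrable f" and e: "0 < e"
  obtains s where "s \<in> exp_span R" "L2_norm Q0 (\<lambda>\<phi>. f \<phi> - s \<phi>) < e"
proof -
  have "\<exists>s\<in>exp_span R. \<forall>M\<in>{Q0}. L2_norm M (\<lambda>\<phi>. f \<phi> - s \<phi>) < e"
    by (rule exp_span_dense[OF R.sigma_finite_measure_axioms])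
       (use f e in \<open>simp_all add: square_integrable_def Q0.finite_measure_axioms sets_Q0\<close>)
  then show ?thesis using that by auto
qed

text \<open>D^n f is a signed sum over J of f at the configuration enlarged by the points in J, and
  each summand is integrated against \<open>shifted w n J\<close>. The constant is obtained before f
  is fixed; by linearity the bound expresses continuity in f.\<close>

lemma diff_op_L1_bound:
  assumes w: "w \<in> borel_measurable R" "\<And>x. 0 \<le> w x" "integrable R w" "integrable R (\<lambda>x. (w x)\<^sup>2)"
  obtains C where "0 \<le> C"
    "\<And>f. square_integrable f \<Longrightarrow>
      integrable (PiM {1..n} (\<lambda>_. density R (\<lambda>x. ennreal (w x))) \<Otimes>\<^sub>M Q) (\<lambda>(x, \<phi>). diff_op R n x f \<phi>)"
    "\<And>f. square_integrable f \<Longrightarrow>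
      (\<integral>(x, \<phi>). \<bar>diff_op R n x f \<phi>\<bar> \<partial>(PiM {1..n} (\<lambda>_. density R (\<lambda>x. ennreal (w x))) \<Otimes>\<^sub>M Q)) \<le> C * L2_norm Q0 f"
proof -
  let ?PQ = "PiM {1..n} (\<lambda>_. density R (\<lambda>x. ennreal (w x))) \<Otimes>\<^sub>M Q"
  have "\<exists>C. 0 \<le> C \<and> (\<forall>s\<in>exp_span R. \<bar>\<integral>\<phi>. s \<phi> \<partial>shifted w n J\<bar> \<le> C * L2_norm Q0 s)" if "J \<in> Pow {1..n}" for J
    using shifted_bound[OF w, of J n] that by (metis PowD)
  then obtain CJ where CJ: "\<And>J. J \<in> Pow {1..n} \<Longrightarrow> 0 \<le> CJ J"
    "\<And>J s. J \<in> Pow {1..n} \<Longrightarrow> s \<in> exp_span R \<Longrightarrow> \<bar>\<integral>\<phi>. s \<phi> \<partial>shifted w n J\<bar> \<le> CJ J * L2_norm Q0 s"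
    by metis
  have main: "integrable ?PQ (\<lambda>z. f (add_points R (snd z) (fst z) J))"
      "(\<integral>z. \<bar>f (add_points R (snd z) (fst z) J)\<bar> \<partial>?PQ) \<le> CJ J * L2_norm Q0 f"
    if J: "J \<in> Pow {1..n}" and f: "square_integrable f" for J f
  proof -
    have J': "J \<subseteq> {1..n}" using J by simp
    have fm: "f \<in> borel_measurable (counting_space R)" "integrable Q0 (\<lambda>\<phi>. (f \<phi>)\<^sup>2)"
      using f by (auto simp: square_integrable_def)
    have sets: "sets (shifted w n J) = sets (counting_space R)" by (simp add: shifted_def)
    note ext = L2_bound_extension[OF finite_shifted[OF w J'] sets CJ(1)[OF J] CJ(2)[OF J] fm]
    have eq: "(\<lambda>z. F (case z of (x, \<phi>) \<Rightarrow> add_points R \<phi> x J)) = (\<lambda>z. F (add_points R (snd z) (fst z) J))" for F :: "'a measure \<Rightarrow> real"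
      by (simp add: case_prod_beta')
    show "integrable ?PQ (\<lambda>z. f (add_points R (snd z) (fst z) J))"
      using integrable_distr[OF add_points_measurable_W[OF w J'] ext(1)[unfolded shifted_def]]
      unfolding eq .
    have "(\<integral>z. \<bar>f (add_points R (snd z) (fst z) J)\<bar> \<partial>?PQ) = (\<integral>\<phi>. \<bar>f \<phi>\<bar> \<partial>shifted w n J)"
      unfolding shifted_def
      by (subst integral_distr[OF add_points_measurable_W[OF w J']]) (use fm in \<open>auto simp: case_prod_beta'\<close>)
    then show "(\<integral>z. \<bar>f (add_points R (snd z) (fst z) J)\<bar> \<partial>?PQ) \<le> CJ J * L2_norm Q0 f"
      using ext(2) by simp
  qed
  have int: "integrable ?PQ (\<lambda>(x, \<phi>). diff_op R n x f \<phi>)" if "square_integrable f" for f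
    unfolding diff_op_def case_prod_beta'
    by (intro Bochner_Integration.integrable_sum integrable_mult_right main that)
  have "(\<integral>(x, \<phi>). \<bar>diff_op R n x f \<phi>\<bar> \<partial>?PQ) \<le> (\<Sum>J\<in>Pow {1..n}. CJ J) * L2_norm Q0 f" if f: "square_integrable f" for f
  proof -
    have "(\<integral>(x, \<phi>). \<bar>diff_op R n x f \<phi>\<bar> \<partial>?PQ) \<le>
        (\<integral>z. (\<Sum>J\<in>Pow {1..n}. \<bar>f (add_points R (snd z) (fst z) J)\<bar>) \<partial>?PQ)"
      unfolding case_prod_beta'
    proof (rule integral_mono)
      show "integrable ?PQ (\<lambda>z. \<bar>diff_op R n (fst z) f (snd z)\<bar>)"
        using int[OF f] by (simp add: case_prod_beta')
      show "integrable ?PQ (\<lambda>z. \<Sum>J\<in>Pow {1..n}. \<bar>f (add_points R (snd z) (fst z) J)\<bar>)"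
        by (intro Bochner_Integration.integrable_sum integrable_abs main f)
      show "\<bar>diff_op R n (fst z) f (snd z)\<bar> \<le> (\<Sum>J\<in>Pow {1..n}. \<bar>f (add_points R (snd z) (fst z) J)\<bar>)" for z
        unfolding diff_op_def by (rule order_trans[OF sum_abs]) (simp add: abs_mult power_abs)
    qed
    also have "\<dots> = (\<Sum>J\<in>Pow {1..n}. \<integral>z. \<bar>f (add_points R (snd z) (fst z) J)\<bar> \<partial>?PQ)"
      by (intro Bochner_Integration.integral_sum integrable_abs main f)
    also have "\<dots> \<le> (\<Sum>J\<in>Pow {1..n}. CJ J * L2_norm Q0 f)"
      by (intro sum_mono main f)
    finally show ?thesis by (simp add: sum_distrib_right)
  qed
  moreover have "0 \<le> (\<Sum>J\<in>Pow {1..n}. CJ J)" by (intro sum_nonneg CJ(1))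
  ultimately show ?thesis using that int by blast
qed

text \<open>Fubini gives a meaning to E D^n f at almost every x and integrates the previous bound.
  This bound, with a weight and an unspecified C, serves convergence only; the quantitative one is
  \<open>mean_diff_L2\<close>.\<close>

lemma mean_diff_L1_bound:
  assumes w: "w \<in> borel_measurable R" "\<And>x. 0 \<le> w x" "integrable R w" "integrable R (\<lambda>x. (w x)\<^sup>2)"
  obtains C where "0 \<le> C"
    "\<And>f. square_integrable f \<Longrightarrow>
      AE x in PiM {1..n} (\<lambda>_. density R (\<lambda>x. ennreal (w x))). integrable Q (diff_op R n x f)"
    "\<And>f. square_integrable f \<Longrightarrow>
      integrable (PiM {1..n} (\<lambda>_. density R (\<lambda>x. ennreal (w x)))) (mean_diff n f)"
    "\<And>f. square_integrable f \<Longrightarrow>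
      (\<integral>x. \<bar>mean_diff n f x\<bar> \<partial>PiM {1..n} (\<lambda>_. density R (\<lambda>x. ennreal (w x)))) \<le> C * L2_norm Q0 f"
proof -
  let ?P = "PiM {1..n} (\<lambda>_. density R (\<lambda>x. ennreal (w x)))"
  interpret P: finite_measure ?P by (rule finite_PiM_W[OF w])
  interpret PQ: pair_sigma_finite ?P Q ..
  obtain C where C: "0 \<le> C"
    "\<And>f. square_integrable f \<Longrightarrow> integrable (?P \<Otimes>\<^sub>M Q) (\<lambda>(x, \<phi>). diff_op R n x f \<phi>)"
    "\<And>f. square_integrable f \<Longrightarrow> (\<integral>(x, \<phi>). \<bar>diff_op R n x f \<phi>\<bar> \<partial>(?P \<Otimes>\<^sub>M Q)) \<le> C * L2_norm Q0 f"
    using diff_op_L1_bound[OF w] by blast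
  have ae: "AE x in ?P. integrable Q (diff_op R n x f)" if "square_integrable f" for f
    using PQ.AE_integrable_fst'[OF C(2)[OF that]] by simp
  have int: "integrable ?P (mean_diff n f)" if "square_integrable f" for f
    using PQ.integrable_fst'[OF C(2)[OF that]] by (simp add: mean_diff_def[abs_def])
  have "(\<integral>x. \<bar>mean_diff n f x\<bar> \<partial>?P) \<le> C * L2_norm Q0 f" if f: "square_integrable f" for f
  proof -
    have ia: "integrable (?P \<Otimes>\<^sub>M Q) (\<lambda>(x, \<phi>). \<bar>diff_op R n x f \<phi>\<bar>)"
      using integrable_abs[OF C(2)[OF f]] by (simp add: case_prod_beta')
    have "(\<integral>x. \<bar>mean_diff n f x\<bar> \<partial>?P) \<le> (\<integral>x. \<integral>\<phi>. \<bar>diff_op R n x f \<phi>\<bar> \<partial>Q \<partial>?P)"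
    proof (rule integral_mono)
      show "integrable ?P (\<lambda>x. \<integral>\<phi>. \<bar>diff_op R n x f \<phi>\<bar> \<partial>Q)"
        using PQ.integrable_fst'[OF ia] by simp
      show "\<bar>mean_diff n f x\<bar> \<le> (\<integral>\<phi>. \<bar>diff_op R n x f \<phi>\<bar> \<partial>Q)" for x
        unfolding mean_diff_def by (rule integral_abs_bound)
    qed (use int[OF f] in simp)
    also have "\<dots> = (\<integral>(x, \<phi>). \<bar>diff_op R n x f \<phi>\<bar> \<partial>(?P \<Otimes>\<^sub>M Q))"
      using PQ.integral_fst'[OF ia] by simp
    finally show ?thesis using C(3)[OF f] by linarith
  qed
  then show ?thesis using that C(1) ae int by blast
qed

lemma mean_diff_AE_integrable:
  assumes "square_integrable f"
  shows "AE x in PiM {1..n} (\<lambda>_. R). integrable Q (diff_op R n x f)"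
proof -
  obtain w :: "'a \<Rightarrow> real" where w: "w \<in> borel_measurable R" "\<And>x. 0 \<le> w x" "integrable R w" "integrable R (\<lambda>x. (w x)\<^sup>2)"
    "\<And>x. x \<in> space R \<Longrightarrow> 0 < w x" using exists_weight by blast
  obtain C :: real where "0 \<le> C" and ae: "\<And>f. square_integrable f \<Longrightarrow>
      AE x in PiM {1..n} (\<lambda>_. density R (\<lambda>x. ennreal (w x))). integrable Q (diff_op R n x f)"
    by (rule mean_diff_L1_bound[OF w(1-4), of n]) blast
  show ?thesis
    using ae[OF assms] AE_PiM_density[OF w] by blast
qed

text \<open>Linearity holds almost everywhere rather than everywhere: where an integral does not
  exist, its value is 0 by convention.\<close>

lemma mean_diff_diff:
  assumes "square_integrable f" "square_integrable f'"
  shows "AE x in PiM {1..n} (\<lambda>_. R). mean_diff n (\<lambda>\<phi>. f \<phi> - f' \<phi>) x = mean_diff n f x - mean_diff n f' x"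
  using mean_diff_AE_integrable[OF assms(1)] mean_diff_AE_integrable[OF assms(2)]
  by eventually_elim (simp add: mean_diff_def diff_op_diff)

lemma mean_diff_measurable:
  assumes "square_integrable f"
  shows "mean_diff n f \<in> borel_measurable (PiM {1..n} (\<lambda>_. R))"
proof -
  have "(\<lambda>(x, \<phi>). diff_op R n x f \<phi>) \<in> borel_measurable (PiM {1..n} (\<lambda>_. R) \<Otimes>\<^sub>M Q)"
    using diff_op_measurable[of f R n] assms
    by (simp add: square_integrable_def measurable_cong_sets[OF sets_pair_measure_cong[OF refl sets_Q] refl])
  then show ?thesis
    unfolding mean_diff_def[abs_def] by (rule Q.borel_measurable_lebesgue_integral)
qed

text \<open>The bound holds on the span and passes to the limit by Fatou's lemma along a subsequence
  that converges almost everywhere; the \<open>L\<^sup>1\<close> bound for the weighted measure provides it.\<close>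

lemma mean_diff_L2:
  assumes f: "square_integrable f"
  shows "integrable (PiM {1..n} (\<lambda>_. R)) (\<lambda>x. (mean_diff n f x)\<^sup>2)"
    and "L2_norm (PiM {1..n} (\<lambda>_. R)) (mean_diff n f) \<le> tilt_const R g n * L2_norm Q0 f"
proof -
  let ?PR = "PiM {1..n} (\<lambda>_. R)" and ?K = "tilt_const R g n"
  obtain w :: "'a \<Rightarrow> real" where w: "w \<in> borel_measurable R" "\<And>x. 0 \<le> w x" "integrable R w" "integrable R (\<lambda>x. (w x)\<^sup>2)"
    "\<And>x. x \<in> space R \<Longrightarrow> 0 < w x" using exists_weight by blast
  let ?P = "PiM {1..n} (\<lambda>_. density R (\<lambda>x. ennreal (w x)))"
  obtain C where C: "0 \<le> C"
    "\<And>f. square_integrable f \<Longrightarrow> integrable ?P (mean_diff n f)"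
    "\<And>f. square_integrable f \<Longrightarrow> (\<integral>x. \<bar>mean_diff n f x\<bar> \<partial>?P) \<le> C * L2_norm Q0 f"
    by (rule mean_diff_L1_bound[OF w(1-4), of n]) blast
  have fm: "f \<in> borel_measurable Q0" "integrable Q0 (\<lambda>\<phi>. (f \<phi>)\<^sup>2)"
    using f by (auto simp: square_integrable_def measurable_cong_sets[OF sets_Q0 refl])
  have close: "integrable ?PR (\<lambda>x. (mean_diff n f x)\<^sup>2) \<and>
      (\<integral>x. (mean_diff n f x)\<^sup>2 \<partial>?PR) \<le> (?K * (L2_norm Q0 f + e))\<^sup>2" if e: "0 < e" for e
  proof -
    \<comment> \<open>The factor 1 / (k + 1) forces convergence, while the factor e keeps every
      approximant within e of f, so that all norms, also along the subsequence, are at most the norm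
      of f plus e.\<close>
    have "\<exists>s. s \<in> exp_span R \<and> L2_norm Q0 (\<lambda>\<phi>. f \<phi> - s \<phi>) < e * inverse (real (Suc k))" for k
      using square_integrable_approx[OF f, of "e * inverse (real (Suc k))"] e by auto
    then obtain s where s: "\<And>k. s k \<in> exp_span R"
      "\<And>k. L2_norm Q0 (\<lambda>\<phi>. f \<phi> - s k \<phi>) < e * inverse (real (Suc k))" by metis
    have sd: "square_integrable (\<lambda>\<phi>. f \<phi> - s k \<phi>)" for k
      by (intro square_integrable_diff f square_integrable_span s)
    have "(\<lambda>k. \<integral>x. norm (mean_diff n (\<lambda>\<phi>. f \<phi> - s k \<phi>) x) \<partial>?P) \<longlonglongrightarrow> 0"
    proof (rule tendsto_sandwich[where f="\<lambda>_. 0"])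
      show "\<forall>\<^sub>F k in sequentially. (\<integral>x. norm (mean_diff n (\<lambda>\<phi>. f \<phi> - s k \<phi>) x) \<partial>?P) \<le> C * (e * inverse (real (Suc k)))"
      proof (rule always_eventually, rule allI)
        fix k
        have "(\<integral>x. norm (mean_diff n (\<lambda>\<phi>. f \<phi> - s k \<phi>) x) \<partial>?P) \<le> C * L2_norm Q0 (\<lambda>\<phi>. f \<phi> - s k \<phi>)"
          using C(3)[OF sd] by simp
        also have "\<dots> \<le> C * (e * inverse (real (Suc k)))"
          using s(2)[of k] C(1) by (intro mult_left_mono) auto
        finally show "(\<integral>x. norm (mean_diff n (\<lambda>\<phi>. f \<phi> - s k \<phi>) x) \<partial>?P) \<le> C * (e * inverse (real (Suc k)))" .
      qed
      show "(\<lambda>k. C * (e * inverse (real (Suc k)))) \<longlonglongrightarrow> 0"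
        by (intro tendsto_mult_right_zero LIMSEQ_inverse_real_of_nat)
    qed (auto intro!: always_eventually)
    then obtain r :: "nat \<Rightarrow> nat" where r: "AE x in ?P. (\<lambda>k. mean_diff n (\<lambda>\<phi>. f \<phi> - s (r k) \<phi>) x) \<longlonglongrightarrow> 0"
      using tendsto_L1_AE_subseq[of ?P "\<lambda>k. mean_diff n (\<lambda>\<phi>. f \<phi> - s k \<phi>)"] C(2)[OF sd] by auto
    have "AE x in ?PR. (\<lambda>k. mean_diff n (\<lambda>\<phi>. f \<phi> - s (r k) \<phi>) x) \<longlonglongrightarrow> 0"
      using r AE_PiM_density[OF w] by blast
    moreover have "AE x in ?PR. \<forall>k. mean_diff n (\<lambda>\<phi>. f \<phi> - s (r k) \<phi>) x = mean_diff n f x - mean_diff n (s (r k)) x"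
      unfolding AE_all_countable by (intro allI mean_diff_diff f square_integrable_span s)
    ultimately have lim: "AE x in ?PR. (\<lambda>k. (mean_diff n (s (r k)) x)\<^sup>2) \<longlonglongrightarrow> (mean_diff n f x)\<^sup>2"
    proof eventually_elim
      case (elim x)
      then have "(\<lambda>k. mean_diff n f x - mean_diff n (s (r k)) x) \<longlonglongrightarrow> 0" by simp
      from tendsto_diff[OF tendsto_const[of "mean_diff n f x"] this]
      have "(\<lambda>k. mean_diff n (s (r k)) x) \<longlonglongrightarrow> mean_diff n f x" by simp
      then show ?case by (rule tendsto_power)
    qed
    have le: "(\<integral>x. (mean_diff n (s (r k)) x)\<^sup>2 \<partial>?PR) \<le> (?K * (L2_norm Q0 f + e))\<^sup>2" for k
    proof -
      let ?s = "s (r k)"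
      have sm: "?s \<in> borel_measurable Q0" "integrable Q0 (\<lambda>\<phi>. (?s \<phi>)\<^sup>2)"
        using exp_span_Q0[OF s(1)] by (auto simp: measurable_cong_sets[OF sets_Q0 refl])
      have "L2_norm Q0 (\<lambda>\<phi>. f \<phi> + (?s \<phi> - f \<phi>)) \<le> L2_norm Q0 f + L2_norm Q0 (\<lambda>\<phi>. ?s \<phi> - f \<phi>)"
        by (rule L2_norm_triangle[OF fm(1) borel_measurable_diff[OF sm(1) fm(1)] fm(2)
              integrable_sq_diff[OF sm(2) fm(2) sm(1) fm(1)]])
      moreover have "e * inverse (real (Suc (r k))) \<le> e"
        using e by (simp add: field_simps)
      ultimately have "L2_norm Q0 ?s \<le> L2_norm Q0 f + e"
        using s(2)[of "r k"] L2_norm_diff_commute[of Q0 ?s f] by simp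
      then have "?K * L2_norm Q0 ?s \<le> ?K * (L2_norm Q0 f + e)"
        by (intro mult_left_mono) auto
      with mean_diff_span(3)[OF s(1), of n "r k"]
      have "L2_norm ?PR (mean_diff n ?s) \<le> ?K * (L2_norm Q0 f + e)" by linarith
      from power_mono[OF this, of 2] show ?thesis by (simp add: L2_norm_power2)
    qed
    have fmd: "(\<lambda>x. (mean_diff n f x)\<^sup>2) \<in> borel_measurable ?PR"
      using mean_diff_measurable[OF f] by measurable
    show ?thesis
      using integrable_limit_le[where u="\<lambda>k x. (mean_diff n (s (r k)) x)\<^sup>2" and f="\<lambda>x. (mean_diff n f x)\<^sup>2",
          OF mean_diff_span(2)[OF s(1)] zero_le_power2 fmd zero_le_power2 lim le] by blast
  qed
  show "integrable ?PR (\<lambda>x. (mean_diff n f x)\<^sup>2)" using close[of 1] by simp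
  show "L2_norm ?PR (mean_diff n f) \<le> ?K * L2_norm Q0 f"
  proof (rule field_le_epsilon)
    fix e :: real assume e: "0 < e"
    then have e': "0 < e / (?K + 1)" by (simp add: add_nonneg_pos)
    have "sqrt (\<integral>x. (mean_diff n f x)\<^sup>2 \<partial>?PR) \<le> sqrt ((?K * (L2_norm Q0 f + e / (?K + 1)))\<^sup>2)"
      using close[OF e'] by (intro real_sqrt_le_mono) simp
    also have "\<dots> = ?K * (L2_norm Q0 f + e / (?K + 1))"
      using e' by (intro real_sqrt_unique) auto
    also have "\<dots> \<le> ?K * L2_norm Q0 f + e"
    proof -
      have "?K * (e / (?K + 1)) \<le> e"
        using e tilt_const_nonneg[of R g n] by (simp add: pos_divide_le_eq add_nonneg_pos distrib_left mult.commute)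
      then show ?thesis by (simp add: distrib_left)
    qed
    finally show "L2_norm ?PR (mean_diff n f) \<le> ?K * L2_norm Q0 f + e"
      by (simp add: L2_norm_def)
  qed
qed

subsection \<open>The expansion\<close>

definition coeff :: "('a \<Rightarrow> real) \<Rightarrow> nat \<Rightarrow> ('a measure \<Rightarrow> real) \<Rightarrow> real" where
  "coeff h n f = (\<integral>x. mean_diff n f x * (\<Prod>j=1..n. h (x j)) \<partial>PiM {1..n} (\<lambda>_. R))"

context
  fixes h :: "'a \<Rightarrow> real"
  assumes h: "h \<in> borel_measurable R" "integrable R (\<lambda>x. (h x)\<^sup>2)"
begin

lemma coeff_integrable:
  "square_integrable f \<Longrightarrow> integrable (PiM {1..n} (\<lambda>_. R)) (\<lambda>x. mean_diff n f x * (\<Prod>j=1..n. h (x j)))"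
  by (intro integrable_mult_L2 mean_diff_measurable mean_diff_L2 L2_prod h)

lemma coeff_bound:
  assumes "square_integrable f"
  shows "\<bar>coeff h n f\<bar> \<le> tilt_const R g n * L2_norm R h ^ n * L2_norm Q0 f"
proof -
  have "\<bar>coeff h n f\<bar> \<le> L2_norm (PiM {1..n} (\<lambda>_. R)) (mean_diff n f) *
      L2_norm (PiM {1..n} (\<lambda>_. R)) (\<lambda>x. \<Prod>j=1..n. h (x j))"
    unfolding coeff_def by (intro Cauchy_Schwarz_integral mean_diff_measurable mean_diff_L2 L2_prod h assms)
  also have "\<dots> \<le> (tilt_const R g n * L2_norm Q0 f) * L2_norm R h ^ n"
    unfolding L2_prod(3)[OF h] by (intro mult_right_mono mean_diff_L2 assms) simp
  finally show ?thesis by (simp add: mult_ac)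
qed

lemma coeff_diff:
  assumes "square_integrable f" "square_integrable f'"
  shows "coeff h n (\<lambda>\<phi>. f \<phi> - f' \<phi>) = coeff h n f - coeff h n f'"
proof -
  have "coeff h n (\<lambda>\<phi>. f \<phi> - f' \<phi>) =
      (\<integral>x. mean_diff n f x * (\<Prod>j=1..n. h (x j)) - mean_diff n f' x * (\<Prod>j=1..n. h (x j)) \<partial>PiM {1..n} (\<lambda>_. R))"
    unfolding coeff_def
  proof (rule integral_cong_AE)
    show "AE x in PiM {1..n} (\<lambda>_. R). mean_diff n (\<lambda>\<phi>. f \<phi> - f' \<phi>) x * (\<Prod>j=1..n. h (x j)) =
        mean_diff n f x * (\<Prod>j=1..n. h (x j)) - mean_diff n f' x * (\<Prod>j=1..n. h (x j))"
      using mean_diff_diff[OF assms, of n] by eventually_elim (simp add: left_diff_distrib)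
  qed (intro borel_measurable_diff borel_measurable_times mean_diff_measurable L2_prod h assms square_integrable_diff)+
  also have "\<dots> = coeff h n f - coeff h n f'"
    unfolding coeff_def by (intro Bochner_Integration.integral_diff coeff_integrable assms)
  finally show ?thesis .
qed

text \<open>Up to a constant the n-th term has modulus D = sqrt ((2 y^2)^n / n!). Writing D^2 = A *
  B with A = (8 y^2)^n / n! and B = (1/4)^n gives D \<le> A + B, an exponential plus a geometric
  series. The factor 4 moved into A is what makes B summable.\<close>

lemma summable_tilt_const: "summable (\<lambda>n. tilt_const R g n * y ^ n / fact n)"
proof (rule summable_comparison_test)
  let ?c = "sqrt (exp (2 * (\<integral>x. (g x)\<^sup>2 \<partial>R)))"
  show "summable (\<lambda>n. ?c * ((8 * y\<^sup>2) ^ n /\<^sub>R fact n + (1/4) ^ n))"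
    by (intro summable_mult summable_add summable_exp_generic summable_geometric) simp
  have "norm (tilt_const R g n * y ^ n / fact n) \<le> ?c * ((8 * y\<^sup>2) ^ n /\<^sub>R fact n + (1/4) ^ n)" for n
  proof -
    define A where "A = (8 * y\<^sup>2) ^ n / fact n"
    define B where "B = (1/4 :: real) ^ n"
    define D where "D = \<bar>y\<bar> ^ n * sqrt (fact n * 2 ^ n) / fact n"
    have AB: "0 \<le> A" "0 \<le> B" by (simp_all add: A_def B_def)
    have "D\<^sup>2 = A * B"
    proof -
      have "D\<^sup>2 = (\<bar>y\<bar> ^ n)\<^sup>2 * (fact n * 2 ^ n) / (fact n * fact n)"
        unfolding D_def power_divide power_mult_distrib by (simp add: power2_eq_square)
      also have "(\<bar>y\<bar> ^ n)\<^sup>2 = (y\<^sup>2) ^ n"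
        by (metis power2_abs power_mult mult.commute)
      also have "(y\<^sup>2) ^ n * (fact n * 2 ^ n) / (fact n * fact n) = (2 * y\<^sup>2) ^ n / fact n"
        by (simp add: power_mult_distrib)
      also have "(2 * y\<^sup>2) ^ n = (8 * y\<^sup>2 * (1/4)) ^ n" by simp
      also have "\<dots> / fact n = A * B"
        unfolding A_def B_def power_mult_distrib by simp
      finally show ?thesis .
    qed
    also have "A * B \<le> (A + B)\<^sup>2"
      using AB by (simp add: power2_sum)
    finally have "D \<le> A + B" by (rule power2_le_imp_le) (use AB in simp)
    moreover have "A + B = (8 * y\<^sup>2) ^ n /\<^sub>R fact n + (1/4) ^ n"
      unfolding A_def B_def by (simp only: real_scaleR_def divide_inverse_commute)
    ultimately have "?c * D \<le> ?c * ((8 * y\<^sup>2) ^ n /\<^sub>R fact n + (1/4) ^ n)"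
      by (intro mult_left_mono) simp_all
    then have "?c * (\<bar>y\<bar> ^ n * sqrt (fact n * 2 ^ n) / fact n) \<le> ?c * ((8 * y\<^sup>2) ^ n /\<^sub>R fact n + (1/4) ^ n)"
      unfolding D_def .
    then show ?thesis
      by (simp add: tilt_const_def real_sqrt_mult abs_mult power_abs mult_ac)
  qed
  then show "\<exists>N. \<forall>n\<ge>N. norm (tilt_const R g n * y ^ n / fact n) \<le> ?c * ((8 * y\<^sup>2) ^ n /\<^sub>R fact n + (1/4) ^ n)"
    by blast
qed

lemma summable_coeff:
  assumes f: "square_integrable f"
  shows "summable (\<lambda>n. \<bar>y ^ n / fact n * coeff h n f\<bar>)"
proof (rule summable_comparison_test)
  show "summable (\<lambda>n. L2_norm Q0 f * (tilt_const R g n * (\<bar>y\<bar> * L2_norm R h) ^ n / fact n))"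
    by (intro summable_mult summable_tilt_const)
  have "norm \<bar>y ^ n / fact n * coeff h n f\<bar> \<le> L2_norm Q0 f * (tilt_const R g n * (\<bar>y\<bar> * L2_norm R h) ^ n / fact n)" for n
  proof -
    have "\<bar>y ^ n / fact n\<bar> * \<bar>coeff h n f\<bar> \<le> \<bar>y ^ n / fact n\<bar> * (tilt_const R g n * L2_norm R h ^ n * L2_norm Q0 f)"
      by (intro mult_left_mono coeff_bound f) simp
    then show ?thesis by (simp add: abs_mult power_abs power_mult_distrib mult_ac)
  qed
  then show "\<exists>N. \<forall>n\<ge>N. norm \<bar>y ^ n / fact n * coeff h n f\<bar> \<le> L2_norm Q0 f * (tilt_const R g n * (\<bar>y\<bar> * L2_norm R h) ^ n / fact n)"
    by blast
qed

text \<open>The sum of the series is a bounded functional of f in L2 of \<open>Q0\<close>, as the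
  density argument in \<open>expansion\<close> needs.\<close>

lemma suminf_coeff_bound:
  assumes f: "square_integrable f"
  shows "\<bar>\<Sum>n. coeff h n f / fact n\<bar> \<le> (\<Sum>n. tilt_const R g n * L2_norm R h ^ n / fact n) * L2_norm Q0 f"
proof -
  have "summable (\<lambda>n. \<bar>coeff h n f / fact n\<bar>)"
    using summable_coeff[OF f, of 1] by (simp add: divide_inverse mult.commute)
  moreover have "\<bar>coeff h n f / fact n\<bar> \<le> tilt_const R g n * L2_norm R h ^ n / fact n * L2_norm Q0 f" for n
    using divide_right_mono[OF coeff_bound[OF f, of n], of "fact n"] by (simp add: abs_divide mult_ac)
  ultimately have "\<bar>\<Sum>n. coeff h n f / fact n\<bar> \<le> (\<Sum>n. tilt_const R g n * L2_norm R h ^ n / fact n * L2_norm Q0 f)"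
    using summable_mult2[OF summable_tilt_const, of _ "L2_norm Q0 f"]
    by (intro order_trans[OF summable_rabs suminf_le])
  then show ?thesis
    using summable_tilt_const by (simp add: suminf_mult2)
qed

text \<open>On the span both sides equal the sum of \<open>b i\<close> * exp <v i, h>: the factor
  exp <v i, g> is already contained in \<open>b i\<close>, and exp <v i, h> is summed as a power
  series. Both laws refer to the same \<open>Q0\<close>, so one approximation of f controls both
  sides.\<close>

lemma expansion:
  assumes Q': "poisson_tilt R Q0 Q' (\<lambda>x. g x + h x)" and f: "square_integrable f"
  shows "(\<integral>\<phi>. f \<phi> \<partial>Q') = (\<Sum>n. coeff h n f / fact n)"
proof -
  interpret Q': poisson_tilt R Q0 Q' "\<lambda>x. g x + h x" by fact
  have sums: "summable (\<lambda>n. coeff h n f / fact n)" if "square_integrable f" for f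
    using summable_rabs_cancel[OF summable_coeff[OF that, of 1]] by (simp add: divide_inverse mult.commute)
  have span: "(\<integral>\<phi>. s \<phi> \<partial>Q') = (\<Sum>n. coeff h n s / fact n)" if s: "s \<in> exp_span R" for s
  proof -
    obtain m c u where *: "tilt_span R Q0 Q g m u" "s = (\<lambda>\<phi>. \<Sum>i<m. c i * exp_fun (u i) \<phi>)"
      using exp_span_tilt[OF s] .
    interpret S: tilt_span R Q0 Q g m c u by fact
    let ?q = "\<lambda>i. \<integral>x. S.v i x * h x \<partial>R"
    have "(\<integral>\<phi>. s \<phi> \<partial>Q') = (\<Sum>i<m. c i * (\<integral>\<phi>. exp_fun (u i) \<phi> \<partial>Q'))"
      unfolding * using exp_fun_integrable[OF Q'.Q.prob_space_axioms Q'.sets_Q S.u]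
      by (simp add: Bochner_Integration.integral_sum)
    also have "\<dots> = (\<Sum>i<m. S.b i * exp (?q i))"
    proof (intro sum.cong refl)
      fix i assume "i \<in> {..<m}"
      then have i: "i < m" by simp
      have "(\<integral>x. S.v i x * (g x + h x) \<partial>R) = (\<integral>x. S.v i x * g x \<partial>R) + ?q i"
        using integrable_mult_L2[OF S.meas g(1) S.sq g(2)] integrable_mult_L2[OF S.meas h(1) S.sq h(2)] i
        by (simp add: distrib_left)
      then show "c i * (\<integral>\<phi>. exp_fun (u i) \<phi> \<partial>Q') = S.b i * exp (?q i)"
        by (simp add: Q'.expectation_Q[OF S.u[OF i]] S.a_def S.b_def exp_add mult_ac)
    qed
    finally have 1: "(\<integral>\<phi>. s \<phi> \<partial>Q') = (\<Sum>i<m. S.b i * exp (?q i))" .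
    have "(\<lambda>n. \<Sum>i<m. S.b i * (?q i ^ n /\<^sub>R fact n)) sums (\<Sum>i<m. S.b i * exp (?q i))"
      by (intro sums_sum sums_mult exp_converges)
    moreover have "(\<Sum>i<m. S.b i * (?q i ^ n /\<^sub>R fact n)) = coeff h n s / fact n" for n
      unfolding coeff_def * S.integral_mean_diff_s[OF h] by (simp add: sum_distrib_left divide_inverse mult_ac)
    ultimately show ?thesis using 1 by (simp add: sums_iff)
  qed
  let ?L = "\<lambda>f. (\<integral>\<phi>. f \<phi> \<partial>Q') - (\<Sum>n. coeff h n f / fact n)"
  \<comment> \<open>The first summand bounds the mean under \<open>Q'\<close>, by the case n = 0 for
    the tilt g + h; the second bounds the series.\<close>
  let ?C = "tilt_const R (\<lambda>x. g x + h x) 0 + (\<Sum>n. tilt_const R g n * L2_norm R h ^ n / fact n)"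
  have C: "0 \<le> ?C"
    by (intro add_nonneg_nonneg suminf_nonneg summable_tilt_const) auto
  have L_bound: "\<bar>?L f\<bar> \<le> ?C * L2_norm Q0 f" if "square_integrable f" for f
  proof -
    have "\<bar>\<integral>\<phi>. f \<phi> \<partial>Q'\<bar> \<le> tilt_const R (\<lambda>x. g x + h x) 0 * L2_norm Q0 f"
      using that unfolding square_integrable_def by (intro Q'.Q_integrable(2)) auto
    then show ?thesis
      using suminf_coeff_bound[OF that] unfolding distrib_right by linarith
  qed
  have "\<bar>?L f\<bar> \<le> 0 + e" if e: "0 < e" for e
  proof -
    have "0 < e / (?C + 1)" using e C by simp
    then obtain s where s: "s \<in> exp_span R" "L2_norm Q0 (\<lambda>\<phi>. f \<phi> - s \<phi>) < e / (?C + 1)"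
      using square_integrable_approx[OF f] by blast
    note ss = square_integrable_span[OF s(1)]
    have i: "integrable Q' f" "integrable Q' s"
      using f ss unfolding square_integrable_def by (auto intro: Q'.Q_integrable(1))
    have "(\<Sum>n. coeff h n (\<lambda>\<phi>. f \<phi> - s \<phi>) / fact n) = (\<Sum>n. coeff h n f / fact n - coeff h n s / fact n)"
      by (simp add: coeff_diff[OF f ss] diff_divide_distrib)
    also have "\<dots> = (\<Sum>n. coeff h n f / fact n) - (\<Sum>n. coeff h n s / fact n)"
      by (rule suminf_diff[symmetric, OF sums[OF f] sums[OF ss]])
    finally have "?L (\<lambda>\<phi>. f \<phi> - s \<phi>) = ?L f - ?L s" using i by simp
    then have "\<bar>?L f\<bar> = \<bar>?L (\<lambda>\<phi>. f \<phi> - s \<phi>)\<bar>" using span[OF s(1)] by simp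
    also have "\<dots> \<le> ?C * L2_norm Q0 (\<lambda>\<phi>. f \<phi> - s \<phi>)"
      by (intro L_bound square_integrable_diff f ss)
    also have "\<dots> \<le> ?C * (e / (?C + 1))"
      using s(2) C by (intro mult_left_mono) auto
    also have "\<dots> \<le> e"
      using e C by (simp add: pos_divide_le_eq distrib_left mult.commute)
    finally show ?thesis by simp
  qed
  then have "\<bar>?L f\<bar> \<le> 0" by (rule field_le_epsilon)
  then show ?thesis by simp
qed

end

end

text \<open>The theorem builds difference operators on X, the locales on \<rho>. Only the common
  measurable structure enters.\<close>

lemma add_points_cong: "sets X = sets Y \<Longrightarrow> add_points X = add_points Y"
  by (intro ext) (simp add: add_points_def return_cong[of X Y] sets_eq_imp_space_eq[of X Y])

lemma diff_op_cong: "sets X = sets Y \<Longrightarrow> diff_op X = diff_op Y"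
  by (intro ext) (simp add: diff_op_def add_points_cong[of X Y])

lemma diff1_cong: "sets X = sets Y \<Longrightarrow> diff1 X = diff1 Y"
  by (intro ext) (simp add: diff1_def diff_op_cong[of X Y])

lemma diff_op_eq_diff1: "diff_op X 1 x f \<phi> = diff1 X (x 1) f \<phi>"
proof -
  have "Pow {1..1::nat} = {{}, {1}}" by auto
  then show ?thesis by (simp add: diff1_def diff_op_def add_points_def)
qed

text \<open>Measurability at fixed points allows the change of variables between \<Omega> and the
  space of configurations.\<close>

lemma diff_op_measurable_configuration:
  assumes "f \<in> borel_measurable (counting_space R)" "x \<in> space (PiM {1..n} (\<lambda>_. R))"
  shows "diff_op R n x f \<in> borel_measurable (counting_space R)"
  using measurable_compose[OF measurable_Pair1'[OF assms(2)] diff_op_measurable[OF assms(1)]] by simp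

lemma diff1_measurable_configuration:
  assumes "f \<in> borel_measurable (counting_space R)" "y \<in> space R"
  shows "diff1 R y f \<in> borel_measurable (counting_space R)"
proof -
  have "diff_op R 1 (\<lambda>i\<in>{1}. y) f \<in> borel_measurable (counting_space R)"
    using assms by (intro diff_op_measurable_configuration) (auto simp: space_PiM)
  moreover have "diff_op R 1 (\<lambda>i\<in>{1}. y) f = diff1 R y f"
    by (rule ext) (simp add: diff_op_eq_diff1 del: One_nat_def)
  ultimately show ?thesis by simp
qed

section \<open>Coefficients of order zero and one, and the derivative of the series\<close>

context poisson_tilt
begin

lemma mean_diff_0: "mean_diff 0 f x = (\<integral>\<phi>. f \<phi> \<partial>Q)"
  unfolding mean_diff_def
proof (intro Bochner_Integration.integral_cong refl)
  fix \<phi> assume "\<phi> \<in> space Q"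
  then have "sets \<phi> = sets R" by (simp add: space_Q counting_measuresD)
  then have "add_points R \<phi> x {} = \<phi>"
    by (intro measure_eqI) (auto simp: emeasure_add_points)
  then show "diff_op R 0 x f \<phi> = f \<phi>" by (simp add: diff_op_def)
qed

text \<open>The index set {1..0} is empty: the product measure is a unit mass and the product of the
  h (x j) is 1.\<close>

lemma coeff_0: "coeff h 0 f = (\<integral>\<phi>. f \<phi> \<partial>Q)"
  by (simp add: coeff_def mean_diff_0 PiM_empty lebesgue_integral_count_space_finite)

lemma coeff_scale: "coeff (\<lambda>x. c * h x) n f = c ^ n * coeff h n f"
  by (simp add: coeff_def prod.distrib mult_ac flip: integral_mult_right_zero)

text \<open>R is identified with its product over the index set {1}, and the general statements are
  transported along y |-> (1 |-> y). At order 1 the operator reads x only at index 1.\<close>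

lemma
  assumes f: "square_integrable f"
  shows mean_diff1_AE_integrable: "AE y in R. integrable Q (diff1 R y f)"
    and mean_diff1_measurable: "(\<lambda>y. \<integral>\<phi>. diff1 R y f \<phi> \<partial>Q) \<in> borel_measurable R"
proof -
  have m: "(\<lambda>y. \<lambda>i\<in>{1::nat}. y) \<in> measurable R (PiM {1::nat} (\<lambda>_. R))"
    by (rule measurable_restrict) simp
  have "AE x in distr R (PiM {1::nat} (\<lambda>_. R)) (\<lambda>y. \<lambda>i\<in>{1::nat}. y). integrable Q (diff_op R 1 x f)"
    unfolding prod.distr_component using mean_diff_AE_integrable[OF f, of 1] unfolding atLeastAtMost_singleton .
  from AE_distrD[OF m this] show "AE y in R. integrable Q (diff1 R y f)"
  proof eventually_elim
    case (elim y)
    moreover have "diff_op R 1 (\<lambda>i\<in>{1}. y) f = diff1 R y f"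
      by (rule ext) (simp add: diff_op_eq_diff1 del: One_nat_def)
    ultimately show ?case by simp
  qed
  have "mean_diff 1 f \<in> borel_measurable (PiM {1::nat} (\<lambda>_. R))"
    using mean_diff_measurable[OF f, of 1] by (simp del: One_nat_def)
  from measurable_compose[OF m this] show "(\<lambda>y. \<integral>\<phi>. diff1 R y f \<phi> \<partial>Q) \<in> borel_measurable R"
    by (simp add: mean_diff_def diff_op_eq_diff1 del: One_nat_def)
qed

lemma
  assumes f: "square_integrable f" and h: "h \<in> borel_measurable R" "integrable R (\<lambda>x. (h x)\<^sup>2)"
  shows mean_diff1_integrable: "integrable R (\<lambda>y. (\<integral>\<phi>. diff1 R y f \<phi> \<partial>Q) * h y)"
    and coeff_1: "coeff h 1 f = (\<integral>y. (\<integral>\<phi>. diff1 R y f \<phi> \<partial>Q) * h y \<partial>R)"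
proof -
  let ?G = "\<lambda>y. (\<integral>\<phi>. diff1 R y f \<phi> \<partial>Q) * h y"
  have G: "?G \<in> borel_measurable R"
    by (intro borel_measurable_times mean_diff1_measurable f h)
  have eq: "mean_diff 1 f x * (\<Prod>j=1..1. h (x j)) = ?G (x 1)" for x
    by (simp add: mean_diff_def diff_op_eq_diff1 del: One_nat_def)
  have "integrable (PiM {1::nat} (\<lambda>_. R)) (\<lambda>x. ?G (x 1))"
    using coeff_integrable[OF h f, of 1] unfolding eq by (simp del: One_nat_def)
  then have "integrable (distr (PiM {1::nat} (\<lambda>_. R)) R (\<lambda>x. x 1)) ?G"
    by (subst integrable_distr_eq) (use G in auto)
  then show "integrable R ?G" by (simp only: prod.distr_singleton)
  show "coeff h 1 f = (\<integral>y. ?G y \<partial>R)"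
    unfolding coeff_def eq using prod.product_integral_singleton[OF G, of 1] by (simp del: One_nat_def)
qed

text \<open>The coefficient of order n is homogeneous of degree n in h, so the expansion in
  direction c h is a power series in c.\<close>

lemma expansion_scaled:
  assumes f: "square_integrable f" and h: "h \<in> borel_measurable R" "integrable R (\<lambda>x. (h x)\<^sup>2)"
    and Q': "poisson_tilt R Q0 Q' (\<lambda>x. g x + c * h x)"
  shows "(\<integral>\<phi>. f \<phi> \<partial>Q') = (\<Sum>n. coeff h n f / fact n * c ^ n)"
proof -
  have "(\<lambda>x. c * h x) \<in> borel_measurable R" "integrable R (\<lambda>x. (c * h x)\<^sup>2)"
    using h by (auto simp: power_mult_distrib)
  from expansion[OF this Q' f] show ?thesis
    by (simp add: coeff_scale mult_ac)
qed

text \<open>The power series converges everywhere, so it is differentiable at its centre on both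
  sides, with the linear coefficient as derivative. One-sidedness enters only when it is compared
  with the expectation.\<close>

lemma coeff_series_deriv:
  assumes f: "square_integrable f" and h: "h \<in> borel_measurable R" "integrable R (\<lambda>x. (h x)\<^sup>2)"
  shows "((\<lambda>t. \<Sum>n. coeff h n f / fact n * (t - a) ^ n) has_real_derivative coeff h 1 f) (at a)"
proof -
  have "summable (\<lambda>n. coeff h n f / fact n * y ^ n)" for y
    using summable_rabs_cancel[OF summable_coeff[OF h f, of y]] by (simp add: mult_ac)
  from termdiffs_strong_converges_everywhere[OF this, of 0]
  have "((\<lambda>t. \<Sum>n. coeff h n f / fact n * t ^ n) has_real_derivative coeff h 1 f) (at (a - a))"
    unfolding powser_zero by (simp add: diffs_def)
  then show ?thesis
    by (rule DERIV_chain'[where f="\<lambda>t. t - a" and D=1, simplified, rotated])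
       (auto intro!: derivative_eq_intros)
qed

end

theorem theorem6p1:
  fixes X :: "'a measure" and \<Omega> :: "'w measure"
    and \<Phi> :: "'w \<Rightarrow> 'a measure" and P :: "'a measure \<Rightarrow> 'w measure"
    and lam \<rho> :: "'a measure" and hlam h :: "'a \<Rightarrow> real"
    and \<theta>0 :: real and I :: "real set" and f :: "'a measure \<Rightarrow> real"
  assumes \<Phi>: "\<Phi> \<in> measurable \<Omega> (counting_space X)"
    and P: "\<And>\<mu>. sets \<mu> = sets X \<Longrightarrow> sigma_finite_measure \<mu> \<Longrightarrow>
              prob_space (P \<mu>) \<and> sets (P \<mu>) = sets \<Omega> \<and>
              poisson_law \<mu> (distr (P \<mu>) (counting_space X) \<Phi>)"
    and \<rho>: "sets \<rho> = sets X" "sigma_finite_measure \<rho>"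
    and lam: "sets lam = sets X" "sigma_finite_measure lam"
    and ac: "absolutely_continuous \<rho> lam"
    and hlam: "hlam \<in> borel_measurable X" "lam = density \<rho> (\<lambda>x. ennreal (hlam x))"
    and h: "h \<in> borel_measurable X"
    and L2: "(\<integral>\<^sup>+x. ennreal ((1 - hlam x)\<^sup>2) \<partial>\<rho>) + (\<integral>\<^sup>+x. ennreal ((h x)\<^sup>2) \<partial>\<rho>) < \<infinity>"
    and I: "is_interval I" "interior I \<noteq> {}" "\<theta>0 \<in> I"
    and nonneg: "\<And>\<theta>. \<theta> \<in> I \<Longrightarrow> AE x in \<rho>. 0 \<le> hlam x + (\<theta> - \<theta>0) * h x"
    and f: "f \<in> borel_measurable (counting_space X)"
    and fL2: "(\<integral>\<^sup>+\<omega>. ennreal ((f (\<Phi> \<omega>))\<^sup>2) \<partial>P \<rho>) < \<infinity>"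
  shows
    \<comment> \<open>all expectations and integrals below exist\<close>
    "(\<forall>\<theta>\<in>I. integrable (P (perturbed \<rho> hlam h \<theta>0 \<theta>)) (\<lambda>\<omega>. f (\<Phi> \<omega>))) \<and>
     integrable (P lam) (\<lambda>\<omega>. f (\<Phi> \<omega>)) \<and>
     (\<forall>n\<ge>1.
        (AE x in Pi\<^sub>M {1..n} (\<lambda>_. \<rho>). (\<Prod>j=1..n. h (x j)) \<noteq> 0 \<longrightarrow>
           integrable (P lam) (\<lambda>\<omega>. diff_op X n x f (\<Phi> \<omega>))) \<and>
        integrable (Pi\<^sub>M {1..n} (\<lambda>_. \<rho>))
          (\<lambda>x. (\<integral>\<omega>. diff_op X n x f (\<Phi> \<omega>) \<partial>P lam) * (\<Prod>j=1..n. h (x j)))) \<and>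
     (\<forall>\<theta>\<in>I.
        (AE x in \<rho>. h x \<noteq> 0 \<longrightarrow>
           integrable (P (perturbed \<rho> hlam h \<theta>0 \<theta>)) (\<lambda>\<omega>. diff1 X x f (\<Phi> \<omega>))) \<and>
        integrable \<rho>
          (\<lambda>x. (\<integral>\<omega>. diff1 X x f (\<Phi> \<omega>) \<partial>P (perturbed \<rho> hlam h \<theta>0 \<theta>)) * h x)) \<and>
     \<comment> \<open>the series expansion\<close>
     (\<forall>\<theta>\<in>I.
        summable (\<lambda>k. \<bar>(\<theta> - \<theta>0) ^ Suc k / fact (Suc k) *
          (\<integral>x. (\<integral>\<omega>. diff_op X (Suc k) x f (\<Phi> \<omega>) \<partial>P lam) * (\<Prod>j=1..Suc k. h (x j))
             \<partial>Pi\<^sub>M {1..Suc k} (\<lambda>_. \<rho>))\<bar>) \<and>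
        (\<integral>\<omega>. f (\<Phi> \<omega>) \<partial>P (perturbed \<rho> hlam h \<theta>0 \<theta>)) =
          (\<integral>\<omega>. f (\<Phi> \<omega>) \<partial>P lam) +
          (\<Sum>k. (\<theta> - \<theta>0) ^ Suc k / fact (Suc k) *
            (\<integral>x. (\<integral>\<omega>. diff_op X (Suc k) x f (\<Phi> \<omega>) \<partial>P lam) * (\<Prod>j=1..Suc k. h (x j))
               \<partial>Pi\<^sub>M {1..Suc k} (\<lambda>_. \<rho>)))) \<and>
     \<comment> \<open>the derivative, one-sided at an endpoint of the interval\<close>
     (\<forall>\<theta>\<in>I.
        ((\<lambda>t. \<integral>\<omega>. f (\<Phi> \<omega>) \<partial>P (perturbed \<rho> hlam h \<theta>0 t)) has_real_derivative
          (\<integral>x. (\<integral>\<omega>. diff1 X x f (\<Phi> \<omega>) \<partial>P (perturbed \<rho> hlam h \<theta>0 \<theta>)) * h x \<partial>\<rho>))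
          (at \<theta> within I))"
proof -
  interpret \<rho>: sigma_finite_measure \<rho> by (rule \<rho>(2))
  define \<mu> where "\<mu> = perturbed \<rho> hlam h \<theta>0"
  define Q where "Q \<nu> = distr (P \<nu>) (counting_space X) \<Phi>" for \<nu>
  \<comment> \<open>This is h_\<theta> - 1. It is square integrable because \<open>hlam\<close> - 1
    and h are.\<close>
  define g where "g \<theta> x = hlam x - 1 + (\<theta> - \<theta>0) * h x" for \<theta> x
  have N: "counting_space X = counting_space \<rho>" by (rule counting_space_cong[OF \<rho>(1)[symmetric]])
  have D: "diff_op X = diff_op \<rho>" "diff1 X = diff1 \<rho>"
    using \<rho>(1) by (auto intro!: diff_op_cong diff1_cong)
  have meas: "hlam \<in> borel_measurable \<rho>" "h \<in> borel_measurable \<rho>" "f \<in> borel_measurable (counting_space \<rho>)"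
    using hlam(1) h f by (simp_all add: measurable_cong_sets[OF \<rho>(1) refl] N)
  have \<mu>: "\<mu> \<theta> = density \<rho> (\<lambda>x. ennreal (1 + g \<theta> x))" for \<theta>
    by (simp add: \<mu>_def perturbed_def g_def)
  have lam_eq: "lam = \<mu> \<theta>0" using hlam(2) by (simp add: \<mu>_def perturbed_def)
  have g_meas: "g \<theta> \<in> borel_measurable \<rho>" for \<theta>
    unfolding g_def[abs_def] using meas by measurable
  have sq: "integrable \<rho> (\<lambda>x. (hlam x - 1)\<^sup>2)" "integrable \<rho> (\<lambda>x. (h x)\<^sup>2)"
    using L2 meas by (auto intro!: integrableI_nonneg simp: power2_commute[of _ 1])
  have g_sq: "integrable \<rho> (\<lambda>x. (g \<theta> x)\<^sup>2)" for \<theta>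
    unfolding g_def using sq meas by (intro integrable_add_L2) (auto simp: power_mult_distrib)
  have sets\<mu>: "sets (\<mu> \<theta>) = sets X" for \<theta> by (simp add: \<mu> \<rho>(1))
  \<comment> \<open>Valid for every real \<theta>: the density is finite everywhere, and
    \<open>ennreal\<close> sends negative values to 0.\<close>
  have sf\<mu>: "sigma_finite_measure (\<mu> \<theta>)" for \<theta>
    unfolding \<mu> using g_meas by (subst \<rho>.sigma_finite_iff_density_finite) auto
  have tilt: "poisson_tilt \<rho> (Q \<rho>) (Q (\<mu> \<theta>)) (g \<theta>)" if "\<theta> \<in> I" for \<theta>
  proof (intro poisson_tilt.intro poisson_tilt_axioms.intro \<rho>(2) g_meas g_sq)
    show "poisson_law \<rho> (Q \<rho>)" using P[OF \<rho>] by (simp add: Q_def)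
    show "poisson_law (density \<rho> (\<lambda>x. ennreal (1 + g \<theta> x))) (Q (\<mu> \<theta>))"
      using P[OF sets\<mu> sf\<mu>, of \<theta>] unfolding \<mu> by (simp add: Q_def)
    show "AE x in \<rho>. 0 \<le> 1 + g \<theta> x"
      using nonneg[OF that] by eventually_elim (simp add: g_def)
  qed
  have \<Phi>\<mu>: "\<Phi> \<in> measurable (P \<nu>) (counting_space \<rho>)" if "sets \<nu> = sets X" "sigma_finite_measure \<nu>" for \<nu>
    using \<Phi> P[OF that] by (simp add: N measurable_cong_sets[of "P \<nu>" \<Omega> _ "counting_space \<rho>"])
  \<comment> \<open>The locales speak of laws on configurations, the theorem of expectations on
    \<Omega>; every statement passes through this change of variables.\<close>
  have transfer: "integrable (P (\<mu> \<theta>)) (\<lambda>\<omega>. k (\<Phi> \<omega>)) \<longleftrightarrow> integrable (Q (\<mu> \<theta>)) k"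
    "(\<integral>\<omega>. k (\<Phi> \<omega>) \<partial>P (\<mu> \<theta>)) = (\<integral>\<phi>. k \<phi> \<partial>Q (\<mu> \<theta>))"
    if "k \<in> borel_measurable (counting_space \<rho>)" for k :: "'a measure \<Rightarrow> real" and \<theta>
    unfolding Q_def N
    using integrable_distr_eq[OF \<Phi>\<mu>[OF sets\<mu> sf\<mu>] that] integral_distr[OF \<Phi>\<mu>[OF sets\<mu> sf\<mu>] that]
    by auto
  have f_sq: "integrable (Q \<rho>) (\<lambda>\<phi>. (f \<phi>)\<^sup>2)"
    unfolding Q_def N
    using fL2 \<Phi>\<mu>[OF \<rho>] meas(3) measurable_compose[OF \<Phi>\<mu>[OF \<rho>] meas(3)]
    by (subst integrable_distr_eq) (auto intro!: integrableI_nonneg)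
  have fs: "poisson_tilt.square_integrable \<rho> (Q \<rho>) f" if "\<theta> \<in> I" for \<theta>
    using poisson_tilt.square_integrable_def[OF tilt[OF that]] meas(3) f_sq by blast
  have md: "poisson_tilt.mean_diff \<rho> (Q (\<mu> \<theta>)) n f x = (\<integral>\<omega>. diff_op X n x f (\<Phi> \<omega>) \<partial>P (\<mu> \<theta>))"
    if "\<theta> \<in> I" "x \<in> space (PiM {1..n} (\<lambda>_. \<rho>))" for \<theta> n x
    unfolding poisson_tilt.mean_diff_def[OF tilt[OF that(1)]] D
    by (rule transfer(2)[symmetric, OF diff_op_measurable_configuration[OF meas(3) that(2)]])
  have co: "poisson_tilt.coeff \<rho> (Q (\<mu> \<theta>)) h n f =
      (\<integral>x. (\<integral>\<omega>. diff_op X n x f (\<Phi> \<omega>) \<partial>P (\<mu> \<theta>)) * (\<Prod>j=1..n. h (x j)) \<partial>PiM {1..n} (\<lambda>_. \<rho>))"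
    if "\<theta> \<in> I" for \<theta> n
    unfolding poisson_tilt.coeff_def[OF tilt[OF that]]
    by (intro Bochner_Integration.integral_cong refl) (simp add: md[OF that])
  have d1: "(\<integral>\<phi>. diff1 \<rho> y f \<phi> \<partial>Q (\<mu> \<theta>)) = (\<integral>\<omega>. diff1 X y f (\<Phi> \<omega>) \<partial>P (\<mu> \<theta>))" if "y \<in> space \<rho>" for \<theta> y
    unfolding D by (rule transfer(2)[symmetric, OF diff1_measurable_configuration[OF meas(3) that]])
  have exists: "integrable (P (\<mu> \<theta>)) (\<lambda>\<omega>. f (\<Phi> \<omega>))" if "\<theta> \<in> I" for \<theta>
    unfolding transfer(1)[OF meas(3)] by (rule poisson_tilt.Q_integrable(1)[OF tilt[OF that] meas(3) f_sq])
  have diff_n: "AE x in PiM {1..n} (\<lambda>_. \<rho>). integrable (P lam) (\<lambda>\<omega>. diff_op X n x f (\<Phi> \<omega>))"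
    "integrable (PiM {1..n} (\<lambda>_. \<rho>)) (\<lambda>x. (\<integral>\<omega>. diff_op X n x f (\<Phi> \<omega>) \<partial>P lam) * (\<Prod>j=1..n. h (x j)))" for n
  proof -
    show "AE x in PiM {1..n} (\<lambda>_. \<rho>). integrable (P lam) (\<lambda>\<omega>. diff_op X n x f (\<Phi> \<omega>))"
      using poisson_tilt.mean_diff_AE_integrable[OF tilt[OF I(3)] fs[OF I(3)], of n] AE_space
      unfolding D lam_eq
      by eventually_elim (simp add: transfer(1)[OF diff_op_measurable_configuration[OF meas(3)]])
    show "integrable (PiM {1..n} (\<lambda>_. \<rho>)) (\<lambda>x. (\<integral>\<omega>. diff_op X n x f (\<Phi> \<omega>) \<partial>P lam) * (\<Prod>j=1..n. h (x j)))"
      using poisson_tilt.coeff_integrable[OF tilt[OF I(3)] meas(2) sq(2) fs[OF I(3)], of n]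
      unfolding lam_eq
      by (rule iffD1[OF Bochner_Integration.integrable_cong, rotated -1]) (simp_all add: md[OF I(3)])
  qed
  have diff_1: "AE x in \<rho>. integrable (P (\<mu> \<theta>)) (\<lambda>\<omega>. diff1 X x f (\<Phi> \<omega>))"
    "integrable \<rho> (\<lambda>x. (\<integral>\<omega>. diff1 X x f (\<Phi> \<omega>) \<partial>P (\<mu> \<theta>)) * h x)"
    "poisson_tilt.coeff \<rho> (Q (\<mu> \<theta>)) h 1 f = (\<integral>x. (\<integral>\<omega>. diff1 X x f (\<Phi> \<omega>) \<partial>P (\<mu> \<theta>)) * h x \<partial>\<rho>)"
    if \<theta>: "\<theta> \<in> I" for \<theta>
  proof -
    show "AE x in \<rho>. integrable (P (\<mu> \<theta>)) (\<lambda>\<omega>. diff1 X x f (\<Phi> \<omega>))"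
      using poisson_tilt.mean_diff1_AE_integrable[OF tilt[OF \<theta>] fs[OF \<theta>]] AE_space
      unfolding D by eventually_elim (simp add: transfer(1)[OF diff1_measurable_configuration[OF meas(3)]])
    show "integrable \<rho> (\<lambda>x. (\<integral>\<omega>. diff1 X x f (\<Phi> \<omega>) \<partial>P (\<mu> \<theta>)) * h x)"
      using poisson_tilt.mean_diff1_integrable[OF tilt[OF \<theta>] fs[OF \<theta>] meas(2) sq(2)]
      by (rule iffD1[OF Bochner_Integration.integrable_cong, rotated -1]) (simp_all add: d1)
    show "poisson_tilt.coeff \<rho> (Q (\<mu> \<theta>)) h 1 f = (\<integral>x. (\<integral>\<omega>. diff1 X x f (\<Phi> \<omega>) \<partial>P (\<mu> \<theta>)) * h x \<partial>\<rho>)"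
      unfolding poisson_tilt.coeff_1[OF tilt[OF \<theta>] fs[OF \<theta>] meas(2) sq(2)]
      by (intro Bochner_Integration.integral_cong refl) (simp add: d1)
  qed
  \<comment> \<open>Since h_t - 1 = (h_\<theta> - 1) + (t - \<theta>) h, every point of I can be the
    base point. Base \<theta>0 gives the expansion of the theorem, base \<theta> its
    derivative.\<close>
  have series: "(\<integral>\<omega>. f (\<Phi> \<omega>) \<partial>P (\<mu> t)) = (\<Sum>n. poisson_tilt.coeff \<rho> (Q (\<mu> \<theta>)) h n f / fact n * (t - \<theta>) ^ n)"
    if \<theta>: "\<theta> \<in> I" and t: "t \<in> I" for \<theta> t
  proof -
    have "g t = (\<lambda>x. g \<theta> x + (t - \<theta>) * h x)"
      by (rule ext) (simp add: g_def algebra_simps)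
    then have "poisson_tilt \<rho> (Q \<rho>) (Q (\<mu> t)) (\<lambda>x. g \<theta> x + (t - \<theta>) * h x)"
      using tilt[OF t] by simp
    from poisson_tilt.expansion_scaled[OF tilt[OF \<theta>] fs[OF \<theta>] meas(2) sq(2) this]
    show ?thesis unfolding transfer(2)[OF meas(3)] .
  qed
  have expansion: "summable (\<lambda>k. \<bar>(\<theta> - \<theta>0) ^ Suc k / fact (Suc k) *
        (\<integral>x. (\<integral>\<omega>. diff_op X (Suc k) x f (\<Phi> \<omega>) \<partial>P lam) * (\<Prod>j=1..Suc k. h (x j)) \<partial>PiM {1..Suc k} (\<lambda>_. \<rho>))\<bar>) \<and>
      (\<integral>\<omega>. f (\<Phi> \<omega>) \<partial>P (\<mu> \<theta>)) = (\<integral>\<omega>. f (\<Phi> \<omega>) \<partial>P lam) +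
        (\<Sum>k. (\<theta> - \<theta>0) ^ Suc k / fact (Suc k) *
          (\<integral>x. (\<integral>\<omega>. diff_op X (Suc k) x f (\<Phi> \<omega>) \<partial>P lam) * (\<Prod>j=1..Suc k. h (x j)) \<partial>PiM {1..Suc k} (\<lambda>_. \<rho>)))"
    if \<theta>: "\<theta> \<in> I" for \<theta>
  proof -
    define c where "c n = (\<theta> - \<theta>0) ^ n / fact n * poisson_tilt.coeff \<rho> (Q lam) h n f" for n
    have ck: "(\<theta> - \<theta>0) ^ Suc k / fact (Suc k) *
        (\<integral>x. (\<integral>\<omega>. diff_op X (Suc k) x f (\<Phi> \<omega>) \<partial>P lam) * (\<Prod>j=1..Suc k. h (x j)) \<partial>PiM {1..Suc k} (\<lambda>_. \<rho>)) = c (Suc k)" for k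
      unfolding c_def lam_eq co[OF I(3)] ..
    have s: "summable (\<lambda>n. \<bar>c n\<bar>)"
      using poisson_tilt.summable_coeff[OF tilt[OF I(3)] meas(2) sq(2) fs[OF I(3)], of "\<theta> - \<theta>0"]
      unfolding c_def lam_eq .
    have "(\<integral>\<omega>. f (\<Phi> \<omega>) \<partial>P (\<mu> \<theta>)) = (\<Sum>n. c n)"
      unfolding series[OF I(3) \<theta>] c_def lam_eq by (simp add: mult_ac)
    \<comment> \<open>The term of order 0 is the mean under \<open>lam\<close>; the series of the
      theorem starts at n = 1, which is k = 0.\<close>
    also have "\<dots> = c 0 + (\<Sum>k. c (Suc k))"
      using suminf_split_head[OF summable_rabs_cancel[OF s]] by simp
    also have "c 0 = (\<integral>\<omega>. f (\<Phi> \<omega>) \<partial>P lam)"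
      unfolding c_def lam_eq transfer(2)[OF meas(3)] by (simp add: poisson_tilt.coeff_0[OF tilt[OF I(3)]])
    finally have "(\<integral>\<omega>. f (\<Phi> \<omega>) \<partial>P (\<mu> \<theta>)) = (\<integral>\<omega>. f (\<Phi> \<omega>) \<partial>P lam) + (\<Sum>k. c (Suc k))" .
    moreover have "summable (\<lambda>k. \<bar>c (Suc k)\<bar>)" using s by (subst summable_Suc_iff)
    ultimately show ?thesis unfolding ck by blast
  qed
  have deriv: "((\<lambda>t. \<integral>\<omega>. f (\<Phi> \<omega>) \<partial>P (\<mu> t)) has_real_derivative
      (\<integral>x. (\<integral>\<omega>. diff1 X x f (\<Phi> \<omega>) \<partial>P (\<mu> \<theta>)) * h x \<partial>\<rho>)) (at \<theta> within I)" if \<theta>: "\<theta> \<in> I" for \<theta>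
  \<comment> \<open>The radius 1 is arbitrary, because expectation and series agree on all of I.
    Restricting the two-sided derivative of the series to I gives the one-sided derivative at an
    endpoint.\<close>
  proof (rule has_field_derivative_transform_within[OF _ zero_less_one \<theta>])
    show "((\<lambda>t. \<Sum>n. poisson_tilt.coeff \<rho> (Q (\<mu> \<theta>)) h n f / fact n * (t - \<theta>) ^ n) has_real_derivative
        (\<integral>x. (\<integral>\<omega>. diff1 X x f (\<Phi> \<omega>) \<partial>P (\<mu> \<theta>)) * h x \<partial>\<rho>)) (at \<theta> within I)"
      using poisson_tilt.coeff_series_deriv[OF tilt[OF \<theta>] fs[OF \<theta>] meas(2) sq(2), of \<theta>]
      unfolding diff_1(3)[OF \<theta>] by (rule has_field_derivative_at_within)
  qed (simp add: series[OF \<theta>])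
  have lam_int: "integrable (P lam) (\<lambda>\<omega>. f (\<Phi> \<omega>))"
    unfolding lam_eq by (rule exists[OF I(3)])
  show ?thesis
    unfolding \<mu>_def[symmetric]
  proof (intro conjI ballI allI impI)
    fix n :: nat
    show "AE x in PiM {1..n} (\<lambda>_. \<rho>). (\<Prod>j=1..n. h (x j)) \<noteq> 0 \<longrightarrow>
        integrable (P lam) (\<lambda>\<omega>. diff_op X n x f (\<Phi> \<omega>))"
      using diff_n(1)[of n] by eventually_elim simp
  next
    fix \<theta> assume \<theta>: "\<theta> \<in> I"
    show "AE x in \<rho>. h x \<noteq> 0 \<longrightarrow> integrable (P (\<mu> \<theta>)) (\<lambda>\<omega>. diff1 X x f (\<Phi> \<omega>))"
      using diff_1(1)[OF \<theta>] by eventually_elim simp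
  qed (use exists lam_int diff_n(2) diff_1(2) expansion deriv in blast)+
qed

end
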